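(* Let $\mu$ be an integer-valued random measure on $[0,T]\times\mathbb{R}$ with compensator $\nu$ such that $J=K$ up to an evanescent set. Let $X$ be an adapted càdlàg process with a decomposition $X=X^i+X^p$ such that: 1. $X^i$ is a càdlàg quasi-left-continuous adapted process with $\{\Delta X^i\neq 0\}\subset D$, and there exists a $\tilde{\mathcal P}$-measurable map $\tilde\gamma:\Omega\times]0,T]\times\mathbb{R}\to\mathbb{R}$ such that $\Delta X^i_t(\omega)\,1_{]0,T]}(t)=\tilde\gamma(\omega,t,e)$ for $M^{\mathbb P}_\mu$-almost every $(\omega,t,e)$; 2. $X^p$ is a càdlàg predictable process with $\{\Delta X^p\neq 0\}\subset J$. Let $\mu^X$ be the jump measure of $X$ and $\nu^X$ its compensator. Let $\varphi:\Omega\times[0,T]\times\mathbb{R}\to\mathbb{R}_+$ be a $\tilde{\mathcal P}$-measurable function such that $\varphi(\omega,s,0)=0$ for every $s\in[0,T]$, up to indistinguishability, and assume that there exists a $\tilde{\mathcal P}$-measurable subset $A$ of $\Omega\times[0,T]\times\mathbb{R}$ such that $$|\varphi|\,1_A\star\mu^X\in\mathcal A^+_{\rm loc},\qquad |\varphi|^2\,1_{A^c}\star\mu^X\in\mathcal A^+_{\rm loc}.$$ Then $$\int_{]0,\cdot]\times\mathbb{R}}\varphi(s,x)\,(\mu^X-\nu^X)(ds\,dx)=\int_{]0,\cdot]\times\mathbb{R}}\varphi(s,\tilde\gamma(s,e))\,(\mu-\nu)(ds\,de).$$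
   Context: Fix $T>0$ and a filtered probability space $(\Omega,\mathcal F,(\mathcal F_t),\mathbb P)$ satisfying the usual conditions, with $\mathcal F=\mathcal F_T$. Processes are indexed by $[0,T]$; càdlàg processes are extended to $\mathbb{R}_+$ by continuity. $\mathcal P$ is the predictable $\sigma$-field on $\Omega\times[0,T]$ and $\tilde{\mathcal P}=\mathcal P\otimes\mathcal B(\mathbb{R})$ on $\tilde\Omega=\Omega\times[0,T]\times\mathbb{R}$. $\mathcal A^+$ (resp. $\mathcal A^+_{\rm loc}$) is the class of adapted integrable (resp. locally integrable) increasing processes. Inclusions and equalities of random sets are understood up to an evanescent set (a set whose projection on $\Omega$ is $\mathbb P$-null). For a random measure $\mu$ on $[0,T]\times\mathbb{R}$ and a measurable function $H$ on $\tilde\Omega$, $H\star\mu_t=\int_{]0,t]\times\mathbb{R}}H(\cdot,s,e)\,\mu(\cdot,ds\,de)$. For an integer-valued random measure $\mu$ with compensator $\nu$ (with the version such that $\nu(\{t\}\times\mathbb{R})\le 1$ identically), $$D=\{(\omega,t):\mu(\omega,\{t\}\times\mathbb{R})>0\},\quad J=\{(\omega,t):\nu(\omega,\{t\}\times\mathbb{R})>0\},\quad K=\{(\omega,t):\nu(\omega,\{t\}\times\mathbb{R})=1\}.$$ $M^{\mathbb P}_\mu$ is the ($\sigma$-finite) measure on $\tilde\Omega$ given by $M^{\mathbb P}_\mu(W)=\mathbb E[W\star\mu_T]$ for nonnegative measurable $W$. A process $Y$ is quasi-left-continuous if $\Delta Y_S 1_{\{S<\infty\}}=0$ a.s. for every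 predictable time $S$. The jump measure of a càdlàg process $X$ is $\mu^X(dt\,dx)=\sum_{s\in]0,T]}1_{\{\Delta X_s\neq0\}}\delta_{(s,\Delta X_s)}(dt\,dx)$. For a $\tilde{\mathcal P}$-measurable $W$ put $\hat W_t=\int_{\mathbb{R}}W_t(e)\,\nu(\{t\},de)$ and $\tilde W_t=\int_{\mathbb{R}}W_t(e)\,\mu(\{t\},de)-\hat W_t$ (with $\tilde W_t=+\infty$ if $\hat W_t$ is not defined). $\mathcal G^q_{\rm loc}(\mu)$ is the set of $\tilde{\mathcal P}$-measurable $W$ such that $[\sum_{s\le\cdot}|\tilde W_s|^2]^{q/2}\in\mathcal A^+_{\rm loc}$. For $W\in\mathcal G^1_{\rm loc}(\mu)$, $\int_{]0,\cdot]\times\mathbb{R}}W_s(e)\,(\mu-\nu)(ds\,de)$ is the unique purely discontinuous local martingale null at $0$ whose jump process is indistinguishable from $\tilde W$. The same notation is used with $(\mu^X,\nu^X)$ in place of $(\mu,\nu)$. *)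

theory Defs
  imports "HOL-Probability.Probability"
begin

text \<open>
  Processes are curried functions of \<open>\<omega>\<close> and \<open>t\<close>, of which only the values on \<open>[0,T]\<close> matter;
  functions on \<open>\<Omega> \<times> [0,T] \<times> \<real>\<close> are curried functions of \<open>\<omega>\<close>, \<open>t\<close>, \<open>e\<close>. Random times take values in
  \<open>[0,\<infinity>]\<close>, rendered as \<^typ>\<open>ennreal\<close>.
\<close>

section \<open>Filtered probability spaces and processes\<close>

locale filtered_prob_space = prob_space M + complete_measure M
  for M :: "'a measure" +
  fixes F :: "real \<Rightarrow> 'a measure" and T :: real
  assumes T_pos: "0 < T"
    and F_subalgebra: "\<And>t. t \<in> {0..T} \<Longrightarrow> subalgebra M (F t)"
    and F_mono: "\<And>s t. 0 \<le> s \<Longrightarrow> s \<le> t \<Longrightarrow> t \<le> T \<Longrightarrow> sets (F s) \<subseteq> sets (F t)"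
    and F_complete: "null_sets M \<subseteq> sets (F 0)"
    and F_right_continuous: "\<And>t. t \<in> {0..<T} \<Longrightarrow> sets (F t) = (\<Inter>s\<in>{t<..T}. sets (F s))"
    and F_T: "sets (F T) = sets M"

definition indistinguishable ::
    "'a measure \<Rightarrow> real \<Rightarrow> ('a \<Rightarrow> real \<Rightarrow> 'b) \<Rightarrow> ('a \<Rightarrow> real \<Rightarrow> 'b) \<Rightarrow> bool" where
  "indistinguishable M T X Y \<longleftrightarrow> (AE \<omega> in M. \<forall>t\<in>{0..T}. X \<omega> t = Y \<omega> t)"

definition subset_ev :: "'a measure \<Rightarrow> real \<Rightarrow> ('a \<times> real) set \<Rightarrow> ('a \<times> real) set \<Rightarrow> bool" where
  "subset_ev M T A B \<longleftrightarrow> (AE \<omega> in M. \<forall>t\<in>{0..T}. (\<omega>, t) \<in> A \<longrightarrow> (\<omega>, t) \<in> B)"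

definition equal_ev :: "'a measure \<Rightarrow> real \<Rightarrow> ('a \<times> real) set \<Rightarrow> ('a \<times> real) set \<Rightarrow> bool" where
  "equal_ev M T A B \<longleftrightarrow> (AE \<omega> in M. \<forall>t\<in>{0..T}. (\<omega>, t) \<in> A \<longleftrightarrow> (\<omega>, t) \<in> B)"

definition adapted ::
    "(real \<Rightarrow> 'a measure) \<Rightarrow> real \<Rightarrow> ('a \<Rightarrow> real \<Rightarrow> 'b::topological_space) \<Rightarrow> bool" where
  "adapted F T X \<longleftrightarrow> (\<forall>t\<in>{0..T}. (\<lambda>\<omega>. X \<omega> t) \<in> borel_measurable (F t))"

definition cadlag :: "'a measure \<Rightarrow> real \<Rightarrow> ('a \<Rightarrow> real \<Rightarrow> real) \<Rightarrow> bool" where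
  "cadlag M T X \<longleftrightarrow> (\<forall>\<omega>\<in>space M.
     (\<forall>t\<in>{0..<T}. continuous (at_right t) (X \<omega>)) \<and>
     (\<forall>t\<in>{0<..T}. \<exists>l. (X \<omega> \<longlongrightarrow> l) (at_left t)))"

text \<open>The jump at time \<open>0\<close> is \<open>0\<close> by convention.\<close>

definition jump :: "('a \<Rightarrow> real \<Rightarrow> real) \<Rightarrow> 'a \<Rightarrow> real \<Rightarrow> real" where
  "jump X \<omega> t = (if 0 < t then X \<omega> t - Lim (at_left t) (X \<omega>) else 0)"

definition predictable :: "'a measure \<Rightarrow> (real \<Rightarrow> 'a measure) \<Rightarrow> real \<Rightarrow> ('a \<times> real) measure" where
  "predictable M F T = sigma (space M \<times> {0..T})
     ({A \<times> {0} | A. A \<in> sets (F 0)} \<union>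
      {A \<times> {s<..t} | A s t. 0 \<le> s \<and> s < t \<and> t \<le> T \<and> A \<in> sets (F s)})"

definition optional :: "'a measure \<Rightarrow> (real \<Rightarrow> 'a measure) \<Rightarrow> real \<Rightarrow> ('a \<times> real) measure" where
  "optional M F T = sigma (space M \<times> {0..T})
     {{(\<omega>, t). \<omega> \<in> space M \<and> t \<in> {0..T} \<and> X \<omega> t \<in> B} | X B.
        cadlag M T X \<and> adapted F T X \<and> B \<in> sets borel}"

abbreviation predictable_tilde ::
    "'a measure \<Rightarrow> (real \<Rightarrow> 'a measure) \<Rightarrow> real \<Rightarrow> (('a \<times> real) \<times> real) measure" where
  "predictable_tilde M F T \<equiv> predictable M F T \<Otimes>\<^sub>M borel"

abbreviation optional_tilde ::
    "'a measure \<Rightarrow> (real \<Rightarrow> 'a measure) \<Rightarrow> real \<Rightarrow> (('a \<times> real) \<times> real) measure" where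
  "optional_tilde M F T \<equiv> optional M F T \<Otimes>\<^sub>M borel"

section \<open>Stopping times and localization\<close>

text \<open>
  The filtration is continued after \<open>T\<close> by \<open>F T\<close>, in accordance with the continuation of the
  processes by their value at \<open>T\<close>. In particular a localizing sequence, which increases to \<open>\<infinity>\<close>,
  eventually exceeds \<open>T\<close> almost surely.
\<close>

definition is_stopping_time :: "(real \<Rightarrow> 'a measure) \<Rightarrow> real \<Rightarrow> ('a \<Rightarrow> ennreal) \<Rightarrow> bool" where
  "is_stopping_time F T S \<longleftrightarrow> stopping_time (\<lambda>t::ennreal. F (enn2real (min t (ennreal T)))) S"

definition predictable_time ::
    "'a measure \<Rightarrow> (real \<Rightarrow> 'a measure) \<Rightarrow> real \<Rightarrow> ('a \<Rightarrow> ennreal) \<Rightarrow> bool" where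
  "predictable_time M F T S \<longleftrightarrow>
     {(\<omega>, t). \<omega> \<in> space M \<and> t \<in> {0..T} \<and> ennreal t < S \<omega>} \<in> sets (predictable M F T)"

definition stopped :: "('a \<Rightarrow> ennreal) \<Rightarrow> ('a \<Rightarrow> real \<Rightarrow> 'b) \<Rightarrow> 'a \<Rightarrow> real \<Rightarrow> 'b" where
  "stopped S X \<omega> t = X \<omega> (enn2real (min (ennreal t) (S \<omega>)))"

definition localizing ::
    "'a measure \<Rightarrow> (real \<Rightarrow> 'a measure) \<Rightarrow> real \<Rightarrow> (nat \<Rightarrow> 'a \<Rightarrow> ennreal) \<Rightarrow> bool" where
  "localizing M F T S \<longleftrightarrow> (\<forall>n. is_stopping_time F T (S n)) \<and>
     (AE \<omega> in M. incseq (\<lambda>n. S n \<omega>) \<and> (SUP n. S n \<omega>) = \<infinity>)"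

text \<open>
  For a quasi-left-continuous process, only times \<open>S \<le> T\<close> matter, as the process is constant after
  \<open>T\<close>.
\<close>

definition quasi_left_continuous ::
    "'a measure \<Rightarrow> (real \<Rightarrow> 'a measure) \<Rightarrow> real \<Rightarrow> ('a \<Rightarrow> real \<Rightarrow> real) \<Rightarrow> bool" where
  "quasi_left_continuous M F T Y \<longleftrightarrow> (\<forall>S. predictable_time M F T S \<longrightarrow>
     (AE \<omega> in M. S \<omega> \<le> ennreal T \<longrightarrow> jump Y \<omega> (enn2real (S \<omega>)) = 0))"

text \<open>
  Increasing processes are null at \<open>0\<close> and right-continuous. They are allowed to take the value \<open>\<infinity>\<close>,
  so that the class makes sense for integrals and sums that are finite only almost surely; since the
  filtration is complete, asking for the path properties almost surely means asking for
  indistinguishability from a process which has them everywhere.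
\<close>

definition A_plus ::
    "'a measure \<Rightarrow> (real \<Rightarrow> 'a measure) \<Rightarrow> real \<Rightarrow> ('a \<Rightarrow> real \<Rightarrow> ennreal) \<Rightarrow> bool" where
  "A_plus M F T A \<longleftrightarrow> adapted F T A \<and>
     (AE \<omega> in M. A \<omega> 0 = 0 \<and> mono_on {0..T} (A \<omega>) \<and>
        (\<forall>t\<in>{0..<T}. continuous (at_right t) (A \<omega>))) \<and>
     (\<integral>\<^sup>+\<omega>. A \<omega> T \<partial>M) < \<infinity>"

definition A_plus_loc ::
    "'a measure \<Rightarrow> (real \<Rightarrow> 'a measure) \<Rightarrow> real \<Rightarrow> ('a \<Rightarrow> real \<Rightarrow> ennreal) \<Rightarrow> bool" where
  "A_plus_loc M F T A \<longleftrightarrow>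
     (\<exists>S. localizing M F T S \<and> (\<forall>n. A_plus M F T (stopped (S n) A)))"

section \<open>Local martingales\<close>

text \<open>Martingales on the compact interval \<open>[0,T]\<close> are automatically uniformly integrable.\<close>

definition martingale ::
    "'a measure \<Rightarrow> (real \<Rightarrow> 'a measure) \<Rightarrow> real \<Rightarrow> ('a \<Rightarrow> real \<Rightarrow> real) \<Rightarrow> bool" where
  "martingale M F T X \<longleftrightarrow> adapted F T X \<and> cadlag M T X \<and>
     (\<forall>t\<in>{0..T}. integrable M (\<lambda>\<omega>. X \<omega> t)) \<and>
     (\<forall>s\<in>{0..T}. \<forall>t\<in>{s..T}.
        AE \<omega> in M. real_cond_exp M (F s) (\<lambda>\<omega>'. X \<omega>' t) \<omega> = X \<omega> s)"

definition local_martingale ::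
    "'a measure \<Rightarrow> (real \<Rightarrow> 'a measure) \<Rightarrow> real \<Rightarrow> ('a \<Rightarrow> real \<Rightarrow> real) \<Rightarrow> bool" where
  "local_martingale M F T X \<longleftrightarrow> adapted F T X \<and> cadlag M T X \<and>
     (\<exists>S. localizing M F T S \<and> (\<forall>n. martingale M F T (stopped (S n) X)))"

definition continuous_local_martingale ::
    "'a measure \<Rightarrow> (real \<Rightarrow> 'a measure) \<Rightarrow> real \<Rightarrow> ('a \<Rightarrow> real \<Rightarrow> real) \<Rightarrow> bool" where
  "continuous_local_martingale M F T X \<longleftrightarrow> local_martingale M F T X \<and>
     (\<forall>\<omega>\<in>space M. continuous_on {0..T} (X \<omega>))"

definition purely_discontinuous ::
    "'a measure \<Rightarrow> (real \<Rightarrow> 'a measure) \<Rightarrow> real \<Rightarrow> ('a \<Rightarrow> real \<Rightarrow> real) \<Rightarrow> bool" where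
  "purely_discontinuous M F T X \<longleftrightarrow> local_martingale M F T X \<and>
     (\<forall>\<omega>\<in>space M. X \<omega> 0 = 0) \<and>
     (\<forall>N. continuous_local_martingale M F T N \<longrightarrow> local_martingale M F T (\<lambda>\<omega> t. X \<omega> t * N \<omega> t))"

section \<open>Random measures\<close>

text \<open>
  A random measure on \<open>[0,T] \<times> \<real>\<close> is a family of measures on the Borel sets of the plane that are
  carried by \<open>]0,T] \<times> \<real>\<close>; as usual, no mass is put at time \<open>0\<close>.
\<close>

definition random_measure :: "'a measure \<Rightarrow> real \<Rightarrow> ('a \<Rightarrow> (real \<times> real) measure) \<Rightarrow> bool" where
  "random_measure M T \<mu> \<longleftrightarrow> (\<forall>\<omega>\<in>space M.
     sets (\<mu> \<omega>) = sets borel \<and> emeasure (\<mu> \<omega>) (- ({0<..T} \<times> UNIV)) = 0)"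

definition star ::
    "('a \<Rightarrow> real \<Rightarrow> real \<Rightarrow> ennreal) \<Rightarrow> ('a \<Rightarrow> (real \<times> real) measure) \<Rightarrow> 'a \<Rightarrow> real \<Rightarrow> ennreal" where
  "star H \<mu> \<omega> t = (\<integral>\<^sup>+(s, e). H \<omega> s e * indicator {0<..t} s \<partial>\<mu> \<omega>)"

definition optional_random_measure ::
    "'a measure \<Rightarrow> (real \<Rightarrow> 'a measure) \<Rightarrow> real \<Rightarrow> ('a \<Rightarrow> (real \<times> real) measure) \<Rightarrow> bool" where
  "optional_random_measure M F T \<mu> \<longleftrightarrow> random_measure M T \<mu> \<and>
     (\<forall>W. (\<lambda>((\<omega>, t), e). W \<omega> t e) \<in> borel_measurable (optional_tilde M F T) \<longrightarrow>
        (\<lambda>(\<omega>, t). star W \<mu> \<omega> t) \<in> borel_measurable (optional M F T))"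

definition predictable_random_measure ::
    "'a measure \<Rightarrow> (real \<Rightarrow> 'a measure) \<Rightarrow> real \<Rightarrow> ('a \<Rightarrow> (real \<times> real) measure) \<Rightarrow> bool" where
  "predictable_random_measure M F T \<mu> \<longleftrightarrow> random_measure M T \<mu> \<and>
     (\<forall>W. (\<lambda>((\<omega>, t), e). W \<omega> t e) \<in> borel_measurable (predictable_tilde M F T) \<longrightarrow>
        (\<lambda>(\<omega>, t). star W \<mu> \<omega> t) \<in> borel_measurable (predictable M F T))"

text \<open>
  The last conjunct is \<open>\<sigma>\<close>-finiteness with respect to the predictable \<open>\<sigma>\<close>-field on
  \<open>\<Omega> \<times> [0,T] \<times> \<real>\<close>, which is part of the standard definition (Jacod and Shiryaev, II.1.13).
\<close>

definition integer_valued_random_measure ::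
    "'a measure \<Rightarrow> (real \<Rightarrow> 'a measure) \<Rightarrow> real \<Rightarrow> ('a \<Rightarrow> (real \<times> real) measure) \<Rightarrow> bool" where
  "integer_valued_random_measure M F T \<mu> \<longleftrightarrow> optional_random_measure M F T \<mu> \<and>
     (\<forall>\<omega>\<in>space M. \<forall>t\<in>{0..T}. emeasure (\<mu> \<omega>) ({t} \<times> UNIV) \<le> 1) \<and>
     (\<forall>\<omega>\<in>space M. \<forall>B\<in>sets borel. emeasure (\<mu> \<omega>) B \<in> range ennreal_of_enat) \<and>
     (\<exists>V. (\<lambda>((\<omega>, t), e). V \<omega> t e) \<in> borel_measurable (predictable_tilde M F T) \<and>
        (\<forall>\<omega>\<in>space M. \<forall>t\<in>{0..T}. \<forall>e. 0 < V \<omega> t e) \<and>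
        (\<integral>\<^sup>+\<omega>. star V \<mu> \<omega> T \<partial>M) < \<infinity>)"

text \<open>
  The compensator is the dual predictable projection; among its versions we take those
  with \<open>\<nu> ({t} \<times> \<real>) \<le> 1\<close> identically.
\<close>

definition compensator ::
    "'a measure \<Rightarrow> (real \<Rightarrow> 'a measure) \<Rightarrow> real \<Rightarrow> ('a \<Rightarrow> (real \<times> real) measure) \<Rightarrow>
     ('a \<Rightarrow> (real \<times> real) measure) \<Rightarrow> bool" where
  "compensator M F T \<mu> \<nu> \<longleftrightarrow> predictable_random_measure M F T \<nu> \<and>
     (\<forall>W. (\<lambda>((\<omega>, t), e). W \<omega> t e) \<in> borel_measurable (predictable_tilde M F T) \<longrightarrow>
        (\<integral>\<^sup>+\<omega>. star W \<nu> \<omega> T \<partial>M) = (\<integral>\<^sup>+\<omega>. star W \<mu> \<omega> T \<partial>M)) \<and>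
     (\<forall>\<omega>\<in>space M. \<forall>t\<in>{0..T}. emeasure (\<nu> \<omega>) ({t} \<times> UNIV) \<le> 1)"

definition D_set :: "'a measure \<Rightarrow> real \<Rightarrow> ('a \<Rightarrow> (real \<times> real) measure) \<Rightarrow> ('a \<times> real) set" where
  "D_set M T \<mu> = {(\<omega>, t). \<omega> \<in> space M \<and> t \<in> {0..T} \<and> emeasure (\<mu> \<omega>) ({t} \<times> UNIV) > 0}"

definition J_set :: "'a measure \<Rightarrow> real \<Rightarrow> ('a \<Rightarrow> (real \<times> real) measure) \<Rightarrow> ('a \<times> real) set" where
  "J_set M T \<nu> = {(\<omega>, t). \<omega> \<in> space M \<and> t \<in> {0..T} \<and> emeasure (\<nu> \<omega>) ({t} \<times> UNIV) > 0}"

definition K_set :: "'a measure \<Rightarrow> real \<Rightarrow> ('a \<Rightarrow> (real \<times> real) measure) \<Rightarrow> ('a \<times> real) set" where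
  "K_set M T \<nu> = {(\<omega>, t). \<omega> \<in> space M \<and> t \<in> {0..T} \<and> emeasure (\<nu> \<omega>) ({t} \<times> UNIV) = 1}"

text \<open>The measure that assigns \<open>E[W \<star> \<mu>\<^sub>T]\<close> to \<open>W\<close>, given by its values on indicators.\<close>

definition doleans_measure ::
    "'a measure \<Rightarrow> real \<Rightarrow> ('a \<Rightarrow> (real \<times> real) measure) \<Rightarrow> (('a \<times> real) \<times> real) measure" where
  "doleans_measure M T \<mu> = measure_of ((space M \<times> {0..T}) \<times> UNIV)
     (sets ((M \<Otimes>\<^sub>M restrict_space borel {0..T}) \<Otimes>\<^sub>M borel))
     (\<lambda>B. \<integral>\<^sup>+\<omega>. star (\<lambda>\<omega> s e. indicator B ((\<omega>, s), e)) \<mu> \<omega> T \<partial>M)"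

text \<open>The image of the counting measure on the jump times is the sum of the Dirac measures.\<close>

definition jump_measure :: "real \<Rightarrow> ('a \<Rightarrow> real \<Rightarrow> real) \<Rightarrow> 'a \<Rightarrow> (real \<times> real) measure" where
  "jump_measure T X \<omega> =
     distr (count_space {s \<in> {0<..T}. jump X \<omega> s \<noteq> 0}) borel (\<lambda>s. (s, jump X \<omega> s))"

section \<open>Stochastic integration with respect to a compensated random measure\<close>

definition hat ::
    "('a \<Rightarrow> (real \<times> real) measure) \<Rightarrow> ('a \<Rightarrow> real \<Rightarrow> real \<Rightarrow> real) \<Rightarrow> 'a \<Rightarrow> real \<Rightarrow> real" where
  "hat \<nu> W \<omega> t = (LINT (s, e):{t} \<times> UNIV|\<nu> \<omega>. W \<omega> s e)"

definition tilde ::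
    "('a \<Rightarrow> (real \<times> real) measure) \<Rightarrow> ('a \<Rightarrow> (real \<times> real) measure) \<Rightarrow>
     ('a \<Rightarrow> real \<Rightarrow> real \<Rightarrow> real) \<Rightarrow> 'a \<Rightarrow> real \<Rightarrow> ereal" where
  "tilde \<mu> \<nu> W \<omega> t =
     (if set_integrable (\<nu> \<omega>) ({t} \<times> UNIV) (\<lambda>(s, e). W \<omega> s e)
      then ereal ((LINT (s, e):{t} \<times> UNIV|\<mu> \<omega>. W \<omega> s e) - hat \<nu> W \<omega> t)
      else \<infinity>)"

definition powr_ennreal :: "ennreal \<Rightarrow> real \<Rightarrow> ennreal" where
  "powr_ennreal x q = (if x = \<infinity> then \<infinity> else ennreal (enn2real x powr q))"

text \<open>
  The uncountable sum of nonnegative terms over \<open>s \<le> t\<close> is an integral with respect to counting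
  measure.
\<close>

definition G_loc ::
    "'a measure \<Rightarrow> (real \<Rightarrow> 'a measure) \<Rightarrow> real \<Rightarrow> real \<Rightarrow> ('a \<Rightarrow> (real \<times> real) measure) \<Rightarrow>
     ('a \<Rightarrow> (real \<times> real) measure) \<Rightarrow> ('a \<Rightarrow> real \<Rightarrow> real \<Rightarrow> real) set" where
  "G_loc M F T q \<mu> \<nu> =
     {W. (\<lambda>((\<omega>, t), e). W \<omega> t e) \<in> borel_measurable (predictable_tilde M F T) \<and>
         A_plus_loc M F T (\<lambda>\<omega> t. powr_ennreal
           (\<integral>\<^sup>+s. (e2ennreal \<bar>tilde \<mu> \<nu> W \<omega> s\<bar>)\<^sup>2 \<partial>count_space {0..t}) (q / 2))}"

text \<open>
  For \<open>W\<close> in \<open>G_loc\<close> with exponent \<open>1\<close> the process below exists and is unique up to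
  indistinguishability; the choice operator picks a version.
\<close>

definition stochastic_integral ::
    "'a measure \<Rightarrow> (real \<Rightarrow> 'a measure) \<Rightarrow> real \<Rightarrow> ('a \<Rightarrow> (real \<times> real) measure) \<Rightarrow>
     ('a \<Rightarrow> (real \<times> real) measure) \<Rightarrow> ('a \<Rightarrow> real \<Rightarrow> real \<Rightarrow> real) \<Rightarrow> 'a \<Rightarrow> real \<Rightarrow> real" where
  "stochastic_integral M F T \<mu> \<nu> W = (SOME X. purely_discontinuous M F T X \<and>
     indistinguishable M T (\<lambda>\<omega> t. ereal (jump X \<omega> t)) (tilde \<mu> \<nu> W))"

end

theory Submission
  imports Defs
begin

text \<open>
  Write \<open>\<Delta>Y\<close> for \<^const>\<open>jump\<close> \<open>Y\<close>, \<open>\<mu>\<^sup>X\<close> for the jump measure of \<open>X\<close>, \<open>\<nu>\<^sup>X\<close> for its compensator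
  and \<open>W (t, e) = \<phi> (t, \<gamma> (t, e))\<close>. A stochastic integral with respect to a compensated random measure
  is determined by its jump process \<^const>\<open>tilde\<close>, so everything follows from the fact that, outside
  an evanescent set, both jump processes are equal to
  \<open>j\<^sub>t = \<phi> (t, \<Delta>X\<^sub>t)\<close> off \<open>J\<close> and \<open>j\<^sub>t = 0\<close> on \<open>J\<close>.

  The key is the behaviour at predictable times. Let \<open>U \<ge> 0\<close> be predictable with \<open>U \<star> \<nu>\<close> integrable.
  The jump times of the predictable increasing process \<open>U \<star> \<nu>\<close> are covered by the first times at
  which it reaches a rational level. These are predictable times, so a quasi-left-continuous process
  does not jump at an atom \<open>t\<close> of \<open>U \<cdot> \<nu>\<close>
  (\<open>quasi_left_continuous_no_jump_at_atoms\<close>). In particular \<open>\<Delta>X\<^sup>i = 0\<close> on \<open>J\<close>, hence \<open>\<Delta>X = \<Delta>X\<^sup>p\<close> on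
  \<open>J\<close> and \<open>\<Delta>X = \<Delta>X\<^sup>i\<close> off \<open>J\<close>.

  For \<open>\<mu>\<close>: off \<open>J\<close> the compensator has no atom and the atom of \<open>\<mu>\<close> contributes \<open>\<phi> (t, \<Delta>X\<^sup>i\<^sub>t)\<close>, because
  \<open>\<gamma> = \<Delta>X\<^sup>i\<close> almost everywhere for \<open>\<mu>\<close>. On \<open>J\<close> the same identity gives \<open>\<gamma> = 0\<close> almost everywhere for \<open>\<mu>\<close>, and
  thus for \<open>\<nu>\<close>, so that both contributions are \<open>\<phi> (t, 0) = 0\<close>.

  For \<open>\<mu>\<^sup>X\<close>: off \<open>J\<close> an atom of \<open>\<nu>\<^sup>X\<close> would be an atom at a time at which \<open>X\<^sup>i\<close>, hence \<open>X\<close>, does not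
  jump, so there is none (\<open>no_atoms_off_J\<close>). On \<open>J\<close> the jump \<open>\<Delta>X = \<Delta>X\<^sup>p\<close> is predictable, so \<open>\<nu>\<^sup>X\<close> has
  there a unit mass at \<open>\<Delta>X\<^sup>p\<^sub>t\<close> like \<open>\<mu>\<^sup>X\<close> itself, and the two contributions cancel
  (\<open>atoms_on_J_carried_by_jump_Xp\<close>, \<open>atoms_on_J_have_full_mass\<close>). These statements are only claimed
  where \<open>\<phi> \<noteq> 0\<close>; there the two integrability hypotheses, localized, provide weights \<open>U\<close> with
  \<open>U \<star> \<mu>\<^sup>X\<close> integrable.

  It remains to see that \<open>Z\<^sub>t = (\<Sum>s \<le> t. j\<^sub>s\<^sup>2)\<^sup>1\<^sup>/\<^sup>2\<close> is locally integrable. The measure \<open>\<mu>\<close> is carried by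
  its atoms in time (\<open>star_eq_sum_over_atoms\<close>), so \<open>Z\<^sup>2 = W\<^sup>2 \<star> \<mu>\<close>, which is adapted; and
  \<open>Z \<le> \<phi> 1\<^sub>A \<star> \<mu>\<^sup>X + 1 + \<phi>\<^sup>2 1\<^sub>B \<star> \<mu>\<^sup>X\<close>, where \<open>B\<close> is the complement of \<open>A\<close>, bounds it by processes
  that are locally integrable by hypothesis.
\<close>

section \<open>Predictable and optional measurability\<close>

context filtered_prob_space
begin

lemma space_F: "t \<in> {0..T} \<Longrightarrow> space (F t) = space M"
  using F_subalgebra by (auto simp: subalgebra_def)

lemma sets_F_subset: "t \<in> {0..T} \<Longrightarrow> sets (F t) \<subseteq> sets M"
  using F_subalgebra by (auto simp: subalgebra_def)

lemma measurable_F_imp_M: "t \<in> {0..T} \<Longrightarrow> f \<in> measurable (F t) N \<Longrightarrow> f \<in> measurable M N"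
  using measurable_from_subalg[OF F_subalgebra] by blast

text \<open>
  Every \<open>F t\<close> contains the null sets, so it does not distinguish processes modified on a null set.
\<close>

lemma measurable_F_AE_cong:
  assumes t: "t \<in> {0..T}" and f: "f \<in> borel_measurable (F t)"
    and g: "AE \<omega> in M. f \<omega> = g \<omega>"
  shows "g \<in> borel_measurable (F t)"
proof (rule measurableI)
  fix B :: "'b set" assume B: "B \<in> sets borel"
  obtain N where N: "N \<in> null_sets M" "{\<omega> \<in> space M. f \<omega> \<noteq> g \<omega>} \<subseteq> N"
    using g by (auto elim!: AE_E simp: null_sets_def)
  have null: "Z \<in> sets (F t)" if "Z \<subseteq> N" for Z
  proof -
    have "Z \<in> null_sets M" using N(1) that complete2 by blast
    then show ?thesis using F_complete F_mono[of 0 t] t by auto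
  qed
  have "g -` B \<inter> space (F t) =
    (f -` B \<inter> space (F t) - N) \<union> {\<omega> \<in> N. g \<omega> \<in> B \<and> \<omega> \<in> space M}"
    using N(2) space_F[OF t] by fastforce
  also have "\<dots> \<in> sets (F t)"
    using measurable_sets[OF f B] by (intro sets.Un sets.Diff) (auto intro!: null)
  finally show "g -` B \<inter> space (F t) \<in> sets (F t)" .
qed auto

lemma space_predictable [simp]: "space (predictable M F T) = space M \<times> {0..T}"
  unfolding predictable_def by (rule space_measure_of_conv)

lemma space_optional [simp]: "space (optional M F T) = space M \<times> {0..T}"
  unfolding optional_def by (rule space_measure_of_conv)

lemma predictable_generator_subset:
  "{A \<times> {0} | A. A \<in> sets (F 0)} \<union>
      {A \<times> {s<..t} | A s t. 0 \<le> s \<and> s < t \<and> t \<le> T \<and> A \<in> sets (F s)} \<subseteq> Pow (space M \<times> {0..T})"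
proof
  have sub: "A \<subseteq> space M" if "A \<in> sets (F s)" "0 \<le> s" "s \<le> T" for A s
    using that sets_F_subset[of s] sets.sets_into_space[of A M] by auto
  fix Y assume "Y \<in> {A \<times> {0} | A. A \<in> sets (F 0)} \<union>
      {A \<times> {s<..t} | A s t. 0 \<le> s \<and> s < t \<and> t \<le> T \<and> A \<in> sets (F s)}"
  then consider A where "Y = A \<times> {0}" "A \<in> sets (F 0)"
    | A s t where "Y = A \<times> {s<..t}" "0 \<le> s" "s < t" "t \<le> T" "A \<in> sets (F s)"
    by blast
  then show "Y \<in> Pow (space M \<times> {0..T})"
  proof cases
    case 1
    then show ?thesis using sub[of _ 0] T_pos by auto
  next
    case 2
    then show ?thesis using sub[OF 2(5)] by auto
  qed
qed

lemma sets_predictable: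
  "sets (predictable M F T) = sigma_sets (space M \<times> {0..T})
     ({A \<times> {0} | A. A \<in> sets (F 0)} \<union>
      {A \<times> {s<..t} | A s t. 0 \<le> s \<and> s < t \<and> t \<le> T \<and> A \<in> sets (F s)})"
  unfolding predictable_def by (intro sets_measure_of predictable_generator_subset)

lemma predictable_rectI:
  "\<lbrakk>0 \<le> s; s \<le> t; t \<le> T; A \<in> sets (F s)\<rbrakk> \<Longrightarrow> A \<times> {s<..t} \<in> sets (predictable M F T)"
  unfolding sets_predictable
  by (cases "s = t") (auto intro!: sigma_sets.Basic sigma_sets.Empty)

lemma predictable_rect0I: "A \<in> sets (F 0) \<Longrightarrow> A \<times> {0} \<in> sets (predictable M F T)"
  unfolding sets_predictable by (auto intro!: sigma_sets.Basic)

lemma predictable_rect0_closedI: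
  assumes "0 \<le> t" "t \<le> T" "A \<in> sets (F 0)"
  shows "A \<times> {0..t} \<in> sets (predictable M F T)"
proof -
  have "A \<times> {0..t} = A \<times> {0} \<union> A \<times> {0<..t}"
    using assms by auto
  then show ?thesis
    using predictable_rectI[of 0 t A] predictable_rect0I[of A] assms by auto
qed

lemma measurable_predictableI:
  assumes sp: "f \<in> space N \<rightarrow> space M \<times> {0..T}"
    and 0: "\<And>A. A \<in> sets (F 0) \<Longrightarrow> f -` (A \<times> {0}) \<inter> space N \<in> sets N"
    and rect: "\<And>A s t. \<lbrakk>0 \<le> s; s < t; t \<le> T; A \<in> sets (F s)\<rbrakk> \<Longrightarrow> f -` (A \<times> {s<..t}) \<inter> space N \<in> sets N"
  shows "f \<in> measurable N (predictable M F T)"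
proof (rule measurable_sigma_sets[OF sets_predictable predictable_generator_subset sp])
  fix Y assume "Y \<in> {A \<times> {0} | A. A \<in> sets (F 0)} \<union>
      {A \<times> {s<..t} | A s t. 0 \<le> s \<and> s < t \<and> t \<le> T \<and> A \<in> sets (F s)}"
  then consider A where "Y = A \<times> {0}" "A \<in> sets (F 0)"
    | A s t where "Y = A \<times> {s<..t}" "0 \<le> s" "s < t" "t \<le> T" "A \<in> sets (F s)"
    by blast
  then show "f -` Y \<inter> space N \<in> sets N"
    by cases (use 0 rect in auto)
qed

lemma predictable_section:
  assumes \<omega>: "\<omega> \<in> space M"
  shows "(\<lambda>s. (\<omega>, s)) \<in> measurable (restrict_space borel {0..T}) (predictable M F T)"
proof (rule measurable_predictableI)
  have in_restrict: "B \<inter> {0..T} \<in> sets (restrict_space borel {0..T})" if "B \<in> sets borel" for B :: "real set"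
    unfolding sets_restrict_space using that by (intro image_eqI[of _ _ B]) auto
  show "(\<lambda>s. (\<omega>, s)) -` (A \<times> {0}) \<inter> space (restrict_space borel {0..T})
      \<in> sets (restrict_space borel {0..T})" for A
  proof -
    have "(\<lambda>s. (\<omega>, s)) -` (A \<times> {0}) \<inter> space (restrict_space borel {0..T}) =
      (if \<omega> \<in> A then {0} else {}) \<inter> {0..T}"
      by (auto simp: space_restrict_space)
    then show ?thesis by (simp only:) (rule in_restrict, simp)
  qed
  show "(\<lambda>s. (\<omega>, s)) -` (A \<times> {s<..t}) \<inter> space (restrict_space borel {0..T})
      \<in> sets (restrict_space borel {0..T})" for A s t
  proof -
    have "(\<lambda>s. (\<omega>, s)) -` (A \<times> {s<..t}) \<inter> space (restrict_space borel {0..T}) =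
      (if \<omega> \<in> A then {s<..t} else {}) \<inter> {0..T}"
      by (auto simp: space_restrict_space)
    then show ?thesis by (simp only:) (rule in_restrict, simp)
  qed
qed (use \<omega> in \<open>auto simp: space_restrict_space\<close>)

lemma predictable_at:
  assumes t: "t \<in> {0..T}"
  shows "(\<lambda>\<omega>. (\<omega>, t)) \<in> measurable (F t) (predictable M F T)"
proof (rule measurable_predictableI)
  fix A assume A: "A \<in> sets (F 0)"
  have "(\<lambda>\<omega>. (\<omega>, t)) -` (A \<times> {0}) \<inter> space (F t) = (if t = 0 then A else {})"
    using t sets.sets_into_space[OF A] by (auto simp: space_F)
  then show "(\<lambda>\<omega>. (\<omega>, t)) -` (A \<times> {0}) \<inter> space (F t) \<in> sets (F t)"
    using A by auto
next
  fix A s u assume *: "A \<in> sets (F s)" "0 \<le> s" "s < u" "u \<le> T"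
  then have "space (F s) = space M" by (intro space_F) auto
  then have "(\<lambda>\<omega>. (\<omega>, t)) -` (A \<times> {s<..u}) \<inter> space (F t) = (if s < t \<and> t \<le> u then A else {})"
    using t sets.sets_into_space[OF *(1)] by (auto simp: space_F)
  then show "(\<lambda>\<omega>. (\<omega>, t)) -` (A \<times> {s<..u}) \<inter> space (F t) \<in> sets (F t)"
    using * F_mono[of s t] t by auto
qed (use t in \<open>auto simp: space_F\<close>)

lemma optional_at:
  assumes t: "t \<in> {0..T}"
  shows "(\<lambda>\<omega>. (\<omega>, t)) \<in> measurable (F t) (optional M F T)"
  unfolding optional_def
proof (rule measurable_measure_of)
  fix Y assume "Y \<in> {{(\<omega>, t). \<omega> \<in> space M \<and> t \<in> {0..T} \<and> X \<omega> t \<in> B} |X B.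
    cadlag M T X \<and> adapted F T X \<and> B \<in> sets borel}"
  then obtain X :: "'a \<Rightarrow> real \<Rightarrow> real" and B where *: "adapted F T X" "B \<in> sets borel"
    and Y: "Y = {(\<omega>, t). \<omega> \<in> space M \<and> t \<in> {0..T} \<and> X \<omega> t \<in> B}"
    by blast
  have "(\<lambda>\<omega>. (\<omega>, t)) -` Y \<inter> space (F t) = (\<lambda>\<omega>. X \<omega> t) -` B \<inter> space (F t)"
    using t by (auto simp: Y space_F)
  then show "(\<lambda>\<omega>. (\<omega>, t)) -` Y \<inter> space (F t) \<in> sets (F t)"
    using * t unfolding adapted_def by (metis measurable_sets)
qed (use t in \<open>auto simp: space_F\<close>)

lemma cadlag_adapted_imp_optional:
  assumes "cadlag M T X" "adapted F T X"
  shows "(\<lambda>(\<omega>, t). X \<omega> t) \<in> borel_measurable (optional M F T)"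
proof (rule measurableI)
  fix B :: "real set" assume B: "B \<in> sets borel"
  have "(\<lambda>(\<omega>, t). X \<omega> t) -` B \<inter> space (optional M F T) =
    {(\<omega>, t). \<omega> \<in> space M \<and> t \<in> {0..T} \<and> X \<omega> t \<in> B}"
    by auto
  also have "\<dots> \<in> sets (optional M F T)"
    unfolding optional_def using assms B by (intro in_measure_of) auto
  finally show "(\<lambda>(\<omega>, t). X \<omega> t) -` B \<inter> space (optional M F T) \<in> sets (optional M F T)" .
qed auto

text \<open>
  The indicator of \<open>A \<times> [a, T]\<close> is a cadlag process, and these rectangles generate the predictable
  rectangles; this is how the predictable \<open>\<sigma>\<close>-field is seen to be contained in the optional one.
\<close>

lemma optional_rectI:
  assumes A: "A \<in> sets (F a)" and a: "0 \<le> a" "a \<le> T"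
  shows "A \<times> {a..T} \<in> sets (optional M F T)"
proof -
  define X :: "'a \<Rightarrow> real \<Rightarrow> real" where "X = (\<lambda>\<omega> t. indicator A \<omega> * indicator {a..} t)"
  have "continuous (at_right t) (X \<omega>)" for t \<omega>
  proof -
    have "\<forall>\<^sub>F s in at_right t. X \<omega> s = X \<omega> t"
    proof (cases "a \<le> t")
      case True
      then show ?thesis unfolding X_def
        by (intro eventually_at_rightI[of t "t+1"]) (auto simp: indicator_def)
    next
      case False
      then show ?thesis unfolding X_def
        by (intro eventually_at_rightI[of t a]) (auto simp: indicator_def)
    qed
    then show ?thesis unfolding continuous_within by (rule tendsto_eventually)
  qed
  moreover have "\<exists>l. (X \<omega> \<longlongrightarrow> l) (at_left t)" for t \<omega>
  proof -
    have "\<forall>\<^sub>F s in at_left t. X \<omega> s = (if a < t then indicator A \<omega> else 0)"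
    proof (cases "a < t")
      case True
      then show ?thesis unfolding X_def
        by (intro eventually_at_leftI[of a t]) (auto simp: indicator_def)
    next
      case False
      then show ?thesis unfolding X_def
        by (intro eventually_at_leftI[of "t-1" t]) (auto simp: indicator_def)
    qed
    then show ?thesis by (auto intro: tendsto_eventually)
  qed
  ultimately have "cadlag M T X" unfolding cadlag_def by auto
  moreover have "adapted F T X" unfolding adapted_def
  proof safe
    fix t assume t: "t \<in> {0..T}"
    have "A \<in> sets (F t)" if "a \<le> t" using F_mono[of a t] A a t that by auto
    then show "(\<lambda>\<omega>. X \<omega> t) \<in> borel_measurable (F t)"
      unfolding X_def by (cases "a \<le> t") auto
  qed
  ultimately have X: "(\<lambda>(\<omega>, t). X \<omega> t) \<in> borel_measurable (optional M F T)"
    by (rule cadlag_adapted_imp_optional)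
  have "A \<subseteq> space M" using A a sets_F_subset[of a] sets.sets_into_space[of A M] by auto
  then have "A \<times> {a..T} = (\<lambda>(\<omega>, t). X \<omega> t) -` {1} \<inter> space (optional M F T)"
    using a by (auto simp: X_def split: split_indicator_asm split_indicator)
  then show ?thesis using measurable_sets[OF X, of "{1}"] by simp
qed

lemma optional_rect_openI:
  assumes A: "A \<in> sets (F s)" and s: "0 \<le> s" "s \<le> T"
  shows "A \<times> {s<..T} \<in> sets (optional M F T)"
proof -
  have "A \<times> {s<..T} = (\<Union>n. A \<times> {s + (T - s) / real (n + 2)..T}) \<union> {}" if "s < T"
  proof -
    have "\<exists>n. s + (T - s) / real (n + 2) \<le> t" if "s < t" for t
    proof -
      obtain n where n: "(T - s) / (t - s) < real n" using reals_Archimedean2 by blast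
      then have "(T - s) < real (n + 2) * (t - s)" using \<open>s < t\<close> by (auto simp: field_simps)
      then have "(T - s) / real (n + 2) \<le> t - s" by (simp add: field_simps)
      then show ?thesis by (intro exI[of _ n]) auto
    qed
    moreover have "s < t" if "s + (T - s) / real (n + 2) \<le> t" for n t
    proof -
      have "0 < (T - s) / real (n + 2)" using \<open>s < T\<close> by simp
      then show ?thesis using that by linarith
    qed
    ultimately have "{s<..T} = (\<Union>n. {s + (T - s) / real (n + 2)..T})"
      by (intro set_eqI) (simp, blast)
    then show ?thesis by auto
  qed
  moreover have "A \<times> {s + (T - s) / real (n + 2)..T} \<in> sets (optional M F T)" for n
  proof (rule optional_rectI)
    have "(T - s) / real (n + 2) \<le> T - s"
      using s by (intro divide_left_mono[of 1 _ "T - s", simplified]) auto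
    then show "s + (T - s) / real (n + 2) \<le> T" by simp
    then show "A \<in> sets (F (s + (T - s) / real (n + 2)))"
      using A s F_mono[of s "s + (T - s) / real (n + 2)"] by auto
  qed (use s in auto)
  ultimately show ?thesis using s by (cases "s < T") auto
qed

lemma predictable_imp_optional:
  "f \<in> measurable (predictable M F T) N \<Longrightarrow> f \<in> measurable (optional M F T) N"
proof -
  have "(\<lambda>x. x) \<in> measurable (optional M F T) (predictable M F T)"
  proof (rule measurable_predictableI)
    fix A assume A: "A \<in> sets (F 0)"
    have "A \<subseteq> space M" using A T_pos sets_F_subset[of 0] sets.sets_into_space[of A M] by auto
    then have "(\<lambda>x. x) -` (A \<times> {0}) \<inter> space (optional M F T) = A \<times> {0..T} - A \<times> {0<..T}"
      using T_pos by auto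
    then show "(\<lambda>x. x) -` (A \<times> {0}) \<inter> space (optional M F T) \<in> sets (optional M F T)"
      using optional_rectI[of A 0] optional_rect_openI[of A 0] A T_pos by auto
  next
    fix A s t assume *: "0 \<le> s" "s < t" "t \<le> T" "A \<in> sets (F s)"
    have "A \<subseteq> space M" using * T_pos sets_F_subset[of s] sets.sets_into_space[of A M] by auto
    then have "(\<lambda>x. x) -` (A \<times> {s<..t}) \<inter> space (optional M F T) = A \<times> {s<..T} - A \<times> {t<..T}"
      using * by auto
    moreover have "A \<in> sets (F t)" using * F_mono[of s t] by auto
    ultimately show "(\<lambda>x. x) -` (A \<times> {s<..t}) \<inter> space (optional M F T) \<in> sets (optional M F T)"
      using optional_rect_openI[of A s] optional_rect_openI[of A t] * T_pos by auto
  qed auto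
  then show "f \<in> measurable (predictable M F T) N \<Longrightarrow> f \<in> measurable (optional M F T) N"
    using measurable_compose by blast
qed

lemma predictable_tilde_imp_optional_tilde:
  assumes "f \<in> measurable (predictable_tilde M F T) N"
  shows "f \<in> measurable (optional_tilde M F T) N"
proof -
  have "(\<lambda>x. x) \<in> measurable (optional M F T) (predictable M F T)"
    by (intro predictable_imp_optional) simp
  then have "(\<lambda>x. (fst x, snd x)) \<in> measurable (optional_tilde M F T) (predictable_tilde M F T)"
    by measurable
  then show ?thesis using measurable_compose[OF _ assms] by auto
qed

text \<open>
  A deterministic delay keeps predictability. It is used to write left limits, and hence jumps, of
  predictable processes as pointwise limits of predictable processes.
\<close>

lemma predictable_shift:
  assumes d: "0 \<le> d"
  shows "(\<lambda>(\<omega>, t). (\<omega>, max 0 (t - d))) \<in> measurable (predictable M F T) (predictable M F T)"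
proof (rule measurable_predictableI)
  fix A assume A: "A \<in> sets (F 0)"
  have "A \<subseteq> space M" using A T_pos sets_F_subset[of 0] sets.sets_into_space[of A M] by auto
  then have "(\<lambda>(\<omega>, t). (\<omega>, max 0 (t - d))) -` (A \<times> {0}) \<inter> space (predictable M F T) = A \<times> {0..min d T}"
    using d by (auto simp: max_def split: if_splits)
  then show "(\<lambda>(\<omega>, t). (\<omega>, max 0 (t - d))) -` (A \<times> {0}) \<inter> space (predictable M F T) \<in> sets (predictable M F T)"
    using A d T_pos by (auto intro: predictable_rect0_closedI)
next
  fix A s t assume *: "0 \<le> s" "s < t" "t \<le> T" "A \<in> sets (F s)"
  have "A \<subseteq> space M" using * T_pos sets_F_subset[of s] sets.sets_into_space[of A M] by auto
  then have **: "(\<lambda>(\<omega>, t). (\<omega>, max 0 (t - d))) -` (A \<times> {s<..t}) \<inter> space (predictable M F T) =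
      (if s + d \<le> T then A \<times> {s + d<..min (t + d) T} else {})"
    using d * by (auto simp: max_def split: if_splits)
  have "A \<times> {s + d<..min (t + d) T} \<in> sets (predictable M F T)" if "s + d \<le> T"
    using * d that F_mono[of s "s + d"] by (intro predictable_rectI) auto
  then show "(\<lambda>(\<omega>, t). (\<omega>, max 0 (t - d))) -` (A \<times> {s<..t}) \<inter> space (predictable M F T) \<in> sets (predictable M F T)"
    unfolding ** by auto
qed (use d in auto)

lemma predictable_time_measurable [measurable]: "snd \<in> borel_measurable (predictable M F T)"
proof (rule borel_measurableI_greater)
  fix y :: real
  have "{x \<in> space (predictable M F T). y < snd x} =
    (if y < 0 then space M \<times> {0..T} else if y \<le> T then space M \<times> {y<..T} else {})"
    by auto
  also have "\<dots> \<in> sets (predictable M F T)"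
    using predictable_rectI[of y T "space M"] predictable_rect0_closedI[of T "space M"] T_pos
      sets.top[of "F 0"] sets.top[of "F y"]
    by (cases "y < 0"; cases "y \<le> T") (auto simp: space_F)
  finally show "{x \<in> space (predictable M F T). y < snd x} \<in> sets (predictable M F T)" .
qed

lemma predictable_null:
  assumes "N \<in> null_sets M"
  shows "N \<times> {0..T} \<in> sets (predictable M F T)"
  using assms F_complete T_pos by (intro predictable_rect0_closedI) auto

text \<open>
  The complement of the closed interval up to \<open>S\<close> is the union over rational \<open>q\<close> of the predictable
  rectangles \<open>{S \<le> q} \<times> ]q, T]\<close>.
\<close>

lemma stopping_interval_predictable:
  assumes S: "is_stopping_time F T S"
  shows "{(\<omega>, t). \<omega> \<in> space M \<and> t \<in> {0..T} \<and> ennreal t \<le> S \<omega>} \<in> sets (predictable M F T)"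
proof -
  have S_le: "{\<omega> \<in> space M. S \<omega> \<le> ennreal q} \<in> sets (F q)" if "q \<in> {0..T}" for q
    using stopping_timeD[OF S[unfolded is_stopping_time_def], of "ennreal q"] that T_pos
    by (simp add: Measurable.pred_def space_F min_def ennreal_le_iff)
  let ?Q = "\<rat> \<inter> {0..T}"
  have "{(\<omega>, t). \<omega> \<in> space M \<and> t \<in> {0..T} \<and> ennreal t \<le> S \<omega>} =
    space M \<times> {0..T} - (\<Union>q\<in>?Q. {\<omega> \<in> space M. S \<omega> \<le> ennreal q} \<times> {q<..T})"
    (is "?L = ?R")
  proof (intro set_eqI iffI)
    fix x assume "x \<in> ?L"
    then obtain \<omega> t where xe: "x = (\<omega>, t)" "\<omega> \<in> space M" "t \<in> {0..T}" "ennreal t \<le> S \<omega>"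
      by auto
    have "\<not> q < t" if "q \<in> ?Q" "S \<omega> \<le> ennreal q" for q
      using order_trans[OF xe(4) that(2)] that(1) by (auto simp: ennreal_le_iff)
    then show "x \<in> ?R" using xe(2,3) by (auto simp: xe(1))
  next
    fix x assume x: "x \<in> ?R"
    obtain \<omega> t where xe: "x = (\<omega>, t)" by force
    have "ennreal t \<le> S \<omega>"
    proof (rule ccontr)
      assume "\<not> ennreal t \<le> S \<omega>"
      then have l: "S \<omega> < ennreal t" by simp
      define r where "r = enn2real (S \<omega>)"
      have "S \<omega> < \<top>" using l ennreal_less_top less_trans by blast
      then have r: "S \<omega> = ennreal r"
        unfolding r_def by (rule ennreal_enn2real[symmetric])
      have "0 \<le> r" unfolding r_def by (rule enn2real_nonneg)
      with l have "r < t"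
        unfolding r by (simp add: ennreal_less_iff)
      then obtain q where q: "q \<in> \<rat>" "r < q" "q < t" using Rats_dense_in_real by blast
      have "q \<in> ?Q"
        using q \<open>0 \<le> r\<close> DiffD1[OF x] unfolding xe by simp
      moreover have "S \<omega> \<le> ennreal q"
        unfolding r by (rule ennreal_leI) (rule less_imp_le[OF q(2)])
      ultimately have "x \<in> (\<Union>q\<in>?Q. {\<omega> \<in> space M. S \<omega> \<le> ennreal q} \<times> {q<..T})"
        using DiffD1[OF x] q(3) unfolding xe by (intro UN_I[of q]) auto
      then show False by (rule DiffD2[OF x])
    qed
    moreover have "x \<in> space M \<times> {0..T}" by (rule DiffD1[OF x])
    ultimately show "x \<in> ?L" unfolding xe by simp
  qed
  also have "\<dots> \<in> sets (predictable M F T)"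
  proof (intro sets.Diff)
    show "space M \<times> {0..T} \<in> sets (predictable M F T)"
      using sets.top[of "predictable M F T"] by simp
    show "(\<Union>q\<in>?Q. {\<omega> \<in> space M. S \<omega> \<le> ennreal q} \<times> {q<..T}) \<in> sets (predictable M F T)"
    proof (rule sets.countable_UN')
      show "countable ?Q" by (simp add: countable_rat)
      show "(\<lambda>q. {\<omega> \<in> space M. S \<omega> \<le> ennreal q} \<times> {q<..T}) ` ?Q \<subseteq> sets (predictable M F T)"
        using predictable_rectI S_le by fastforce
    qed
  qed
  finally show ?thesis .
qed

end

section \<open>Integrals with respect to random measures and their atoms\<close>

text \<open>
  For \<open>t > 0\<close> this is the jump at time \<open>t\<close> of the process \<open>H \<star> \<mu>\<close>; the definition as an integral makes sense
  also where that process is infinite.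
\<close>

definition atom_integral ::
    "('a \<Rightarrow> real \<Rightarrow> real \<Rightarrow> ennreal) \<Rightarrow> ('a \<Rightarrow> (real \<times> real) measure) \<Rightarrow> 'a \<Rightarrow> real \<Rightarrow> ennreal" where
  "atom_integral H \<mu> \<omega> t = (\<integral>\<^sup>+(s, e). H \<omega> s e * indicator {t} s \<partial>\<mu> \<omega>)"

lemma strip_borel:
  fixes B :: "real set"
  assumes "B \<in> sets borel"
  shows "B \<times> UNIV \<in> sets (borel :: (real \<times> real) measure)"
proof -
  have "B \<times> UNIV \<in> sets (borel \<Otimes>\<^sub>M borel :: (real \<times> real) measure)"
    using assms by (intro pair_measureI) auto
  then show ?thesis unfolding borel_prod .
qed

lemma nn_integral_over_countable_fibres:
  fixes N :: "(real \<times> real) measure" and H :: "real \<Rightarrow> real \<Rightarrow> ennreal"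
  assumes C: "countable C"
    and H: "\<And>t. t \<in> C \<Longrightarrow> (\<lambda>(s, e). H s e * indicator {t} s) \<in> borel_measurable N"
  shows "(\<integral>\<^sup>+(s, e). H s e * indicator C s \<partial>N) =
    (\<integral>\<^sup>+t. (\<integral>\<^sup>+(s, e). H s e * indicator {t} s \<partial>N) \<partial>count_space C)"
proof -
  have "(\<integral>\<^sup>+t. (\<integral>\<^sup>+(s, e). H s e * indicator {t} s \<partial>N) \<partial>count_space C) =
    (\<integral>\<^sup>+x. (\<integral>\<^sup>+t. (case x of (s, e) \<Rightarrow> H s e * indicator {t} s) \<partial>count_space C) \<partial>N)"
    by (rule nn_integral_count_space_nn_integral[OF C H, symmetric])
  also have "\<dots> = (\<integral>\<^sup>+(s, e). H s e * indicator C s \<partial>N)"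
  proof (intro nn_integral_cong)
    fix x :: "real \<times> real" obtain s e where x: "x = (s, e)" by force
    have "(\<integral>\<^sup>+t. H s e * indicator {t} s \<partial>count_space C) =
      (\<integral>\<^sup>+t. H s e * indicator {s} t \<partial>count_space C)"
      by (intro nn_integral_cong) (auto split: split_indicator)
    also have "\<dots> = H s e * (\<integral>\<^sup>+t. indicator {s} t \<partial>count_space C)"
      by (rule nn_integral_cmult) auto
    also have "(\<integral>\<^sup>+t. indicator {s} t \<partial>count_space C) = emeasure (count_space C) ({s} \<inter> C)"
      by (subst nn_integral_indicator') auto
    also have "\<dots> = indicator C s" by (subst emeasure_count_space) (auto split: split_indicator)
    finally show "(\<integral>\<^sup>+t. (case x of (s, e) \<Rightarrow> H s e * indicator {t} s) \<partial>count_space C) =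
      (case x of (s, e) \<Rightarrow> H s e * indicator C s)"
      by (simp add: x)
  qed
  finally show ?thesis by simp
qed

lemma star_mono: "s \<le> t \<Longrightarrow> star H \<mu> \<omega> s \<le> star H \<mu> \<omega> t"
  unfolding star_def by (intro nn_integral_mono) (auto split: split_indicator)

lemma star_0 [simp]: "star H \<mu> \<omega> 0 = 0"
  unfolding star_def by (simp add: split_beta')

lemma star_le_star:
  "(\<And>s e. 0 < s \<Longrightarrow> s \<le> t \<Longrightarrow> H \<omega> s e \<le> G \<omega> s e) \<Longrightarrow> star H \<mu> \<omega> t \<le> star G \<mu> \<omega> t"
  unfolding star_def by (intro nn_integral_mono) (auto split: split_indicator)

text \<open>
  Stopping the integral process amounts to cutting the integrand at the stopping time, so that
  localized hypotheses become hypotheses on other integrands.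
\<close>

lemma star_stopped:
  assumes "0 \<le> t"
  shows "stopped S (star H \<mu>) \<omega> t = star (\<lambda>\<omega> s e. H \<omega> s e * indicator {s. ennreal s \<le> S \<omega>} s) \<mu> \<omega> t"
proof -
  have "indicator {0<..enn2real (min (ennreal t) (S \<omega>))} s =
    (indicator {s. ennreal s \<le> S \<omega>} s * indicator {0<..t} s :: ennreal)" for s :: real
  proof (cases "ennreal t \<le> S \<omega>")
    case True
    then have "ennreal s \<le> S \<omega>" if "s \<le> t" for s
      using that by (meson ennreal_leI order_trans)
    then show ?thesis using True assms by (auto simp: min_def split: split_indicator)
  next
    case False
    then obtain r where r: "S \<omega> = ennreal r" "0 \<le> r"
      by (metis ennreal_cases top_greatest)
    then have "r < t" using False by (auto simp: not_le ennreal_less_iff)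
    then have "enn2real (min (ennreal t) (S \<omega>)) = r"
      using r by (simp add: min_def ennreal_le_iff)
    then show ?thesis using r \<open>r < t\<close> by (auto simp: ennreal_le_iff split: split_indicator)
  qed
  then show ?thesis unfolding stopped_def star_def
    by (intro nn_integral_cong) (auto simp: mult.assoc)
qed

context filtered_prob_space
begin

abbreviation predictable_integrand :: "('a \<Rightarrow> real \<Rightarrow> real \<Rightarrow> 'b::topological_space) \<Rightarrow> bool" where
  "predictable_integrand W \<equiv>
     (\<lambda>((\<omega>, t), e). W \<omega> t e) \<in> borel_measurable (predictable_tilde M F T)"

lemma section_measurable:
  assumes W: "(\<lambda>((\<omega>, t), e). W \<omega> t e) \<in> measurable (predictable_tilde M F T) N" and \<omega>: "\<omega> \<in> space M"
  shows "(\<lambda>(s, e). W \<omega> s e) \<in> measurable (restrict_space borel ({0..T} \<times> UNIV)) N"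
proof -
  have fst: "fst \<in> measurable (restrict_space borel ({0..T} \<times> UNIV)) (restrict_space borel {0..T})"
    by (intro measurable_restrict_space3 borel_measurable_continuous_onI continuous_intros) auto
  have "(\<lambda>x. ((\<omega>, fst x), snd x)) \<in>
    measurable (restrict_space borel ({0..T} \<times> UNIV)) (predictable_tilde M F T)"
    by (intro measurable_Pair measurable_compose[OF fst predictable_section[OF \<omega>]]
        measurable_restrict_space1 borel_measurable_continuous_onI continuous_intros)
  from measurable_compose[OF this W] show ?thesis by (simp add: split_beta')
qed

text \<open>
  Integrands are controlled only on \<open>[0, T]\<close>; multiplied with the indicator of a set of times inside
  this interval, their sections are measurable on the whole plane.
\<close>

lemma section_times_indicator_measurable:
  fixes W :: "'a \<Rightarrow> real \<Rightarrow> real \<Rightarrow> ennreal"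
  assumes W: "predictable_integrand W" and \<omega>: "\<omega> \<in> space M"
    and B: "B \<in> sets borel" "B \<subseteq> {0..T}" and N: "sets N = sets borel"
  shows "(\<lambda>(s, e). W \<omega> s e * indicator B s) \<in> borel_measurable N"
proof -
  have "(\<lambda>x. (case x of (s, e) \<Rightarrow> W \<omega> s e) * indicator ({0..T} \<times> UNIV) x) \<in> borel_measurable borel"
    using section_measurable[OF W \<omega>]
    by (subst (asm) borel_measurable_restrict_space_iff_ennreal)
       (auto simp: borel_prod[symmetric])
  moreover have "(\<lambda>x. indicator B (fst x) :: ennreal) \<in> borel_measurable (borel :: (real \<times> real) measure)"
    using B by (auto simp: borel_prod[symmetric])
  ultimately have "(\<lambda>x. (case x of (s, e) \<Rightarrow> W \<omega> s e) * indicator ({0..T} \<times> UNIV) x * indicator B (fst x))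
      \<in> borel_measurable borel" by (rule borel_measurable_times_ennreal)
  also have "(\<lambda>x. (case x of (s, e) \<Rightarrow> W \<omega> s e) * indicator ({0..T} \<times> UNIV) x * indicator B (fst x)) =
     (\<lambda>(s, e). W \<omega> s e * indicator B s)"
    using B(2) by (auto simp: fun_eq_iff split: split_indicator)
  finally show ?thesis using N by (simp cong: measurable_cong_sets)
qed

lemma star_eq_left_limit_plus_atom:
  assumes W: "predictable_integrand W" and \<omega>: "\<omega> \<in> space M" and t: "0 < t" "t \<le> T"
    and N: "sets (\<mu> \<omega>) = sets borel"
  shows "star W \<mu> \<omega> t = (SUP n. star W \<mu> \<omega> (max 0 (t - 1 / real (Suc n)))) + atom_integral W \<mu> \<omega> t"
proof -
  let ?r = "\<lambda>n. max 0 (t - 1 / real (Suc n))"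
  note meas = section_times_indicator_measurable[OF W \<omega> _ _ N]
  have r_le: "?r n \<le> t" for n using t by simp
  have 1: "(\<lambda>(s, e). W \<omega> s e * indicator {0<..<t} s) \<in> borel_measurable (\<mu> \<omega>)"
    by (rule meas) (use t in auto)
  have 2: "(\<lambda>(s, e). W \<omega> s e * indicator {t} s) \<in> borel_measurable (\<mu> \<omega>)"
    by (rule meas) (use t in auto)
  have 3: "(\<lambda>(s, e). W \<omega> s e * indicator {0<..?r n} s) \<in> borel_measurable (\<mu> \<omega>)" for n
    by (rule meas) (use t r_le[of n] in \<open>auto simp del: max.bounded_iff intro: order_trans\<close>)
  have "star W \<mu> \<omega> t = (\<integral>\<^sup>+x. (case x of (s, e) \<Rightarrow> W \<omega> s e * indicator {0<..<t} s)
      + (case x of (s, e) \<Rightarrow> W \<omega> s e * indicator {t} s) \<partial>\<mu> \<omega>)"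
    unfolding star_def using t by (intro nn_integral_cong) (auto split: split_indicator)
  also have "\<dots> = (\<integral>\<^sup>+(s, e). W \<omega> s e * indicator {0<..<t} s \<partial>\<mu> \<omega>) + atom_integral W \<mu> \<omega> t"
    unfolding atom_integral_def using 1 2 by (intro nn_integral_add)
  also have "(\<integral>\<^sup>+(s, e). W \<omega> s e * indicator {0<..<t} s \<partial>\<mu> \<omega>) =
    (\<integral>\<^sup>+x. (SUP n. case x of (s, e) \<Rightarrow> W \<omega> s e * indicator {0<..?r n} s) \<partial>\<mu> \<omega>)"
  proof (intro nn_integral_cong)
    fix x :: "real \<times> real" obtain s e where x: "x = (s, e)" by force
    have "(SUP n. W \<omega> s e * indicator {0<..?r n} s) = W \<omega> s e * (SUP n. indicator {0<..?r n} s)"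
      by (rule SUP_mult_left_ennreal[symmetric])
    also have "(SUP n. indicator {0<..?r n} s) = (indicator {0<..<t} s :: ennreal)"
    proof (cases "s \<in> {0<..<t}")
      case True
      then obtain n where "1 / real (Suc n) < t - s"
        using nat_approx_posE[of "t - s"] by auto
      then have "indicator {0<..?r n} s = (1::ennreal)" using True
        by (intro indicator_simps(1)) (simp add: max.coboundedI2)
      then have "1 \<le> (SUP n. indicator {0<..?r n} s :: ennreal)" by (intro SUP_upper2[of n]) auto
      moreover have "(SUP n. indicator {0<..?r n} s :: ennreal) \<le> 1"
        by (intro SUP_least) (simp add: indicator_def)
      ultimately show ?thesis using True by (simp del: max_less_iff_conj)
    next
      case False
      moreover have "?r n < t" for n using t by simp
      ultimately have "s \<notin> {0<..?r n}" for n
        by (metis greaterThanAtMost_iff greaterThanLessThan_iff le_less_trans)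
      then have "indicator {0<..?r n} s = (0::ennreal)" for n by simp
      then show ?thesis using False by simp
    qed
    finally show "(case x of (s, e) \<Rightarrow> W \<omega> s e * indicator {0<..<t} s) =
      (SUP n. case x of (s, e) \<Rightarrow> W \<omega> s e * indicator {0<..?r n} s)"
      by (simp add: x)
  qed
  also have "\<dots> = (SUP n. star W \<mu> \<omega> (?r n))"
    unfolding star_def using 3
  proof (intro nn_integral_monotone_convergence_SUP)
    have "?r m \<le> ?r n" if "m \<le> n" for m n using that
      by (intro max.mono diff_left_mono divide_left_mono) auto
    then show "incseq (\<lambda>n x. case x of (s, e) \<Rightarrow> W \<omega> s e * indicator {0<..?r n} s)"
      by (auto simp: incseq_def le_fun_def split: split_indicator intro: order_trans)
  qed
  finally show ?thesis .
qed

lemma star_right_continuous: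
  assumes W: "predictable_integrand W" and \<omega>: "\<omega> \<in> space M" and t: "0 \<le> t" "t < T"
    and N: "sets (\<mu> \<omega>) = sets borel" and fin: "star W \<mu> \<omega> T < \<infinity>"
  shows "continuous (at_right t) (star W \<mu> \<omega>)"
  unfolding continuous_within
proof (rule tendsto_at_right_sequentially[OF t(2)])
  note meas = section_times_indicator_measurable[OF W \<omega> _ _ N]
  fix S :: "nat \<Rightarrow> real" assume S: "\<And>n. t < S n" "\<And>n. S n < T" "S \<longlonglongrightarrow> t"
  show "(\<lambda>n. star W \<mu> \<omega> (S n)) \<longlonglongrightarrow> star W \<mu> \<omega> t"
    unfolding star_def
  proof (rule nn_integral_dominated_convergence[where w = "\<lambda>(s, e). W \<omega> s e * indicator {0<..T} s"])
    show "(\<lambda>(s, e). W \<omega> s e * indicator {0<..S n} s) \<in> borel_measurable (\<mu> \<omega>)" for n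
      using S(2)[of n] by (intro meas) auto
    show "(\<lambda>(s, e). W \<omega> s e * indicator {0<..t} s) \<in> borel_measurable (\<mu> \<omega>)"
      "(\<lambda>(s, e). W \<omega> s e * indicator {0<..T} s) \<in> borel_measurable (\<mu> \<omega>)"
      using t by (intro meas; auto)+
    show "(\<integral>\<^sup>+ x. (case x of (s, e) \<Rightarrow> W \<omega> s e * indicator {0<..T} s) \<partial>\<mu> \<omega>) < \<infinity>"
      using fin by (simp add: star_def)
    show "AE x in \<mu> \<omega>. (case x of (s, e) \<Rightarrow> W \<omega> s e * indicator {0<..S n} s)
      \<le> (case x of (s, e) \<Rightarrow> W \<omega> s e * indicator {0<..T} s)" for n
      using S(2)[of n] by (auto split: split_indicator)
    show "AE x in \<mu> \<omega>. (\<lambda>n. case x of (s, e) \<Rightarrow> W \<omega> s e * indicator {0<..S n} s)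
      \<longlonglongrightarrow> (case x of (s, e) \<Rightarrow> W \<omega> s e * indicator {0<..t} s)"
    proof (intro AE_I2, clarify)
      fix s e :: real
      have "\<forall>\<^sub>F n in sequentially. indicator {0<..S n} s = (indicator {0<..t} s :: ennreal)"
      proof (cases "s \<le> t")
        case True
        then show ?thesis using S(1) by (intro always_eventually) (auto split: split_indicator intro: less_imp_le order_trans)
      next
        case False
        then have "\<forall>\<^sub>F n in sequentially. S n < s" using S(3) by (intro order_tendstoD(2)) auto
        then show ?thesis by eventually_elim (use False in \<open>auto split: split_indicator\<close>)
      qed
      then show "(\<lambda>n. W \<omega> s e * indicator {0<..S n} s) \<longlonglongrightarrow> W \<omega> s e * indicator {0<..t} s"
        by (intro tendsto_eventually) (auto elim: eventually_mono)
    qed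
  qed
qed

lemma random_measure_AE_in:
  assumes "random_measure M T \<mu>" "\<omega> \<in> space M"
  shows "AE x in \<mu> \<omega>. fst x \<in> {0<..T}"
  using assms strip_borel[of "- {0<..T}"]
  by (intro AE_I[where N = "- ({0<..T} \<times> UNIV)"]) (auto simp: random_measure_def)

lemma atom_integral_eq_0_outside:
  assumes "random_measure M T \<mu>" "\<omega> \<in> space M" "t \<notin> {0<..T}"
  shows "atom_integral W \<mu> \<omega> t = 0"
proof -
  have "AE x in \<mu> \<omega>. (case x of (s, e) \<Rightarrow> W \<omega> s e * indicator {t} s) = 0"
    using random_measure_AE_in[OF assms(1,2)]
    by eventually_elim (use assms(3) in \<open>auto split: split_indicator\<close>)
  then show ?thesis unfolding atom_integral_def by (simp cong: nn_integral_cong_AE)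
qed

lemma atom_integral_le_star:
  assumes "0 < t" "t \<le> u"
  shows "atom_integral W \<mu> \<omega> t \<le> star W \<mu> \<omega> u"
  unfolding atom_integral_def star_def using assms
  by (intro nn_integral_mono) (auto split: split_indicator)

section \<open>Predictable random measures and quasi-left-continuity\<close>

lemma star_predictable:
  assumes "predictable_random_measure M F T \<nu>" "predictable_integrand W"
  shows "(\<lambda>(\<omega>, t). star W \<nu> \<omega> t) \<in> borel_measurable (predictable M F T)"
  using assms unfolding predictable_random_measure_def by blast

lemma predictable_random_measure_sets:
  "predictable_random_measure M F T \<nu> \<Longrightarrow> \<omega> \<in> space M \<Longrightarrow> sets (\<nu> \<omega>) = sets borel"
  unfolding predictable_random_measure_def random_measure_def by blast

lemma predictable_process_adapted:
  assumes "(\<lambda>(\<omega>, t). Y \<omega> t) \<in> borel_measurable (predictable M F T)" "t \<in> {0..T}"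
  shows "(\<lambda>\<omega>. Y \<omega> t) \<in> borel_measurable (F t)"
  using measurable_compose[OF predictable_at[OF assms(2)] assms(1)] by simp

lemma star_borel_measurable_T:
  assumes "predictable_random_measure M F T \<nu>" "predictable_integrand W"
  shows "(\<lambda>\<omega>. star W \<nu> \<omega> T) \<in> borel_measurable M"
  using measurable_F_imp_M[of T] predictable_process_adapted[OF star_predictable[OF assms], of T] T_pos
  by auto

lemma AE_star_finite:
  assumes "predictable_random_measure M F T \<nu>" "predictable_integrand W"
    and "(\<integral>\<^sup>+\<omega>. star W \<nu> \<omega> T \<partial>M) < \<infinity>"
  shows "AE \<omega> in M. star W \<nu> \<omega> T < \<infinity>"
  using nn_integral_PInf_AE[OF star_borel_measurable_T[OF assms(1,2)]] assms(3)
  by (auto simp: less_top)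

lemma shifted_predictable:
  assumes "(\<lambda>(\<omega>, t). Y \<omega> t) \<in> measurable (predictable M F T) N" "0 \<le> d"
  shows "(\<lambda>(\<omega>, t). Y \<omega> (max 0 (t - d))) \<in> measurable (predictable M F T) N"
  using measurable_compose[OF predictable_shift[OF assms(2)] assms(1)] by (simp add: split_beta')

text \<open>
  Where \<open>W \<star> \<nu>\<close> is finite, the mass of the atoms is its jump, the difference of two predictable
  processes.
\<close>

lemma atom_integral_predictable_version:
  assumes \<nu>: "predictable_random_measure M F T \<nu>" and W: "predictable_integrand W"
  obtains p where "(\<lambda>(\<omega>, t). p \<omega> t) \<in> borel_measurable (predictable M F T)"
    and "\<And>\<omega> t. \<omega> \<in> space M \<Longrightarrow> star W \<nu> \<omega> T < \<infinity> \<Longrightarrow> t \<in> {0..T} \<Longrightarrow> p \<omega> t = atom_integral W \<nu> \<omega> t"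
proof
  let ?L = "\<lambda>\<omega> t. (SUP n. star W \<nu> \<omega> (max 0 (t - 1 / real (Suc n))))"
  have "(\<lambda>x. star W \<nu> (fst x) (max 0 (snd x - 1 / real (Suc n)))) \<in> borel_measurable (predictable M F T)" for n
    using shifted_predictable[OF star_predictable[OF \<nu> W], of "1 / real (Suc n)"] by (simp add: split_beta')
  moreover have "(\<lambda>x. star W \<nu> (fst x) (snd x)) \<in> borel_measurable (predictable M F T)"
    using star_predictable[OF \<nu> W] by (simp add: split_beta')
  ultimately show "(\<lambda>(\<omega>, t). star W \<nu> \<omega> t - ?L \<omega> t) \<in> borel_measurable (predictable M F T)"
    unfolding split_beta' by measurable
  fix \<omega> t assume \<omega>: "\<omega> \<in> space M" and fin: "star W \<nu> \<omega> T < \<infinity>" and t: "t \<in> {0..T}"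
  show "star W \<nu> \<omega> t - ?L \<omega> t = atom_integral W \<nu> \<omega> t"
  proof (cases "t = 0")
    case True
    then show ?thesis
      using atom_integral_eq_0_outside[OF _ \<omega>, of \<nu> t W] \<nu> by (simp add: predictable_random_measure_def)
  next
    case False
    have "?L \<omega> t \<le> star W \<nu> \<omega> T"
      using t T_pos by (intro SUP_least star_mono) (auto simp: max_def intro: order_trans[of _ t])
    then have "?L \<omega> t < \<top>" using fin by (simp only: infinity_ennreal_def le_less_trans)
    then have "?L \<omega> t \<noteq> \<top>" by (rule less_imp_neq)
    moreover have "star W \<nu> \<omega> t = ?L \<omega> t + atom_integral W \<nu> \<omega> t"
      using star_eq_left_limit_plus_atom[OF W \<omega>] False t predictable_random_measure_sets[OF \<nu> \<omega>] by auto
    ultimately show ?thesis by (metis ennreal_add_diff_cancel_left infinity_ennreal_def)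
  qed
qed

text \<open>
  The image of \<open>W \<cdot> \<mu> \<omega>\<close> under the time coordinate is a finite measure on the line, which has only
  countably many atoms.
\<close>

lemma countable_atoms:
  assumes W: "predictable_integrand W" and \<omega>: "\<omega> \<in> space M" and N: "sets (\<mu> \<omega>) = sets borel"
    and fin: "star W \<mu> \<omega> T < \<infinity>"
  shows "countable {t \<in> {0<..T}. 0 < atom_integral W \<mu> \<omega> t}"
proof -
  let ?h = "\<lambda>(s, e). W \<omega> s e * indicator {0<..T} s"
  define m where "m = distr (density (\<mu> \<omega>) ?h) borel fst"
  have h: "?h \<in> borel_measurable (\<mu> \<omega>)"
    by (intro section_times_indicator_measurable[OF W \<omega> _ _ N]) auto
  have fst: "fst \<in> measurable (density (\<mu> \<omega>) ?h) borel"
    using N by (simp cong: measurable_cong_sets)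
      (intro borel_measurable_continuous_onI continuous_intros)
  have m: "emeasure m B = (\<integral>\<^sup>+(s, e). W \<omega> s e * indicator {0<..T} s * indicator B s \<partial>\<mu> \<omega>)"
    if B: "B \<in> sets borel" for B
  proof -
    have "fst -` B \<inter> space (\<mu> \<omega>) \<in> sets (\<mu> \<omega>)"
      using measurable_sets[OF fst B] by simp
    then show ?thesis unfolding m_def using h fst B
      by (subst emeasure_distr) (auto simp: emeasure_density split_beta' indicator_def intro!: nn_integral_cong)
  qed
  have "emeasure m UNIV = star W \<mu> \<omega> T" by (simp add: m star_def)
  then interpret finite_measure m
    using fin by (intro finite_measureI) (auto simp: m_def)
  have "measure m {t} \<noteq> 0" if "0 < t" "t \<le> T" "0 < atom_integral W \<mu> \<omega> t" for t
  proof -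
    have "emeasure m {t} = atom_integral W \<mu> \<omega> t"
      using that by (subst m) (auto simp: atom_integral_def intro!: nn_integral_cong split: split_indicator)
    then show ?thesis using that by (auto simp: emeasure_eq_measure)
  qed
  then show ?thesis by (intro countable_subset[OF _ countable_support]) auto
qed

text \<open>
  For rational \<open>q\<close> let \<open>S\<^sub>q\<close> be the first time at which the increasing process \<open>W \<star> \<nu>\<close> reaches level
  \<open>q\<close>. By right-continuity \<open>t < S\<^sub>q\<close> is equivalent to \<open>(W \<star> \<nu>)\<^sub>t < q\<close>, which is a predictable
  condition, so \<open>S\<^sub>q\<close> is a predictable time and \<open>Y\<close> almost surely does not jump there. If \<open>t\<close> is an
  atom, then \<open>t = S\<^sub>q\<close> for every rational \<open>q\<close> strictly between the left limit of \<open>W \<star> \<nu>\<close> at \<open>t\<close>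
  and its value.
\<close>

lemma quasi_left_continuous_no_jump_at_atoms:
  assumes \<nu>: "predictable_random_measure M F T \<nu>" and W: "predictable_integrand W"
    and fin: "(\<integral>\<^sup>+\<omega>. star W \<nu> \<omega> T \<partial>M) < \<infinity>"
    and Y: "quasi_left_continuous M F T Y"
  shows "AE \<omega> in M. \<forall>t\<in>{0..T}. 0 < atom_integral W \<nu> \<omega> t \<longrightarrow> jump Y \<omega> t = 0"
proof -
  \<comment> \<open>On the null set \<open>b\<close> right-continuity may fail; there the times are set to \<open>\<infinity>\<close>.\<close>
  define b where "b = {\<omega> \<in> space M. star W \<nu> \<omega> T = \<infinity>}"
  have "b \<in> null_sets M"
  proof -
    have "b = {\<omega> \<in> space M. \<not> star W \<nu> \<omega> T < \<infinity>}"
      by (auto simp: b_def less_top[symmetric])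
    then show ?thesis using AE_star_finite[OF \<nu> W fin] by (simp add: AE_iff_null_sets)
  qed
  then have b: "b \<times> {0..T} \<in> sets (predictable M F T)" by (rule predictable_null)
  define S :: "rat \<Rightarrow> 'a \<Rightarrow> ennreal" where
    "S q \<omega> = (if \<omega> \<in> b then \<infinity> else (INF t\<in>{t\<in>{0..T}. ennreal (real_of_rat q) \<le> star W \<nu> \<omega> t}. ennreal t))" for q \<omega>
  have pred: "predictable_time M F T (S q)" for q
  proof -
    \<comment> \<open>Right-continuity makes the inequality for the infimum strict.\<close>
    have iff: "ennreal t < S q \<omega> \<longleftrightarrow> star W \<nu> \<omega> t < ennreal (real_of_rat q)"
      if \<omega>: "\<omega> \<in> space M" "\<omega> \<notin> b" and t: "t \<in> {0..T}" for \<omega> t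
    proof
      assume "ennreal t < S q \<omega>"
      moreover have "S q \<omega> \<le> ennreal t" if "ennreal (real_of_rat q) \<le> star W \<nu> \<omega> t"
        using \<omega> t that unfolding S_def by (auto intro: INF_lower)
      ultimately show "star W \<nu> \<omega> t < ennreal (real_of_rat q)" by (meson not_le)
    next
      assume less: "star W \<nu> \<omega> t < ennreal (real_of_rat q)"
      show "ennreal t < S q \<omega>"
      proof (cases "t = T")
        case True
        then have "star W \<nu> \<omega> s < ennreal (real_of_rat q)" if "s \<le> T" for s
          using less star_mono[OF that, of W \<nu> \<omega>] by (auto intro: le_less_trans)
        then have empty: "{t\<in>{0..T}. ennreal (real_of_rat q) \<le> star W \<nu> \<omega> t} = {}"
          by (auto simp: not_le[symmetric])
        have "S q \<omega> = \<top>"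
          unfolding S_def if_not_P[OF \<omega>(2)] empty by simp
        then show ?thesis by simp
      next
        case False
        then have "t < T" using t by auto
        have "continuous (at_right t) (star W \<nu> \<omega>)"
          using star_right_continuous[OF W \<omega>(1) _ \<open>t < T\<close>] predictable_random_measure_sets[OF \<nu> \<omega>(1)] t \<omega>
          by (auto simp: b_def less_top)
        then have "\<forall>\<^sub>F u in at_right t. star W \<nu> \<omega> u < ennreal (real_of_rat q)"
          unfolding continuous_within using less by (intro order_tendstoD(2)) auto
        moreover have "\<forall>\<^sub>F u in at_right t. t < u \<and> u < T"
          using \<open>t < T\<close> by (intro eventually_at_rightI) auto
        ultimately have "\<forall>\<^sub>F u in at_right t. t < u \<and> star W \<nu> \<omega> u < ennreal (real_of_rat q)"
          by eventually_elim auto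
        then have "\<exists>u. t < u \<and> star W \<nu> \<omega> u < ennreal (real_of_rat q)"
          by (rule eventually_happens'[rotated]) simp
        then obtain u where u: "t < u" "star W \<nu> \<omega> u < ennreal (real_of_rat q)" by blast
        have "ennreal u \<le> S q \<omega>"
          unfolding S_def if_not_P[OF \<omega>(2)]
        proof (intro INF_greatest, safe)
          fix s assume s: "ennreal (real_of_rat q) \<le> star W \<nu> \<omega> s"
          have "u \<le> s"
          proof (rule ccontr)
            assume "\<not> u \<le> s"
            then have "star W \<nu> \<omega> s \<le> star W \<nu> \<omega> u" by (intro star_mono) auto
            with s u show False by (meson leD order_trans)
          qed
          then show "ennreal u \<le> ennreal s" by (rule ennreal_leI)
        qed
        moreover have "ennreal t < ennreal u" using u t by (auto simp: ennreal_less_iff)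
        ultimately show ?thesis by (rule less_le_trans[rotated])
      qed
    qed
    have "{(\<omega>, t). \<omega> \<in> space M \<and> t \<in> {0..T} \<and> ennreal t < S q \<omega>} =
      {x \<in> space (predictable M F T). (case x of (\<omega>, t) \<Rightarrow> star W \<nu> \<omega> t) < ennreal (real_of_rat q)} \<union> b \<times> {0..T}"
      (is "?A = ?B")
    proof (intro set_eqI iffI)
      fix x assume "x \<in> ?A"
      then show "x \<in> ?B" using iff by (cases "fst x \<in> b") auto
    next
      fix x assume x: "x \<in> ?B"
      obtain \<omega> t where xe: "x = (\<omega>, t)" by force
      have "\<omega> \<in> space M" "t \<in> {0..T}" using x by (auto simp: xe b_def)
      moreover have "ennreal t < S q \<omega>"
      proof (cases "\<omega> \<in> b")
        case True
        then show ?thesis by (simp add: S_def)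
      next
        case False
        then show ?thesis using x iff[of \<omega> t] by (auto simp: xe)
      qed
      ultimately show "x \<in> ?A" by (auto simp: xe)
    qed
    also have "\<dots> \<in> sets (predictable M F T)"
      by (intro sets.Un borel_measurable_less b star_predictable[OF \<nu> W] borel_measurable_const)
    finally show ?thesis unfolding predictable_time_def .
  qed
  have "AE \<omega> in M. \<forall>q. S q \<omega> \<le> ennreal T \<longrightarrow> jump Y \<omega> (enn2real (S q \<omega>)) = 0"
    using Y pred unfolding quasi_left_continuous_def by (subst AE_all_countable) blast
  then show ?thesis
    using AE_star_finite[OF \<nu> W fin] AE_space
  proof eventually_elim
    fix \<omega> assume \<omega>: "\<omega> \<in> space M" and fin\<omega>: "star W \<nu> \<omega> T < \<infinity>"
      and jump: "\<forall>q. S q \<omega> \<le> ennreal T \<longrightarrow> jump Y \<omega> (enn2real (S q \<omega>)) = 0"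
    show "\<forall>t\<in>{0..T}. 0 < atom_integral W \<nu> \<omega> t \<longrightarrow> jump Y \<omega> t = 0"
    proof (intro ballI impI)
      fix t assume t: "t \<in> {0..T}" and pos: "0 < atom_integral W \<nu> \<omega> t"
      show "jump Y \<omega> t = 0"
      proof (cases "t = 0")
        case True
        then show ?thesis by (simp add: jump_def)
      next
        case False
        let ?L = "(SUP n. star W \<nu> \<omega> (max 0 (t - 1 / real (Suc n))))"
        have eq: "star W \<nu> \<omega> t = ?L + atom_integral W \<nu> \<omega> t"
          using star_eq_left_limit_plus_atom[OF W \<omega>] False t predictable_random_measure_sets[OF \<nu> \<omega>] by auto
        have "star W \<nu> \<omega> t < \<infinity>"
          using star_mono[of t T W \<nu> \<omega>] fin\<omega> t by (auto intro: le_less_trans)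
        then have "?L \<noteq> \<top>" unfolding eq by (metis ennreal_add_eq_top infinity_ennreal_def less_irrefl)
        then have "?L + 0 < ?L + atom_integral W \<nu> \<omega> t"
          using pos by (simp del: of_nat_Suc)
        then have "?L < star W \<nu> \<omega> t" unfolding eq by (simp only: add_0_right)
        then obtain q where q: "?L < ennreal (real_of_rat q)" "ennreal (real_of_rat q) < star W \<nu> \<omega> t"
          using ennreal_rat_dense by blast
        have "S q \<omega> = ennreal t"
          unfolding S_def
        proof (subst if_not_P)
          show "\<omega> \<notin> b" using fin\<omega> by (auto simp: b_def)
          show "(INF t\<in>{t\<in>{0..T}. ennreal (real_of_rat q) \<le> star W \<nu> \<omega> t}. ennreal t) = ennreal t"
          proof (intro antisym INF_greatest INF_lower)
            show "t \<in> {t\<in>{0..T}. ennreal (real_of_rat q) \<le> star W \<nu> \<omega> t}" using t q by auto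
            fix s assume s: "s \<in> {t\<in>{0..T}. ennreal (real_of_rat q) \<le> star W \<nu> \<omega> t}"
            have "t \<le> s"
            proof (rule ccontr)
              assume "\<not> t \<le> s"
              then obtain n where "1 / real (Suc n) < t - s"
                using nat_approx_posE[of "t - s"] by auto
              then have "star W \<nu> \<omega> s \<le> star W \<nu> \<omega> (max 0 (t - 1 / real (Suc n)))"
                by (intro star_mono) auto
              also have "\<dots> \<le> ?L" by (rule SUP_upper) simp
              finally show False using s q(1) by (auto dest: order_trans simp: not_le[symmetric])
            qed
            then show "ennreal t \<le> ennreal s" by (rule ennreal_leI)
          qed
        qed
        then show ?thesis using jump[rule_format, of q] t by (auto simp: ennreal_leI)
      qed
    qed
  qed
qed

text \<open>
  Both measures give the same expectation to \<open>W\<close>, and an expectation of \<open>0\<close> forces a nonnegative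
  variable to vanish.
\<close>

lemma compensator_null_transfer:
  assumes "compensator M F T \<mu> \<nu>" and W: "predictable_integrand W"
    and "AE \<omega> in M. star W \<mu> \<omega> T = 0"
  shows "AE \<omega> in M. star W \<nu> \<omega> T = 0"
proof -
  have \<nu>: "predictable_random_measure M F T \<nu>" using assms(1) by (simp add: compensator_def)
  have "(\<integral>\<^sup>+\<omega>. star W \<nu> \<omega> T \<partial>M) = (\<integral>\<^sup>+\<omega>. star W \<mu> \<omega> T \<partial>M)"
    using assms(1) W unfolding compensator_def by blast
  also have "\<dots> = 0" using nn_integral_cong_AE[OF assms(3)] by simp
  finally show ?thesis
    using nn_integral_0_iff_AE[OF star_borel_measurable_T[OF \<nu> W]] by simp
qed

text \<open>
  The left limit is the limit of the delayed processes, each of which is predictable.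
\<close>

lemma predictable_jump:
  assumes Y: "cadlag M T Y" and pred: "(\<lambda>(\<omega>, t). Y \<omega> t) \<in> borel_measurable (predictable M F T)"
  shows "(\<lambda>(\<omega>, t). jump Y \<omega> t) \<in> borel_measurable (predictable M F T)"
proof (rule borel_measurable_LIMSEQ_real)
  let ?r = "\<lambda>n t. max 0 (t - 1 / real (Suc n)) :: real"
  show "(\<lambda>(\<omega>, t). Y \<omega> t - Y \<omega> (?r n t)) \<in> borel_measurable (predictable M F T)" for n
  proof -
    have "(\<lambda>x. Y (fst x) (?r n (snd x))) \<in> borel_measurable (predictable M F T)"
      using shifted_predictable[OF pred, of "1 / real (Suc n)"] by (simp add: split_beta')
    moreover have "(\<lambda>x. Y (fst x) (snd x)) \<in> borel_measurable (predictable M F T)"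
      using pred by (simp add: split_beta')
    ultimately show ?thesis unfolding split_beta' by measurable
  qed
  fix x assume "x \<in> space (predictable M F T)"
  then obtain \<omega> t where x: "x = (\<omega>, t)" "\<omega> \<in> space M" "0 \<le> t" "t \<le> T" by auto
  have "(\<lambda>n. Y \<omega> t - Y \<omega> (?r n t)) \<longlonglongrightarrow> jump Y \<omega> t"
  proof (cases "t = 0")
    case True
    then show ?thesis by (simp add: jump_def)
  next
    case False
    then obtain l where l: "(Y \<omega> \<longlongrightarrow> l) (at_left t)"
      using Y x unfolding cadlag_def by (metis greaterThanAtMost_iff order_le_less)
    have "(\<lambda>n. 1 / real (Suc n)) \<longlonglongrightarrow> 0"
      using LIMSEQ_inverse_real_of_nat by (simp add: inverse_eq_divide)
    then have "(\<lambda>n. ?r n t) \<longlonglongrightarrow> max 0 (t - 0)"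
      by (intro tendsto_max tendsto_diff tendsto_const)
    moreover have "?r n t < t" for n using False x by simp
    ultimately have "filterlim (\<lambda>n. ?r n t) (at_left t) sequentially"
      using x by (intro filterlim_at_withinI always_eventually) (auto simp: less_imp_neq)
    then have "(\<lambda>n. Y \<omega> (?r n t)) \<longlonglongrightarrow> l"
      using filterlim_compose[OF l] by blast
    moreover have "Lim (at_left t) (Y \<omega>) = l"
      by (rule tendsto_Lim[OF _ l]) simp
    ultimately show ?thesis
      using False x by (auto simp: jump_def intro!: tendsto_diff)
  qed
  then show "(\<lambda>n. (case x of (\<omega>, t) \<Rightarrow> Y \<omega> t - Y \<omega> (?r n t))) \<longlonglongrightarrow> (case x of (\<omega>, t) \<Rightarrow> jump Y \<omega> t)"
    by (simp add: x)
qed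

lemma star_jump_measure:
  assumes W: "predictable_integrand W" and \<omega>: "\<omega> \<in> space M" and t: "t \<le> T"
  shows "star W (jump_measure T X) \<omega> t =
    (\<integral>\<^sup>+s. W \<omega> s (jump X \<omega> s) * indicator {0<..t} s \<partial>count_space {s \<in> {0<..T}. jump X \<omega> s \<noteq> 0})"
proof -
  have "(\<lambda>(s, e). W \<omega> s e * indicator {0<..t} s) \<in> borel_measurable borel"
    using t by (intro section_times_indicator_measurable[OF W \<omega>]) auto
  then show ?thesis unfolding star_def jump_measure_def
    by (subst nn_integral_distr) auto
qed

end

section \<open>Integer-valued random measures are carried by their atoms\<close>

text \<open>
  The distribution function of the time coordinate under \<open>N\<close> restricted to \<open>E\<close> is continuous because
  there are no atoms in time, and it takes integer values. If \<open>E\<close> had positive mass, the intermediate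
  value theorem would give a point at which it is \<open>1 / 2\<close>.
\<close>

lemma atomless_integer_valued_null:
  fixes N :: "(real \<times> real) measure"
  assumes N: "sets N = sets borel" and E: "E \<in> sets borel" and fin: "emeasure N E < \<infinity>"
    and int: "\<And>B. B \<in> sets borel \<Longrightarrow> emeasure N B \<in> range ennreal_of_enat"
    and atomless: "\<And>t. emeasure N (E \<inter> ({t} \<times> UNIV)) = 0"
  shows "emeasure N E = 0"
proof -
  define m where "m = distr (density N (indicator E)) borel fst"
  have fst: "fst \<in> borel_measurable (borel :: (real \<times> real) measure)"
    by (intro borel_measurable_continuous_onI continuous_intros)
  have m: "emeasure m B = emeasure N (E \<inter> (B \<times> UNIV))" if B: "B \<in> sets borel" for B
  proof -
    have "emeasure m B = emeasure (density N (indicator E)) (B \<times> UNIV)"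
      unfolding m_def using B fst N sets_eq_imp_space_eq[OF N]
      by (subst emeasure_distr) (auto cong: measurable_cong_sets intro!: arg_cong2[where f = emeasure])
    also have "\<dots> = (\<integral>\<^sup>+x. indicator (E \<inter> (B \<times> UNIV)) x \<partial>N)"
      using E N strip_borel[OF B] by (subst emeasure_density) (simp_all add: indicator_inter_arith[symmetric] del: nn_integral_indicator)
    also have "\<dots> = emeasure N (E \<inter> (B \<times> UNIV))"
      using E N strip_borel[OF B] by (intro nn_integral_indicator) auto
    finally show ?thesis .
  qed
  have "finite_measure m"
    using m[of UNIV] fin by (intro finite_measureI) (auto simp: m_def)
  then interpret finite_borel_measure m
    by (intro finite_borel_measure.intro finite_borel_measure_axioms.intro) (simp_all add: m_def)
  have "measure m {x} = 0" for x
    using m[of "{x}"] atomless[of x] by (simp add: measure_def)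
  then have cont: "isCont (cdf m) x" for x by (simp add: isCont_cdf)
  have nat: "\<exists>n. cdf m x = real n" for x
  proof -
    have "E \<inter> ({..x} \<times> UNIV) \<in> sets borel" using E strip_borel[of "{..x}"] by auto
    then obtain k where k: "emeasure m {..x} = ennreal_of_enat k" using int m[of "{..x}"] by auto
    then obtain n where "k = enat n"
      using emeasure_finite[of "{..x}"] by (cases k) auto
    then have "ennreal (cdf m x) = of_nat n"
      using k by (simp add: cdf_def2 emeasure_eq_measure)
    then show ?thesis by (metis cdf_nonneg ennreal_inj ennreal_of_nat_eq_real_of_nat of_nat_0_le_iff)
  qed
  have "measure m (space m) = 0"
  proof (rule ccontr)
    assume pos: "measure m (space m) \<noteq> 0"
    then have c: "0 < measure m (space m)" by (simp add: less_le)
    have "\<forall>\<^sub>F x in at_top. 0 < cdf m x" by (rule order_tendstoD(1)[OF cdf_lim_at_top c])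
    then obtain b where "\<And>x. x \<ge> b \<Longrightarrow> 0 < cdf m x" by (auto simp: eventually_at_top_linorder)
    then have b: "0 < cdf m b" by simp
    have "\<forall>\<^sub>F x in at_bot. cdf m x < 1 / 2" by (rule order_tendstoD(2)[OF cdf_lim_at_bot]) simp
    then obtain a where "\<And>x. x \<le> a \<Longrightarrow> cdf m x < 1 / 2" by (auto simp: eventually_at_bot_linorder)
    then have a: "cdf m (min a b) < 1 / 2" by simp
    have "1 \<le> cdf m b" using nat[of b] b by auto
    then obtain x where "cdf m x = 1 / 2"
      using IVT[where f = "cdf m" and a = "min a b" and b = b and y = "1 / 2"] less_imp_le[OF a] cont
      by fastforce
    with nat[of x] obtain n where "real n = 1 / 2" by auto
    then have "2 * n = 1" by linarith
    then show False by presburger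
  qed
  moreover have "space m = UNIV" by (simp add: m_def)
  ultimately have "emeasure m UNIV = 0" by (simp add: emeasure_eq_measure)
  then show ?thesis using m[of UNIV] by simp
qed

context filtered_prob_space
begin

lemma optional_random_measure_sets:
  "optional_random_measure M F T \<mu> \<Longrightarrow> \<omega> \<in> space M \<Longrightarrow> sets (\<mu> \<omega>) = sets borel"
  unfolding optional_random_measure_def random_measure_def by blast

lemma optional_star_adapted:
  assumes \<mu>: "optional_random_measure M F T \<mu>" and W: "predictable_integrand W" and t: "t \<in> {0..T}"
  shows "(\<lambda>\<omega>. star W \<mu> \<omega> t) \<in> borel_measurable (F t)"
proof -
  have "(\<lambda>(\<omega>, t). star W \<mu> \<omega> t) \<in> borel_measurable (optional M F T)"
    using \<mu> predictable_tilde_imp_optional_tilde[OF W] unfolding optional_random_measure_def by blast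
  from measurable_compose[OF optional_at[OF t] this] show ?thesis by simp
qed

text \<open>
  Away from the countably many times charged by \<open>\<mu> \<omega>\<close>, every set \<open>{V \<ge> 1 / n}\<close> has finite mass
  and no atoms in time, so it is null by integrality. Hence \<open>\<mu> \<omega>\<close> is carried by its atoms in time.
\<close>

lemma star_eq_sum_over_atoms:
  assumes \<mu>: "integer_valued_random_measure M F T \<mu>" and V: "predictable_integrand V"
    and V_pos: "\<And>t e. t \<in> {0..T} \<Longrightarrow> 0 < V \<omega> t e" and \<omega>: "\<omega> \<in> space M"
    and fin: "star V \<mu> \<omega> T < \<infinity>" and H: "predictable_integrand H" and t: "t \<in> {0..T}"
  shows "star H \<mu> \<omega> t = (\<integral>\<^sup>+s. atom_integral H \<mu> \<omega> s \<partial>count_space {0..t})"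
proof -
  have rm: "random_measure M T \<mu>" and N: "sets (\<mu> \<omega>) = sets borel"
    and int: "\<And>B. B \<in> sets borel \<Longrightarrow> emeasure (\<mu> \<omega>) B \<in> range ennreal_of_enat"
    using \<mu> \<omega> unfolding integer_valued_random_measure_def optional_random_measure_def random_measure_def
    by blast+
  define C where "C = {t \<in> {0<..T}. 0 < atom_integral V \<mu> \<omega> t}"
  have C: "countable C" unfolding C_def by (rule countable_atoms[OF V \<omega> N fin])
  then have C_meas: "C \<in> sets borel" by (rule sets.countable[rotated]) auto
  have null_atom: "emeasure (\<mu> \<omega>) ({s} \<times> UNIV) = 0" if s: "s \<in> {0<..T} - C" for s
  proof -
    have V_nonzero: "V \<omega> s e \<noteq> 0" for e using V_pos[of s e] s by auto
    have meas: "(\<lambda>(r, e). V \<omega> r e * indicator {s} r) \<in> borel_measurable (\<mu> \<omega>)"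
      by (rule section_times_indicator_measurable[OF V \<omega> _ _ N]) (use s in auto)
    have "atom_integral V \<mu> \<omega> s = 0" using s by (auto simp: C_def)
    then have "AE x in \<mu> \<omega>. (case x of (r, e) \<Rightarrow> V \<omega> r e * indicator {s} r) = 0"
      using nn_integral_0_iff_AE[OF meas] by (simp add: atom_integral_def)
    then have "AE x in \<mu> \<omega>. x \<notin> {s} \<times> UNIV"
      by eventually_elim (auto simp: V_nonzero)
    then show ?thesis using strip_borel[of "{s}"] N Measure_Space.AE_iff_null_sets[of "{s} \<times> UNIV" "\<mu> \<omega>"]
      by (simp add: null_sets_def)
  qed
  define h where "h = (\<lambda>(s, e). V \<omega> s e * indicator {0<..T} s)"
  have h: "h \<in> borel_measurable (\<mu> \<omega>)"
    unfolding h_def by (intro section_times_indicator_measurable[OF V \<omega> _ _ N]) auto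
  have "AE x in \<mu> \<omega>. x \<notin> ({0<..T} - C) \<times> UNIV"
  proof -
    \<comment> \<open>The sets \<open>E n\<close> exhaust the part over the uncharged times, and each has finite mass by Markov's
       inequality.\<close>
    define E where "E n = {x \<in> space (\<mu> \<omega>). 1 / ennreal (Suc n) \<le> h x} \<inter> (({0<..T} - C) \<times> UNIV)" for n :: nat
    have E_meas: "E n \<in> sets (\<mu> \<omega>)" for n
      unfolding E_def using h strip_borel[of "{0<..T} - C"] C_meas N by (intro sets.Int) (auto intro: borel_measurable_le)
    have "emeasure (\<mu> \<omega>) (E n) = 0" for n
    proof (rule atomless_integer_valued_null[OF N _ _ int])
      show "E n \<in> sets borel" using E_meas N by simp
      have "emeasure (\<mu> \<omega>) (E n) = (\<integral>\<^sup>+x. indicator (E n) x \<partial>\<mu> \<omega>)"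
        by (rule nn_integral_indicator[symmetric, OF E_meas])
      also have "\<dots> \<le> (\<integral>\<^sup>+x. ennreal (Suc n) * h x \<partial>\<mu> \<omega>)"
      proof (intro nn_integral_mono)
        fix x
        have "1 \<le> ennreal (Suc n) * h x" if "1 / ennreal (Suc n) \<le> h x"
        proof -
          have "ennreal (Suc n) * (1 / ennreal (Suc n)) \<le> ennreal (Suc n) * h x"
            by (rule mult_left_mono[OF that]) simp
          moreover have "ennreal (Suc n) * (1 / ennreal (Suc n)) = 1"
            by (simp add: ennreal_times_divide ennreal_divide_self)
          ultimately show ?thesis by simp
        qed
        then show "indicator (E n) x \<le> ennreal (Suc n) * h x"
          by (auto simp: E_def split: split_indicator)
      qed
      also have "\<dots> = ennreal (Suc n) * star V \<mu> \<omega> T"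
        using h by (subst nn_integral_cmult) (auto simp: star_def h_def)
      also have "\<dots> < \<infinity>" using fin by (simp add: ennreal_mult_less_top)
      finally show "emeasure (\<mu> \<omega>) (E n) < \<infinity>" .
      fix s
      show "emeasure (\<mu> \<omega>) (E n \<inter> {s} \<times> UNIV) = 0"
      proof (cases "s \<in> {0<..T} - C")
        case True
        then have "emeasure (\<mu> \<omega>) (E n \<inter> {s} \<times> UNIV) \<le> emeasure (\<mu> \<omega>) ({s} \<times> UNIV)"
          using strip_borel[of "{s}"] N by (intro emeasure_mono) auto
        then show ?thesis using null_atom[OF True] by simp
      next
        case False
        then have "E n \<inter> {s} \<times> UNIV = {}" by (auto simp: E_def)
        then show ?thesis by simp
      qed
    qed
    then have "AE x in \<mu> \<omega>. \<forall>n. x \<notin> E n"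
      using E_meas by (subst AE_all_countable) (auto intro: AE_not_in simp: null_sets_def)
    then show ?thesis
      using AE_space
    proof eventually_elim
      fix x assume x: "\<forall>n. x \<notin> E n" "x \<in> space (\<mu> \<omega>)"
      show "x \<notin> ({0<..T} - C) \<times> UNIV"
      proof
        assume x': "x \<in> ({0<..T} - C) \<times> UNIV"
        then have "0 < h x" using V_pos by (auto simp: h_def)
        then obtain n where "1 / ennreal (Suc n) \<le> h x"
        proof -
          obtain r where r: "0 < r" "ennreal r < h x"
            using ennreal_rat_dense[OF \<open>0 < h x\<close>] by (metis ennreal_less_zero_iff)
          obtain n where "1 / real (Suc n) < r" using nat_approx_posE[OF r(1)] by auto
          then have "ennreal (1 / real (Suc n)) \<le> h x"
            using r by (meson ennreal_leI less_imp_le order_trans)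
          moreover have "1 / ennreal (Suc n) = ennreal (1 / real (Suc n))"
            by (metis divide_ennreal ennreal_1 of_nat_0_less_iff zero_less_Suc zero_le_one)
          ultimately show ?thesis by (intro that[of n]) (simp only:)
        qed
        then show False using x x' by (auto simp: E_def)
      qed
    qed
  qed
  with random_measure_AE_in[OF rm \<omega>] have AE_C: "AE x in \<mu> \<omega>. fst x \<in> C"
    by eventually_elim (auto simp: mem_Times_iff)
  have "star H \<mu> \<omega> t = (\<integral>\<^sup>+(s, e). H \<omega> s e * indicator (C \<inter> {0<..t}) s \<partial>\<mu> \<omega>)"
    unfolding star_def
  proof (rule nn_integral_cong_AE)
    show "AE x in \<mu> \<omega>. (case x of (s, e) \<Rightarrow> H \<omega> s e * indicator {0<..t} s) =
      (case x of (s, e) \<Rightarrow> H \<omega> s e * indicator (C \<inter> {0<..t}) s)"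
      using AE_C by eventually_elim (auto split: split_indicator)
  qed
  also have "\<dots> = (\<integral>\<^sup>+s. atom_integral H \<mu> \<omega> s \<partial>count_space (C \<inter> {0<..t}))"
    unfolding atom_integral_def
  proof (rule nn_integral_over_countable_fibres)
    show "countable (C \<inter> {0<..t})" using C by auto
    show "(\<lambda>(r, e). H \<omega> r e * indicator {s} r) \<in> borel_measurable (\<mu> \<omega>)" if "s \<in> C \<inter> {0<..t}" for s
      by (rule section_times_indicator_measurable[OF H \<omega> _ _ N]) (use that in \<open>auto simp: C_def\<close>)
  qed
  also have "\<dots> = (\<integral>\<^sup>+s. atom_integral H \<mu> \<omega> s \<partial>count_space {0..t})"
  proof (rule nn_integral_count_space_eq)
    fix s assume s: "s \<in> {0..t} - C \<inter> {0<..t}"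
    show "atom_integral H \<mu> \<omega> s = 0"
    proof (cases "s = 0")
      case True
      then show ?thesis using atom_integral_eq_0_outside[OF rm \<omega>] by simp
    next
      case False
      then have "emeasure (\<mu> \<omega>) ({s} \<times> UNIV) = 0" using s t by (intro null_atom) auto
      then have "AE x in \<mu> \<omega>. x \<notin> {s} \<times> UNIV"
        using strip_borel[of "{s}"] N by (intro AE_not_in) (auto simp: null_sets_def)
      then have "AE x in \<mu> \<omega>. (case x of (r, e) \<Rightarrow> H \<omega> r e * indicator {s} r) = 0"
        by eventually_elim (auto simp: indicator_eq_0_iff)
      then show ?thesis unfolding atom_integral_def by (simp cong: nn_integral_cong_AE)
    qed
  qed (auto simp: C_def)
  finally show ?thesis .
qed

section \<open>Almost everywhere with respect to the Doleans measure\<close>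

abbreviation product_tilde :: "(('a \<times> real) \<times> real) measure" where
  "product_tilde \<equiv> (M \<Otimes>\<^sub>M restrict_space borel {0..T}) \<Otimes>\<^sub>M borel"

lemma predictable_imp_product:
  "f \<in> measurable (predictable M F T) N \<Longrightarrow> f \<in> measurable (M \<Otimes>\<^sub>M restrict_space borel {0..T}) N"
proof -
  let ?P = "M \<Otimes>\<^sub>M restrict_space borel {0..T}"
  have rect: "A \<times> (B \<inter> {0..T}) \<in> sets ?P" if "A \<in> sets M" "B \<in> sets borel" for A B
    using that by (intro pair_measureI) (auto simp: sets_restrict_space Int_commute)
  have "(\<lambda>x. x) \<in> measurable ?P (predictable M F T)"
  proof (rule measurable_predictableI)
    fix A assume A: "A \<in> sets (F 0)"
    then have AM: "A \<in> sets M" using sets_F_subset[of 0] T_pos by auto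
    have "(\<lambda>x. x) -` (A \<times> {0}) \<inter> space ?P = A \<times> ({0} \<inter> {0..T})"
      using sets.sets_into_space[OF AM] T_pos by (auto simp: space_pair_measure space_restrict_space)
    then show "(\<lambda>x. x) -` (A \<times> {0}) \<inter> space ?P \<in> sets ?P" using rect[OF AM, of "{0}"] by simp
  next
    fix A s t assume *: "0 \<le> s" "s < t" "t \<le> T" "A \<in> sets (F s)"
    then have AM: "A \<in> sets M" using sets_F_subset[of s] by auto
    have "(\<lambda>x. x) -` (A \<times> {s<..t}) \<inter> space ?P = A \<times> ({s<..t} \<inter> {0..T})"
      using sets.sets_into_space[OF AM] * by (auto simp: space_pair_measure space_restrict_space)
    then show "(\<lambda>x. x) -` (A \<times> {s<..t}) \<inter> space ?P \<in> sets ?P" using rect[OF AM, of "{s<..t}"] by simp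
  qed (auto simp: space_pair_measure space_restrict_space)
  then show "f \<in> measurable (predictable M F T) N \<Longrightarrow> f \<in> measurable ?P N"
    using measurable_compose by blast
qed

lemma predictable_tilde_imp_product_tilde:
  assumes "f \<in> measurable (predictable_tilde M F T) N"
  shows "f \<in> measurable product_tilde N"
proof -
  have "(\<lambda>x. x) \<in> measurable (M \<Otimes>\<^sub>M restrict_space borel {0..T}) (predictable M F T)"
    by (intro predictable_imp_product) simp
  then have "(\<lambda>x. (fst x, snd x)) \<in> measurable product_tilde (predictable_tilde M F T)"
    by measurable
  then show ?thesis using measurable_compose[OF _ assms] by auto
qed

lemma product_tilde_regroup:
  fixes H :: "'a \<Rightarrow> real \<Rightarrow> real \<Rightarrow> ennreal"
  assumes H: "(\<lambda>((\<omega>, s), e). H \<omega> s e) \<in> borel_measurable product_tilde"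
  shows "(\<lambda>(\<omega>, x). H \<omega> (fst x) (snd x) * indicator {0<..T} (fst x)) \<in> borel_measurable (M \<Otimes>\<^sub>M borel)"
proof -
  let ?R = "restrict_space (M \<Otimes>\<^sub>M (borel :: (real \<times> real) measure)) (space M \<times> {0..T} \<times> UNIV)"
  have fst: "fst \<in> borel_measurable (borel :: (real \<times> real) measure)"
    and snd: "snd \<in> borel_measurable (borel :: (real \<times> real) measure)"
    by (intro borel_measurable_continuous_onI continuous_intros)+
  have "(\<lambda>x. fst (snd x)) \<in> measurable ?R (restrict_space borel {0..T})"
    by (intro measurable_restrict_space3 measurable_compose[OF measurable_snd fst]) auto
  moreover have "fst \<in> measurable ?R M"
    by (intro measurable_restrict_space1) simp
  moreover have "(\<lambda>x. snd (snd x)) \<in> borel_measurable ?R"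
    by (intro measurable_restrict_space1 measurable_compose[OF measurable_snd snd])
  ultimately have "(\<lambda>x. ((fst x, fst (snd x)), snd (snd x))) \<in> measurable ?R product_tilde"
    by (intro measurable_Pair)
  from measurable_compose[OF this H]
  have 1: "(\<lambda>x. H (fst x) (fst (snd x)) (snd (snd x))) \<in> borel_measurable ?R" by simp
  have "space M \<times> {0..T} \<times> UNIV \<in> sets (M \<Otimes>\<^sub>M (borel :: (real \<times> real) measure))"
    by (intro pair_measureI strip_borel) auto
  then have 2: "(\<lambda>x. H (fst x) (fst (snd x)) (snd (snd x)) * indicator (space M \<times> {0..T} \<times> UNIV) x)
    \<in> borel_measurable (M \<Otimes>\<^sub>M (borel :: (real \<times> real) measure))"
    using 1 by (subst (asm) borel_measurable_restrict_space_iff_ennreal) auto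
  have 3: "(\<lambda>x. indicator {0<..T} (fst (snd x)) :: ennreal)
    \<in> borel_measurable (M \<Otimes>\<^sub>M (borel :: (real \<times> real) measure))"
    by (rule measurable_compose[OF measurable_compose[OF measurable_snd fst] borel_measurable_indicator]) simp
  have eq: "(case x of (\<omega>, x) \<Rightarrow> H \<omega> (fst x) (snd x) * indicator {0<..T} (fst x)) =
    H (fst x) (fst (snd x)) (snd (snd x)) * indicator (space M \<times> {0..T} \<times> UNIV) x
      * indicator {0<..T} (fst (snd x))" if "x \<in> space (M \<Otimes>\<^sub>M borel)" for x
    using that by (auto simp: space_pair_measure split: split_indicator)
  show ?thesis
    using borel_measurable_times_ennreal[OF 2 3] by (subst measurable_cong[OF eq])
qed

text \<open>
  An optional random measure is measurable in \<open>\<omega>\<close> by definition only for optional integrands. The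
  general case holds because \<open>V \<cdot> \<mu>\<close>, normalized to mass at most \<open>1\<close>, is a subprobability kernel: its
  mass on a fixed Borel set is the integral of a predictable function. Dividing by the density then
  recovers the integral of \<open>H\<close> with respect to \<open>\<mu>\<close> wherever \<open>V \<star> \<mu>\<close> is finite.
\<close>

lemma star_borel_measurable_of_product:
  fixes H :: "'a \<Rightarrow> real \<Rightarrow> real \<Rightarrow> ennreal"
  assumes \<mu>: "integer_valued_random_measure M F T \<mu>"
    and H: "(\<lambda>((\<omega>, s), e). H \<omega> s e) \<in> borel_measurable product_tilde"
  shows "(\<lambda>\<omega>. star H \<mu> \<omega> T) \<in> borel_measurable M"
proof -
  have opt: "optional_random_measure M F T \<mu>"
    using \<mu> unfolding integer_valued_random_measure_def by blast
  obtain V0 where V0: "predictable_integrand V0" "\<And>\<omega> t e. \<omega> \<in> space M \<Longrightarrow> t \<in> {0..T} \<Longrightarrow> (0::ennreal) < V0 \<omega> t e"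
    "(\<integral>\<^sup>+\<omega>. star V0 \<mu> \<omega> T \<partial>M) < \<infinity>"
    using \<mu> unfolding integer_valued_random_measure_def by blast
  \<comment> \<open>The minimum makes the weight finite, so that it can be divided by.\<close>
  define V where "V \<omega> t e = min (V0 \<omega> t e) 1" for \<omega> t e
  have V: "predictable_integrand V"
    using V0(1) unfolding V_def split_beta' by measurable
  have V_pos: "0 < V \<omega> t e" "V \<omega> t e \<noteq> \<top>" if "\<omega> \<in> space M" "t \<in> {0..T}" for \<omega> t e
    using V0(2)[OF that] by (auto simp: V_def min_def top_unique)
  have T: "T \<in> {0..T}" using T_pos by auto
  have star_meas: "(\<lambda>\<omega>. star W \<mu> \<omega> T) \<in> borel_measurable M" if "predictable_integrand W" for W
    by (rule measurable_F_imp_M[OF T optional_star_adapted[OF opt that T]])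
  have fin: "AE \<omega> in M. star V \<mu> \<omega> T < \<infinity>"
  proof -
    have "(\<integral>\<^sup>+\<omega>. star V \<mu> \<omega> T \<partial>M) \<le> (\<integral>\<^sup>+\<omega>. star V0 \<mu> \<omega> T \<partial>M)"
      by (intro nn_integral_mono star_le_star) (simp add: V_def)
    then have "(\<integral>\<^sup>+\<omega>. star V \<mu> \<omega> T \<partial>M) < \<infinity>" using V0(3) by (rule le_less_trans)
    then show ?thesis using nn_integral_PInf_AE[OF star_meas[OF V]] by (auto simp: less_top)
  qed
  define c where "c \<omega> = inverse (1 + star V \<mu> \<omega> T)" for \<omega>
  \<comment> \<open>The factor \<open>c\<close> normalizes the mass; it is \<open>0\<close>, by \<open>1 / \<infinity> = 0\<close>, where \<open>V \<star> \<mu>\<close> is infinite.\<close>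
  define K where "K \<omega> = density (\<mu> \<omega>) (\<lambda>(s, e). V \<omega> s e * indicator {0<..T} s * c \<omega>)" for \<omega>
  have sets: "sets (\<mu> \<omega>) = sets borel" if "\<omega> \<in> space M" for \<omega>
    by (rule optional_random_measure_sets[OF opt that])
  have dens: "(\<lambda>(s, e). V \<omega> s e * indicator {0<..T} s * c \<omega>) \<in> borel_measurable (\<mu> \<omega>)"
    and V_sec: "(\<lambda>(s, e). V \<omega> s e * indicator {0<..T} s) \<in> borel_measurable (\<mu> \<omega>)"
    if "\<omega> \<in> space M" for \<omega>
  proof -
    show "(\<lambda>(s, e). V \<omega> s e * indicator {0<..T} s) \<in> borel_measurable (\<mu> \<omega>)"
      by (rule section_times_indicator_measurable[OF V that _ _ sets[OF that]]) auto
    then show "(\<lambda>(s, e). V \<omega> s e * indicator {0<..T} s * c \<omega>) \<in> borel_measurable (\<mu> \<omega>)"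
      unfolding split_beta' by measurable
  qed
  have K_emeasure: "emeasure (K \<omega>) B = star (\<lambda>\<omega> s e. V \<omega> s e * indicator B (s, e)) \<mu> \<omega> T * c \<omega>"
    if \<omega>: "\<omega> \<in> space M" and B: "B \<in> sets borel" for \<omega> B
  proof -
    have BN: "B \<in> sets (\<mu> \<omega>)" using B sets[OF \<omega>] by simp
    have "emeasure (K \<omega>) B = (\<integral>\<^sup>+x. ((case x of (s, e) \<Rightarrow> V \<omega> s e * indicator {0<..T} s) * indicator B x) * c \<omega> \<partial>\<mu> \<omega>)"
      unfolding K_def using dens[OF \<omega>] BN
      by (subst emeasure_density) (auto intro!: nn_integral_cong simp: ac_simps)
    also have "\<dots> = (\<integral>\<^sup>+x. (case x of (s, e) \<Rightarrow> V \<omega> s e * indicator {0<..T} s) * indicator B x \<partial>\<mu> \<omega>) * c \<omega>"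
      using V_sec[OF \<omega>] BN by (intro nn_integral_multc borel_measurable_times_ennreal) auto
    finally show ?thesis
      by (simp add: star_def split_beta' ac_simps)
  qed
  have "K \<in> measurable M (subprob_algebra borel)"
  proof (rule measurable_subprob_algebra)
    fix \<omega> assume \<omega>: "\<omega> \<in> space M"
    show sK: "sets (K \<omega>) = sets borel" using sets[OF \<omega>] by (simp add: K_def)
    then have spK: "space (K \<omega>) = UNIV" by (simp add: sets_eq_imp_space_eq)
    have "emeasure (K \<omega>) UNIV = star V \<mu> \<omega> T / (1 + star V \<mu> \<omega> T)"
      using K_emeasure[OF \<omega>, of UNIV] by (simp add: c_def divide_ennreal_def)
    also have "\<dots> \<le> 1"
    proof (cases "star V \<mu> \<omega> T = \<top>")
      case False
      then show ?thesis by (intro divide_le_posI_ennreal) (auto intro!: add_pos_nonneg)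
    qed simp
    finally show "subprob_space (K \<omega>)" by (intro subprob_spaceI) (auto simp: spK)
  next
    fix B :: "(real \<times> real) set" assume B: "B \<in> sets borel"
    have "(\<lambda>x. (snd (fst x), snd x)) \<in> measurable (predictable_tilde M F T) (borel \<Otimes>\<^sub>M borel)"
      by (intro measurable_Pair measurable_compose[OF measurable_fst predictable_time_measurable]) simp
    then have "(\<lambda>x. indicator B (snd (fst x), snd x) :: ennreal) \<in> borel_measurable (predictable_tilde M F T)"
      using B by (intro measurable_compose[OF _ borel_measurable_indicator]) (auto simp: borel_prod)
    moreover have "(\<lambda>x. V (fst (fst x)) (snd (fst x)) (snd x)) \<in> borel_measurable (predictable_tilde M F T)"
      using V by (simp add: split_beta')
    ultimately have "predictable_integrand (\<lambda>\<omega> s e. V \<omega> s e * indicator B (s, e))"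
      unfolding split_beta' by (rule borel_measurable_times_ennreal[rotated])
    from star_meas[OF this] have "(\<lambda>\<omega>. star (\<lambda>\<omega> s e. V \<omega> s e * indicator B (s, e)) \<mu> \<omega> T * c \<omega>) \<in> borel_measurable M"
      unfolding c_def using star_meas[OF V] by measurable
    then show "(\<lambda>\<omega>. emeasure (K \<omega>) B) \<in> borel_measurable M"
      by (subst measurable_cong[OF K_emeasure]) (use B in auto)
  qed
  note K = this
  define G where "G \<omega> x = H \<omega> (fst x) (snd x) * indicator {0<..T} (fst x)
      * (inverse (V \<omega> (fst x) (snd x) * indicator {0<..T} (fst x)) * (1 + star V \<mu> \<omega> T))" for \<omega> x
  have G: "(\<lambda>(\<omega>, x). G \<omega> x) \<in> borel_measurable (M \<Otimes>\<^sub>M borel)"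
  proof -
    have "(\<lambda>(\<omega>, x). V \<omega> (fst x) (snd x) * indicator {0<..T} (fst x)) \<in> borel_measurable (M \<Otimes>\<^sub>M borel)"
      by (rule product_tilde_regroup[OF predictable_tilde_imp_product_tilde[OF V]])
    then show ?thesis
      using product_tilde_regroup[OF H] measurable_compose[OF measurable_fst star_meas[OF V]]
      unfolding G_def split_beta' by measurable
  qed
  have "(\<lambda>\<omega>. integral\<^sup>N (K \<omega>) (G \<omega>)) \<in> borel_measurable M"
    by (rule nn_integral_measurable_subprob_algebra2[OF G K])
  then have "(\<lambda>\<omega>. integral\<^sup>N (K \<omega>) (G \<omega>)) \<in> borel_measurable (F T)"
    using space_F[OF T] F_T by (simp cong: measurable_cong_sets)
  moreover have "AE \<omega> in M. integral\<^sup>N (K \<omega>) (G \<omega>) = star H \<mu> \<omega> T"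
    using fin AE_space
  proof eventually_elim
    fix \<omega> assume fin: "star V \<mu> \<omega> T < \<infinity>" and \<omega>: "\<omega> \<in> space M"
    have "G \<omega> \<in> borel_measurable (\<mu> \<omega>)"
      using measurable_Pair2[OF G \<omega>] sets[OF \<omega>] by (simp cong: measurable_cong_sets)
    then have "integral\<^sup>N (K \<omega>) (G \<omega>) =
      (\<integral>\<^sup>+x. (case x of (s, e) \<Rightarrow> V \<omega> s e * indicator {0<..T} s * c \<omega>) * G \<omega> x \<partial>\<mu> \<omega>)"
      unfolding K_def by (rule nn_integral_density[OF dens[OF \<omega>]])
    also have "\<dots> = star H \<mu> \<omega> T"
      unfolding star_def
    proof (intro nn_integral_cong)
      fix x :: "real \<times> real" obtain s e where x: "x = (s, e)" by force
      show "(case x of (s, e) \<Rightarrow> V \<omega> s e * indicator {0<..T} s * c \<omega>) * G \<omega> x =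
        (case x of (s, e) \<Rightarrow> H \<omega> s e * indicator {0<..T} s)"
      proof (cases "s \<in> {0<..T}")
        case True
        then have 1: "V \<omega> s e * inverse (V \<omega> s e) = 1"
          using V_pos[OF \<omega>, of s e] ennreal_divide_self[of "V \<omega> s e"] by (auto simp: divide_ennreal_def less_top[symmetric])
        have 2: "c \<omega> * (1 + star V \<mu> \<omega> T) = 1"
          using fin ennreal_divide_self[of "1 + star V \<mu> \<omega> T"]
          by (auto simp: less_top[symmetric] c_def divide_ennreal_def mult.commute ennreal_add_eq_top)
        have "(case x of (s, e) \<Rightarrow> V \<omega> s e * indicator {0<..T} s * c \<omega>) * G \<omega> x =
          (V \<omega> s e * inverse (V \<omega> s e)) * (c \<omega> * (1 + star V \<mu> \<omega> T)) * H \<omega> s e"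
          using True by (simp add: G_def x ac_simps)
        then show ?thesis using True by (simp add: 1 2 x)
      qed (simp add: x)
    qed
    finally show "integral\<^sup>N (K \<omega>) (G \<omega>) = star H \<mu> \<omega> T" .
  qed
  ultimately have "(\<lambda>\<omega>. star H \<mu> \<omega> T) \<in> borel_measurable (F T)"
    by (rule measurable_F_AE_cong[OF T])
  then show ?thesis by (rule measurable_F_imp_M[OF T])
qed

text \<open>
  The set function that defines the Doleans measure is countably additive, since the integrals of all
  indicators are measurable in \<open>\<omega>\<close>. So a null set \<open>N\<close> for it really satisfies \<open>E[1\<^sub>N \<star> \<mu>\<^sub>T] = 0\<close>, and
  almost every section of \<open>N\<close> is a null set for \<open>\<mu> \<omega>\<close>.
\<close>

lemma AE_doleans_measure:
  assumes \<mu>: "integer_valued_random_measure M F T \<mu>"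
    and P: "AE x in doleans_measure M T \<mu>. P x"
  shows "AE \<omega> in M. AE x in \<mu> \<omega>. P ((\<omega>, fst x), snd x)"
proof -
  let ?Q = product_tilde
  let ?m = "\<lambda>B. \<integral>\<^sup>+\<omega>. star (\<lambda>\<omega> s e. indicator B ((\<omega>, s), e)) \<mu> \<omega> T \<partial>M"
  have opt: "optional_random_measure M F T \<mu>" and rm: "random_measure M T \<mu>"
    using \<mu> unfolding integer_valued_random_measure_def optional_random_measure_def by blast+
  have space_Q: "space ?Q = (space M \<times> {0..T}) \<times> UNIV"
    by (simp add: space_pair_measure space_restrict_space)
  have ind_meas: "(\<lambda>((\<omega>, s), e). indicator B ((\<omega>, s), e) :: ennreal) \<in> borel_measurable ?Q" if "B \<in> sets ?Q" for B
    using that by (simp add: split_beta')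
  have star_meas: "(\<lambda>\<omega>. star (\<lambda>\<omega> s e. indicator B ((\<omega>, s), e)) \<mu> \<omega> T) \<in> borel_measurable M"
    if "B \<in> sets ?Q" for B
    by (rule star_borel_measurable_of_product[OF \<mu> ind_meas[OF that]])
  have sec_meas: "(\<lambda>x. indicator B ((\<omega>, fst x), snd x) * indicator {0<..T} (fst x) :: ennreal)
      \<in> borel_measurable (\<mu> \<omega>)" if "\<omega> \<in> space M" "B \<in> sets ?Q" for \<omega> B
    using measurable_Pair2[OF product_tilde_regroup[OF ind_meas[OF that(2)]] that(1)]
      optional_random_measure_sets[OF opt that(1)]
    by (simp cong: measurable_cong_sets)
  have "countably_additive (sets ?Q) ?m"
  proof (rule countably_additiveI)
    fix A :: "nat \<Rightarrow> (('a \<times> real) \<times> real) set"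
    assume A: "range A \<subseteq> sets ?Q" "disjoint_family A"
    have "(\<Sum>i. ?m (A i)) = (\<integral>\<^sup>+\<omega>. (\<Sum>i. star (\<lambda>\<omega> s e. indicator (A i) ((\<omega>, s), e)) \<mu> \<omega> T) \<partial>M)"
      using A(1) star_meas by (intro nn_integral_suminf[symmetric]) auto
    also have "\<dots> = ?m (\<Union>i. A i)"
    proof (intro nn_integral_cong)
      fix \<omega> assume \<omega>: "\<omega> \<in> space M"
      have "(\<Sum>i. star (\<lambda>\<omega> s e. indicator (A i) ((\<omega>, s), e)) \<mu> \<omega> T) =
        (\<integral>\<^sup>+x. (\<Sum>i. indicator (A i) ((\<omega>, fst x), snd x) * indicator {0<..T} (fst x)) \<partial>\<mu> \<omega>)"
        unfolding star_def split_beta' using A(1) \<omega>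
        by (intro nn_integral_suminf[symmetric] sec_meas) auto
      also have "\<dots> = star (\<lambda>\<omega> s e. indicator (\<Union>i. A i) ((\<omega>, s), e)) \<mu> \<omega> T"
        unfolding star_def split_beta' by (intro nn_integral_cong) (simp add: suminf_indicator[OF A(2)])
      finally show "(\<Sum>i. star (\<lambda>\<omega> s e. indicator (A i) ((\<omega>, s), e)) \<mu> \<omega> T) =
        star (\<lambda>\<omega> s e. indicator (\<Union>i. A i) ((\<omega>, s), e)) \<mu> \<omega> T" .
    qed
    finally show "(\<Sum>i. ?m (A i)) = ?m (\<Union>i. A i)" .
  qed
  moreover have "positive (sets ?Q) ?m" by (simp add: positive_def star_def split_beta')
  ultimately have em: "emeasure (doleans_measure M T \<mu>) B = ?m B" if "B \<in> sets ?Q" for B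
    unfolding doleans_measure_def space_Q[symmetric] using that
    by (intro emeasure_measure_of_sigma sets.sigma_algebra_axioms)
  have sets_d: "sets (doleans_measure M T \<mu>) = sets ?Q"
    and space_d: "space (doleans_measure M T \<mu>) = (space M \<times> {0..T}) \<times> UNIV"
    unfolding doleans_measure_def space_Q[symmetric] by simp_all
  obtain N where N: "{x \<in> space (doleans_measure M T \<mu>). \<not> P x} \<subseteq> N"
    "emeasure (doleans_measure M T \<mu>) N = 0" "N \<in> sets ?Q"
    using P by (auto elim!: AE_E simp: sets_d)
  have "AE \<omega> in M. star (\<lambda>\<omega> s e. indicator N ((\<omega>, s), e)) \<mu> \<omega> T = 0"
    using N em[of N] nn_integral_0_iff_AE[OF star_meas[OF N(3)]] by simp
  then show ?thesis
    using AE_space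
  proof eventually_elim
    fix \<omega> assume \<omega>: "\<omega> \<in> space M" and 0: "star (\<lambda>\<omega> s e. indicator N ((\<omega>, s), e)) \<mu> \<omega> T = 0"
    have "AE x in \<mu> \<omega>. indicator N ((\<omega>, fst x), snd x) * indicator {0<..T} (fst x) = (0::ennreal)"
      using 0 nn_integral_0_iff_AE[OF sec_meas[OF \<omega> N(3)]] by (simp add: star_def split_beta')
    with random_measure_AE_in[OF rm \<omega>] show "AE x in \<mu> \<omega>. P ((\<omega>, fst x), snd x)"
    proof eventually_elim
      fix x assume x: "indicator N ((\<omega>, fst x), snd x) * indicator {0<..T} (fst x) = (0::ennreal)"
        "fst x \<in> {0<..T}"
      then have "((\<omega>, fst x), snd x) \<notin> N" by (auto split: split_indicator_asm)
      moreover have "((\<omega>, fst x), snd x) \<in> space (doleans_measure M T \<mu>)"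
        using x \<omega> by (auto simp: space_d)
      ultimately show "P ((\<omega>, fst x), snd x)" using N(1) by blast
    qed
  qed
qed

end

section \<open>Null sets of the compensator\<close>

lemma nn_integral_eq_imp_AE_eq:
  assumes f: "f \<in> borel_measurable N" and g: "g \<in> borel_measurable N"
    and le: "AE x in N. f x \<le> g x" and eq: "integral\<^sup>N N f = integral\<^sup>N N g" and fin: "integral\<^sup>N N f < \<infinity>"
  shows "AE x in N. f x = g x"
proof -
  have "(\<integral>\<^sup>+x. g x - f x \<partial>N) = integral\<^sup>N N g - integral\<^sup>N N f"
    using f g le fin by (intro nn_integral_diff) auto
  also have "\<dots> = 0" using eq fin by simp
  finally have "AE x in N. g x - f x = 0"
    using f g by (subst (asm) nn_integral_0_iff_AE) auto
  then show ?thesis using le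
    by eventually_elim (metis antisym diff_eq_0_iff_ennreal infinity_ennreal_def order_less_imp_le order_refl)
qed

context filtered_prob_space
begin

lemma integral_over_countable_times:
  assumes H: "predictable_integrand H" and \<omega>: "\<omega> \<in> space M" and N: "sets (\<mu> \<omega>) = sets borel"
    and C: "countable C" "C \<subseteq> {0..T}"
  shows "(\<integral>\<^sup>+(s, e). H \<omega> s e * indicator C s \<partial>\<mu> \<omega>) = (\<integral>\<^sup>+s. atom_integral H \<mu> \<omega> s \<partial>count_space C)"
  unfolding atom_integral_def
proof (rule nn_integral_over_countable_fibres[OF C(1)])
  fix t assume "t \<in> C"
  then show "(\<lambda>(s, e). H \<omega> s e * indicator {t} s) \<in> borel_measurable (\<mu> \<omega>)"
    using C(2) by (intro section_times_indicator_measurable[OF H \<omega> _ _ N]) auto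
qed

lemma compensator_null_atoms:
  assumes comp: "compensator M F T \<mu> \<nu>" and W: "predictable_integrand W"
    and 0: "AE \<omega> in M. star W \<mu> \<omega> T = 0"
  shows "AE \<omega> in M. \<forall>t\<in>{0..T}. atom_integral W \<nu> \<omega> t = 0"
  using compensator_null_transfer[OF assms] AE_space
proof eventually_elim
  fix \<omega> assume *: "star W \<nu> \<omega> T = 0" and \<omega>: "\<omega> \<in> space M"
  have rm: "random_measure M T \<nu>"
    using comp by (simp add: compensator_def predictable_random_measure_def)
  show "\<forall>t\<in>{0..T}. atom_integral W \<nu> \<omega> t = 0"
  proof
    fix t assume t: "t \<in> {0..T}"
    show "atom_integral W \<nu> \<omega> t = 0"
    proof (cases "t = 0")
      case True
      then show ?thesis using atom_integral_eq_0_outside[OF rm \<omega>] by simp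
    next
      case False
      then show ?thesis using atom_integral_le_star[of t T W \<nu> \<omega>] t * by auto
    qed
  qed
qed

lemma atom_integral_cong:
  "(\<And>e. H \<omega> t e = G \<omega> t e) \<Longrightarrow> atom_integral H \<mu> \<omega> t = atom_integral G \<mu> \<omega> t"
  unfolding atom_integral_def by (intro nn_integral_cong) (auto split: split_indicator)

lemma predictable_process_integrand:
  assumes "(\<lambda>(\<omega>, t). Y \<omega> t) \<in> measurable (predictable M F T) N"
  shows "(\<lambda>x. Y (fst (fst x)) (snd (fst x))) \<in> measurable (predictable_tilde M F T) N"
  using measurable_compose[OF measurable_fst assms] by (simp add: split_beta')

lemma predictable_set_integrand:
  assumes "J \<in> sets (predictable M F T)"
  shows "(\<lambda>x. indicator J (fst (fst x), snd (fst x)) :: 'b::{zero_neq_one,topological_space})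
    \<in> borel_measurable (predictable_tilde M F T)"
  using measurable_compose[OF measurable_fst borel_measurable_indicator[OF assms]] by simp

end

section \<open>Local integrability of the square root of an integral process\<close>

lemma powr_ennreal_half_mono: "x \<le> y \<Longrightarrow> powr_ennreal x (1 / 2) \<le> powr_ennreal y (1 / 2)"
  unfolding powr_ennreal_def
  by (auto simp: top_unique less_top intro!: ennreal_leI powr_mono2 enn2real_mono)

lemma powr_ennreal_half_measurable: "(\<lambda>x. powr_ennreal x (1 / 2)) \<in> borel_measurable borel"
  unfolding powr_ennreal_def by measurable

lemma powr_ennreal_eq_top_iff: "powr_ennreal x q = \<top> \<longleftrightarrow> x = \<top>"
  by (simp add: powr_ennreal_def)

lemma continuous_at_right_powr_ennreal_half:
  fixes f :: "real \<Rightarrow> ennreal"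
  assumes f: "continuous (at_right t) f" and fin: "f t \<noteq> \<top>"
  shows "continuous (at_right t) (\<lambda>s. powr_ennreal (f s) (1 / 2))"
proof -
  have lim: "(f \<longlongrightarrow> f t) (at_right t)" using f by (simp add: continuous_within)
  have sqrt: "powr_ennreal x (1 / 2) = ennreal (sqrt (enn2real x))" if "x \<noteq> \<top>" for x
    using that by (simp add: powr_ennreal_def powr_half_sqrt)
  have "\<forall>\<^sub>F s in at_right t. f s < \<top>"
    using fin by (intro order_tendstoD(2)[OF lim]) (simp add: less_top)
  then have "\<forall>\<^sub>F s in at_right t. ennreal (sqrt (enn2real (f s))) = powr_ennreal (f s) (1 / 2)"
    by eventually_elim (simp add: sqrt)
  moreover have "((\<lambda>s. ennreal (sqrt (enn2real (f s)))) \<longlongrightarrow> ennreal (sqrt (enn2real (f t)))) (at_right t)"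
    using fin by (intro tendsto_ennrealI tendsto_real_sqrt tendsto_enn2real) (auto simp: less_top lim)
  ultimately have "((\<lambda>s. powr_ennreal (f s) (1 / 2)) \<longlongrightarrow> ennreal (sqrt (enn2real (f t)))) (at_right t)"
    by (rule Lim_transform_eventually[rotated])
  then show ?thesis
    using fin by (simp add: continuous_within sqrt)
qed

text \<open>
  The summand \<open>1\<close> comes from \<open>sqrt c \<le> 1 + c\<close>.
\<close>

lemma powr_ennreal_half_le:
  assumes "x \<le> b * b + c"
  shows "powr_ennreal x (1 / 2) \<le> b + 1 + c"
proof (cases "b = \<top> \<or> c = \<top>")
  case True
  then show ?thesis by auto
next
  case False
  then obtain b' c' where b: "b = ennreal b'" "0 \<le> b'" and c: "c = ennreal c'" "0 \<le> c'"
    by (metis ennreal_cases)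
  have "powr_ennreal x (1 / 2) \<le> powr_ennreal (b * b + c) (1 / 2)"
    by (rule powr_ennreal_half_mono[OF assms])
  also have "b * b + c = ennreal (b' * b' + c')"
    using b c by (simp add: ennreal_mult ennreal_plus)
  also have "powr_ennreal \<dots> (1 / 2) = ennreal (sqrt (b' * b' + c'))"
    using b c by (simp add: powr_ennreal_def powr_half_sqrt del: ennreal_plus)
  also have "\<dots> \<le> ennreal (b' + 1 + c')"
  proof (intro ennreal_leI real_le_lsqrt)
    have "0 \<le> c' * c' + 2 * b' + 2 * b' * c' + c' + 1" using b c by simp
    then show "b' * b' + c' \<le> (b' + 1 + c')\<^sup>2"
      by (simp add: power2_eq_square algebra_simps)
  qed (use b c in auto)
  also have "\<dots> = b + 1 + c"
    using b c by (simp add: ennreal_plus)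
  finally show ?thesis .
qed

context filtered_prob_space
begin

lemma localizing_min:
  assumes S: "localizing M F T S" and S': "localizing M F T S'"
  shows "localizing M F T (\<lambda>n \<omega>. min (S n \<omega>) (S' n \<omega>))"
  unfolding localizing_def
proof (intro conjI allI)
  fix n show "is_stopping_time F T (\<lambda>\<omega>. min (S n \<omega>) (S' n \<omega>))"
    using S S' unfolding localizing_def is_stopping_time_def by (auto intro: stopping_time_min)
next
  have "AE \<omega> in M. incseq (\<lambda>n. S n \<omega>) \<and> (SUP n. S n \<omega>) = \<infinity>"
    "AE \<omega> in M. incseq (\<lambda>n. S' n \<omega>) \<and> (SUP n. S' n \<omega>) = \<infinity>"
    using S S' by (auto simp: localizing_def)
  then show "AE \<omega> in M. incseq (\<lambda>n. min (S n \<omega>) (S' n \<omega>)) \<and> (SUP n. min (S n \<omega>) (S' n \<omega>)) = \<infinity>"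
  proof eventually_elim
    fix \<omega> assume 1: "incseq (\<lambda>n. S n \<omega>) \<and> (SUP n. S n \<omega>) = \<infinity>"
      and 2: "incseq (\<lambda>n. S' n \<omega>) \<and> (SUP n. S' n \<omega>) = \<infinity>"
    have "incseq (\<lambda>n. min (S n \<omega>) (S' n \<omega>))"
      using 1 2 by (intro incseq_SucI min.mono) (auto dest: incseq_SucD)
    moreover have "(SUP n. min (S n \<omega>) (S' n \<omega>)) = \<top>"
    proof (subst SUP_eq_top_iff, intro allI impI)
      fix x :: ennreal assume x: "x < \<top>"
      obtain n where n: "x < S n \<omega>" using 1 x by (metis SUP_eq_top_iff UNIV_I infinity_ennreal_def)
      obtain m where m: "x < S' m \<omega>" using 2 x by (metis SUP_eq_top_iff UNIV_I infinity_ennreal_def)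
      have "x < S (max n m) \<omega>"
        using n 1 unfolding incseq_def by (meson less_le_trans max.cobounded1)
      moreover have "x < S' (max n m) \<omega>"
        using m 2 unfolding incseq_def by (meson less_le_trans max.cobounded2)
      ultimately show "\<exists>i\<in>UNIV. x < min (S i \<omega>) (S' i \<omega>)" by (intro bexI[of _ "max n m"]) auto
    qed
    ultimately show "incseq (\<lambda>n. min (S n \<omega>) (S' n \<omega>)) \<and> (SUP n. min (S n \<omega>) (S' n \<omega>)) = \<infinity>" by simp
  qed
qed

lemma stopped_time_in:
  assumes "t \<in> {0..T}"
  shows "enn2real (min (ennreal t) s) \<in> {0..t}"
proof -
  have "enn2real (min (ennreal t) s) \<le> enn2real (ennreal t)" by (intro enn2real_mono) auto
  then show ?thesis using assms by simp
qed

lemma stopped_integrand: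
  assumes G: "predictable_integrand G" and S: "is_stopping_time F T S"
  shows "predictable_integrand (\<lambda>\<omega> s e. G \<omega> s e * indicator {s. ennreal s \<le> S \<omega>} s :: ennreal)"
proof -
  let ?I = "{(\<omega>, t). \<omega> \<in> space M \<and> t \<in> {0..T} \<and> ennreal t \<le> S \<omega>}"
  have "(\<lambda>x. indicator ?I (fst (fst x), snd (fst x)) :: ennreal) \<in> borel_measurable (predictable_tilde M F T)"
    by (rule predictable_set_integrand[OF stopping_interval_predictable[OF S]])
  then have "(\<lambda>x. G (fst (fst x)) (snd (fst x)) (snd x) * indicator ?I (fst (fst x), snd (fst x)))
      \<in> borel_measurable (predictable_tilde M F T)"
    using G unfolding split_beta' by (intro borel_measurable_times_ennreal)
  then show ?thesis
    by (rule measurable_cong[THEN iffD1, rotated])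
       (auto simp: space_pair_measure indicator_eq_0_iff split: split_indicator)
qed

text \<open>
  The optional random measure provides adaptedness of the square root process, and the two locally
  integrable processes \<open>B\<close> and \<open>C\<close> provide the bound in expectation up to the minimum of their
  localizing times. Finiteness at \<open>T\<close> after stopping gives right-continuity.
\<close>

lemma A_plus_loc_sqrt_star:
  assumes \<mu>: "optional_random_measure M F T \<mu>" and G: "predictable_integrand G"
    and Z: "AE \<omega> in M. \<forall>t\<in>{0..T}. Z \<omega> t = powr_ennreal (star G \<mu> \<omega> t) (1 / 2)"
    and S: "localizing M F T S" "\<And>n. A_plus M F T (stopped (S n) B)"
    and S': "localizing M F T S'" "\<And>n. A_plus M F T (stopped (S' n) C)"
    and mono: "\<And>\<omega> s t. s \<le> t \<Longrightarrow> B \<omega> s \<le> B \<omega> t" "\<And>\<omega> s t. s \<le> t \<Longrightarrow> C \<omega> s \<le> C \<omega> t"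
    and le: "AE \<omega> in M. \<forall>t\<in>{0..T}. Z \<omega> t \<le> B \<omega> t + 1 + C \<omega> t"
  shows "A_plus_loc M F T Z"
  unfolding A_plus_loc_def
proof (intro exI conjI allI)
  let ?R = "\<lambda>n \<omega>. min (S n \<omega>) (S' n \<omega>)"
  show R: "localizing M F T ?R" by (rule localizing_min[OF S(1) S'(1)])
  fix n
  have Rn: "is_stopping_time F T (?R n)" using R unfolding localizing_def by blast
  have T: "T \<in> {0..T}" using T_pos by auto
  define H where "H \<omega> s e = G \<omega> s e * indicator {s. ennreal s \<le> ?R n \<omega>} s" for \<omega> s e
  have H: "predictable_integrand H" unfolding H_def by (rule stopped_integrand[OF G Rn])
  have Zs: "AE \<omega> in M. \<forall>t\<in>{0..T}. stopped (?R n) Z \<omega> t = powr_ennreal (star H \<mu> \<omega> t) (1 / 2)"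
    using Z
  proof eventually_elim
    fix \<omega> assume Z: "\<forall>t\<in>{0..T}. Z \<omega> t = powr_ennreal (star G \<mu> \<omega> t) (1 / 2)"
    show "\<forall>t\<in>{0..T}. stopped (?R n) Z \<omega> t = powr_ennreal (star H \<mu> \<omega> t) (1 / 2)"
    proof
      fix t assume t: "t \<in> {0..T}"
      have "stopped (?R n) Z \<omega> t = powr_ennreal (stopped (?R n) (star G \<mu>) \<omega> t) (1 / 2)"
        using Z stopped_time_in[OF t, of "?R n \<omega>"] t by (auto simp: stopped_def)
      also have "stopped (?R n) (star G \<mu>) \<omega> t = star H \<mu> \<omega> t"
        unfolding H_def using t by (intro star_stopped) auto
      finally show "stopped (?R n) Z \<omega> t = powr_ennreal (star H \<mu> \<omega> t) (1 / 2)" .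
    qed
  qed
  have adapted: "adapted F T (stopped (?R n) Z)"
    unfolding adapted_def
  proof
    fix t assume t: "t \<in> {0..T}"
    have "(\<lambda>\<omega>. powr_ennreal (star H \<mu> \<omega> t) (1 / 2)) \<in> borel_measurable (F t)"
      by (rule measurable_compose[OF optional_star_adapted[OF \<mu> H t] powr_ennreal_half_measurable])
    moreover have "AE \<omega> in M. powr_ennreal (star H \<mu> \<omega> t) (1 / 2) = stopped (?R n) Z \<omega> t"
      using Zs by eventually_elim (use t in auto)
    ultimately show "(\<lambda>\<omega>. stopped (?R n) Z \<omega> t) \<in> borel_measurable (F t)"
      by (rule measurable_F_AE_cong[OF t])
  qed
  have bound: "AE \<omega> in M. stopped (?R n) Z \<omega> T \<le> stopped (S n) B \<omega> T + 1 + stopped (S' n) C \<omega> T"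
    using le
  proof eventually_elim
    fix \<omega> assume le: "\<forall>t\<in>{0..T}. Z \<omega> t \<le> B \<omega> t + 1 + C \<omega> t"
    let ?r = "\<lambda>s. enn2real (min (ennreal T) s)"
    have "?r (?R n \<omega>) \<le> ?r (S n \<omega>)" "?r (?R n \<omega>) \<le> ?r (S' n \<omega>)"
      by (intro enn2real_mono min.mono order_refl min.cobounded1 min.cobounded2
          le_less_trans[OF min.cobounded1 ennreal_less_top])+
    then have "B \<omega> (?r (?R n \<omega>)) \<le> B \<omega> (?r (S n \<omega>))" "C \<omega> (?r (?R n \<omega>)) \<le> C \<omega> (?r (S' n \<omega>))"
      by (auto intro: mono)
    moreover have "Z \<omega> (?r (?R n \<omega>)) \<le> B \<omega> (?r (?R n \<omega>)) + 1 + C \<omega> (?r (?R n \<omega>))"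
      using le stopped_time_in[OF T] by blast
    ultimately show "stopped (?R n) Z \<omega> T \<le> stopped (S n) B \<omega> T + 1 + stopped (S' n) C \<omega> T"
      unfolding stopped_def by (meson add_mono order_refl order_trans)
  qed
  have fin: "(\<integral>\<^sup>+\<omega>. stopped (?R n) Z \<omega> T \<partial>M) < \<infinity>"
  proof -
    have meas: "(\<lambda>\<omega>. stopped (S n) B \<omega> T) \<in> borel_measurable M" "(\<lambda>\<omega>. stopped (S' n) C \<omega> T) \<in> borel_measurable M"
      using S(2)[of n] S'(2)[of n] T measurable_F_imp_M[OF T] unfolding A_plus_def adapted_def by blast+
    have "(\<integral>\<^sup>+\<omega>. stopped (?R n) Z \<omega> T \<partial>M) \<le> (\<integral>\<^sup>+\<omega>. stopped (S n) B \<omega> T + 1 + stopped (S' n) C \<omega> T \<partial>M)"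
      by (rule nn_integral_mono_AE[OF bound])
    also have "\<dots> = (\<integral>\<^sup>+\<omega>. stopped (S n) B \<omega> T \<partial>M) + 1 + (\<integral>\<^sup>+\<omega>. stopped (S' n) C \<omega> T \<partial>M)"
      using meas by (simp add: nn_integral_add emeasure_space_1)
    also have "\<dots> < \<infinity>"
      using S(2)[of n] S'(2)[of n] unfolding A_plus_def by (simp add: ennreal_add_less_top)
    finally show ?thesis .
  qed
  have "(\<lambda>\<omega>. stopped (?R n) Z \<omega> T) \<in> borel_measurable M"
    by (rule measurable_F_imp_M[OF T]) (use adapted T in \<open>simp add: adapted_def\<close>)
  then have "AE \<omega> in M. stopped (?R n) Z \<omega> T \<noteq> \<infinity>"
    using fin by (intro nn_integral_PInf_AE) auto
  then have path: "AE \<omega> in M. stopped (?R n) Z \<omega> 0 = 0 \<and> mono_on {0..T} (stopped (?R n) Z \<omega>) \<and>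
      (\<forall>t\<in>{0..<T}. continuous (at_right t) (stopped (?R n) Z \<omega>))"
    using Zs AE_space
  proof eventually_elim
    fix \<omega> assume ne: "stopped (?R n) Z \<omega> T \<noteq> \<infinity>" and \<omega>: "\<omega> \<in> space M"
      and eq: "\<forall>t\<in>{0..T}. stopped (?R n) Z \<omega> t = powr_ennreal (star H \<mu> \<omega> t) (1 / 2)"
    have finH: "star H \<mu> \<omega> T < \<infinity>"
      using ne eq T powr_ennreal_eq_top_iff[of "star H \<mu> \<omega> T" "1 / 2"] by (auto simp: less_top[symmetric])
    have "stopped (?R n) Z \<omega> 0 = 0" using eq T by (auto simp: powr_ennreal_def)
    moreover have "mono_on {0..T} (stopped (?R n) Z \<omega>)"
      using eq by (auto simp: mono_on_def intro!: powr_ennreal_half_mono star_mono)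
    moreover have "continuous (at_right t) (stopped (?R n) Z \<omega>)" if t: "t \<in> {0..<T}" for t
    proof -
      have c: "continuous (at_right t) (star H \<mu> \<omega>)"
        using star_right_continuous[OF H \<omega> _ _ _ finH] t optional_random_measure_sets[OF \<mu> \<omega>] by auto
      have "star H \<mu> \<omega> t \<le> star H \<mu> \<omega> T" using t by (intro star_mono) auto
      then have "star H \<mu> \<omega> t \<noteq> \<top>" using finH by (auto simp: top_unique)
      then have "((\<lambda>s. powr_ennreal (star H \<mu> \<omega> s) (1 / 2)) \<longlongrightarrow> powr_ennreal (star H \<mu> \<omega> t) (1 / 2)) (at_right t)"
        using continuous_at_right_powr_ennreal_half[OF c] by (simp add: continuous_within)
      moreover have "\<forall>\<^sub>F s in at_right t. powr_ennreal (star H \<mu> \<omega> s) (1 / 2) = stopped (?R n) Z \<omega> s"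
        using t eq by (intro eventually_at_rightI[of t T]) auto
      ultimately have "(stopped (?R n) Z \<omega> \<longlongrightarrow> powr_ennreal (star H \<mu> \<omega> t) (1 / 2)) (at_right t)"
        by (rule Lim_transform_eventually)
      then show ?thesis using eq t by (simp add: continuous_within)
    qed
    ultimately show "stopped (?R n) Z \<omega> 0 = 0 \<and> mono_on {0..T} (stopped (?R n) Z \<omega>) \<and>
      (\<forall>t\<in>{0..<T}. continuous (at_right t) (stopped (?R n) Z \<omega>))" by blast
  qed
  show "A_plus M F T (stopped (?R n) Z)"
    unfolding A_plus_def using adapted path fin by blast
qed

section \<open>Integrals over a single time\<close>

lemma integrand_at_measurable:
  fixes W :: "'a \<Rightarrow> real \<Rightarrow> real \<Rightarrow> 'b::topological_space"
  assumes W: "predictable_integrand W" and \<omega>: "\<omega> \<in> space M" and t: "t \<in> {0..T}"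
  shows "W \<omega> t \<in> borel_measurable borel"
proof -
  have "(\<omega>, t) \<in> space (predictable M F T)" using \<omega> t by simp
  from measurable_compose[OF measurable_Pair1'[OF this] W] show ?thesis by simp
qed

lemma integrand_on_strip_measurable:
  fixes W :: "'a \<Rightarrow> real \<Rightarrow> real \<Rightarrow> real"
  assumes W: "predictable_integrand W" and \<omega>: "\<omega> \<in> space M" and t: "t \<in> {0..T}"
    and N: "sets N = sets borel"
  shows "(\<lambda>x. indicat_real ({t} \<times> UNIV) x *\<^sub>R (case x of (s, e) \<Rightarrow> W \<omega> s e)) \<in> borel_measurable N"
proof -
  have fst: "fst \<in> borel_measurable (borel :: (real \<times> real) measure)"
    and snd: "snd \<in> borel_measurable (borel :: (real \<times> real) measure)"
    by (intro borel_measurable_continuous_onI continuous_intros)+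
  have "(\<lambda>x. indicat_real {t} (fst x) * W \<omega> t (snd x)) \<in> borel_measurable borel"
    by (intro borel_measurable_times measurable_compose[OF fst] measurable_compose[OF snd]
        integrand_at_measurable[OF W \<omega> t]) auto
  also have "(\<lambda>x. indicat_real {t} (fst x) * W \<omega> t (snd x)) =
    (\<lambda>x. indicat_real ({t} \<times> UNIV) x *\<^sub>R (case x of (s, e) \<Rightarrow> W \<omega> s e))"
    by (auto simp: fun_eq_iff split: split_indicator)
  finally show ?thesis using N by (simp cong: measurable_cong_sets)
qed

text \<open>
  All integrands that occur over a single time are almost everywhere constant on one set \<open>B\<close> and \<open>0\<close>
  elsewhere.
\<close>

lemma integral_on_strip_const:
  fixes W :: "'a \<Rightarrow> real \<Rightarrow> real \<Rightarrow> real"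
  assumes W: "predictable_integrand W" and \<omega>: "\<omega> \<in> space M" and t: "t \<in> {0..T}"
    and N: "sets N = sets borel" and B: "B \<in> sets borel" "emeasure N B < \<infinity>"
    and AE: "AE x in N. indicat_real ({t} \<times> UNIV) x *\<^sub>R (case x of (s, e) \<Rightarrow> W \<omega> s e) = indicat_real B x *\<^sub>R c"
  shows "set_integrable N ({t} \<times> UNIV) (\<lambda>(s, e). W \<omega> s e)"
    and "(LINT (s, e):{t} \<times> UNIV|N. W \<omega> s e) = c * measure N B"
proof -
  note meas = integrand_on_strip_measurable[OF W \<omega> t N]
  have int: "integrable N (\<lambda>x. indicat_real B x *\<^sub>R c)"
    using B N by (intro integrable_scaleR_left integrable_real_indicator) auto
  then show "set_integrable N ({t} \<times> UNIV) (\<lambda>(s, e). W \<omega> s e)"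
    unfolding set_integrable_def using integrable_cong_AE[OF meas _ AE] by auto
  have "(LINT (s, e):{t} \<times> UNIV|N. W \<omega> s e) = (LINT x|N. indicat_real B x *\<^sub>R c)"
    unfolding set_lebesgue_integral_def using int by (intro integral_cong_AE[OF meas _ AE]) auto
  also have "\<dots> = (LINT x|N. indicat_real B x) *\<^sub>R c"
    using B N by (intro integral_scaleR_left integrable_real_indicator) auto
  also have "\<dots> = c * measure N B"
    using sets_eq_imp_space_eq[OF N] by simp
  finally show "(LINT (s, e):{t} \<times> UNIV|N. W \<omega> s e) = c * measure N B" .
qed

lemma integral_on_strip_jump_measure:
  fixes W :: "'a \<Rightarrow> real \<Rightarrow> real \<Rightarrow> real"
  assumes W: "predictable_integrand W" and \<omega>: "\<omega> \<in> space M" and t: "t \<in> {0..T}"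
  shows "(LINT (s, e):{t} \<times> UNIV|jump_measure T X \<omega>. W \<omega> s e) =
    (if jump X \<omega> t \<noteq> 0 then W \<omega> t (jump X \<omega> t) else 0)"
proof -
  let ?S = "{s \<in> {0<..T}. jump X \<omega> s \<noteq> 0}"
  let ?f = "\<lambda>s. indicat_real {t} s * W \<omega> t (jump X \<omega> t)"
  have "(LINT (s, e):{t} \<times> UNIV|jump_measure T X \<omega>. W \<omega> s e) =
    (LINT s|count_space ?S. indicat_real ({t} \<times> UNIV) (s, jump X \<omega> s) *\<^sub>R W \<omega> s (jump X \<omega> s))"
    unfolding set_lebesgue_integral_def jump_measure_def
    by (subst integral_distr[OF _ integrand_on_strip_measurable[OF W \<omega> t]]) auto
  also have "\<dots> = (LINT s|count_space ?S. ?f s)"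
    by (intro Bochner_Integration.integral_cong) (auto split: split_indicator)
  also have "\<dots> = (\<Sum>s | s \<in> ?S \<and> ?f s \<noteq> 0. ?f s)"
    by (rule lebesgue_integral_count_space_finite_support)
      (rule finite_subset[of _ "{t}"], auto split: split_indicator_asm)
  also have "\<dots> = (\<Sum>s\<in>{t} \<inter> ?S. ?f s)"
    by (rule sum.mono_neutral_left) (auto split: split_indicator)
  also have "\<dots> = (if jump X \<omega> t \<noteq> 0 then W \<omega> t (jump X \<omega> t) else 0)"
    using t by (auto simp: jump_def)
  finally show ?thesis .
qed

lemma atom_integral_eq_0_iff_AE:
  assumes H: "predictable_integrand H" and \<omega>: "\<omega> \<in> space M" and t: "t \<in> {0..T}"
    and N: "sets (\<mu> \<omega>) = sets borel"
  shows "atom_integral H \<mu> \<omega> t = 0 \<longleftrightarrow> (AE x in \<mu> \<omega>. fst x = t \<longrightarrow> H \<omega> t (snd x) = 0)"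
proof -
  have "(\<lambda>(s, e). H \<omega> s e * indicator {t} s) \<in> borel_measurable (\<mu> \<omega>)"
    by (rule section_times_indicator_measurable[OF H \<omega> _ _ N]) (use t in auto)
  then have "atom_integral H \<mu> \<omega> t = 0 \<longleftrightarrow> (AE x in \<mu> \<omega>. (case x of (s, e) \<Rightarrow> H \<omega> s e * indicator {t} s) = 0)"
    unfolding atom_integral_def by (rule nn_integral_0_iff_AE)
  also have "\<dots> \<longleftrightarrow> (AE x in \<mu> \<omega>. fst x = t \<longrightarrow> H \<omega> t (snd x) = 0)"
    by (intro AE_cong) (auto simp: indicator_eq_0_iff)
  finally show ?thesis .
qed

lemma strip_null_iff_AE:
  assumes N: "sets N = sets (borel :: (real \<times> real) measure)"
  shows "emeasure N ({t} \<times> UNIV) = 0 \<longleftrightarrow> (AE x in N. fst x \<noteq> t)"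
proof -
  have sp: "space N = UNIV" using sets_eq_imp_space_eq[OF N] by simp
  have "{t} \<times> UNIV \<in> sets N" by (simp add: N strip_borel)
  then have "emeasure N ({t} \<times> UNIV) = 0 \<longleftrightarrow> (AE x in N. x \<notin> {t} \<times> UNIV)"
    using Measure_Space.AE_iff_null_sets[of "{t} \<times> UNIV" N] by (simp add: null_sets_def)
  then show ?thesis by (simp add: mem_Times_iff)
qed

lemma atom_integral_pos_iff:
  assumes V: "predictable_integrand V" and \<omega>: "\<omega> \<in> space M" and t: "t \<in> {0..T}"
    and N: "sets (\<mu> \<omega>) = sets borel" and pos: "\<And>e. 0 < V \<omega> t e"
  shows "0 < atom_integral V \<mu> \<omega> t \<longleftrightarrow> 0 < emeasure (\<mu> \<omega>) ({t} \<times> UNIV)"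
proof -
  have "V \<omega> t e \<noteq> 0" for e using pos[of e] by auto
  then have "atom_integral V \<mu> \<omega> t = 0 \<longleftrightarrow> emeasure (\<mu> \<omega>) ({t} \<times> UNIV) = 0"
    unfolding atom_integral_eq_0_iff_AE[OF V \<omega> t, of \<mu>, OF N] strip_null_iff_AE[OF N] by simp
  then show ?thesis by (simp add: zero_less_iff_neq_zero)
qed

lemma jump_add:
  assumes Y: "cadlag M T Y" and Z: "cadlag M T Z" and \<omega>: "\<omega> \<in> space M"
    and eq: "\<And>t. t \<in> {0..T} \<Longrightarrow> X \<omega> t = Y \<omega> t + Z \<omega> t" and t: "t \<in> {0..T}"
  shows "jump X \<omega> t = jump Y \<omega> t + jump Z \<omega> t"
proof (cases "t = 0")
  case True
  then show ?thesis by (simp add: jump_def)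
next
  case False
  then obtain l k where l: "(Y \<omega> \<longlongrightarrow> l) (at_left t)" and k: "(Z \<omega> \<longlongrightarrow> k) (at_left t)"
    using Y Z \<omega> t unfolding cadlag_def by (metis atLeastAtMost_iff greaterThanAtMost_iff order_le_less)
  have "\<forall>\<^sub>F s in at_left t. Y \<omega> s + Z \<omega> s = X \<omega> s"
    using False t eq by (intro eventually_at_leftI[of 0]) auto
  then have x: "(X \<omega> \<longlongrightarrow> l + k) (at_left t)"
    by (rule Lim_transform_eventually[OF tendsto_add[OF l k]])
  have "Lim (at_left t) (X \<omega>) = l + k" "Lim (at_left t) (Y \<omega>) = l" "Lim (at_left t) (Z \<omega>) = k"
    by (rule tendsto_Lim[OF _ x] tendsto_Lim[OF _ l] tendsto_Lim[OF _ k]; simp)+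
  then show ?thesis using False t eq[OF t] by (simp add: jump_def)
qed

text \<open>
  The sum of the squares of nonnegative numbers is at most the square of their sum. So first-order
  integrability of \<open>HA\<close> suffices where it enters quadratically.
\<close>

lemma sum_of_squared_jumps_le:
  assumes HA: "predictable_integrand HA" and HB: "predictable_integrand HB" and \<omega>: "\<omega> \<in> space M"
    and t: "t \<in> {0..T}"
    and 0: "\<And>s. s \<in> {0..t} \<Longrightarrow> s = 0 \<or> jump X \<omega> s = 0 \<Longrightarrow> f s = 0"
    and le: "\<And>s. s \<in> {0<..t} \<Longrightarrow> f s \<le> HA \<omega> s (jump X \<omega> s) * HA \<omega> s (jump X \<omega> s) + HB \<omega> s (jump X \<omega> s)"
  shows "(\<integral>\<^sup>+s. f s \<partial>count_space {0..t}) \<le>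
    star HA (jump_measure T X) \<omega> t * star HA (jump_measure T X) \<omega> t + star HB (jump_measure T X) \<omega> t"
proof -
  let ?S = "{s \<in> {0<..T}. jump X \<omega> s \<noteq> 0}"
  define a where "a s = HA \<omega> s (jump X \<omega> s) * indicator {0<..t} s" for s
  define b where "b s = HB \<omega> s (jump X \<omega> s) * indicator {0<..t} s" for s
  have tT: "t \<le> T" using t by simp
  have A: "star HA (jump_measure T X) \<omega> t = (\<integral>\<^sup>+s. a s \<partial>count_space ?S)"
    unfolding a_def by (rule star_jump_measure[OF HA \<omega> tT])
  have B: "star HB (jump_measure T X) \<omega> t = (\<integral>\<^sup>+s. b s \<partial>count_space ?S)"
    unfolding b_def by (rule star_jump_measure[OF HB \<omega> tT])
  have "(\<integral>\<^sup>+s. f s \<partial>count_space {0..t}) = (\<integral>\<^sup>+s. f s \<partial>count_space (?S \<inter> {0<..t}))"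
    using t by (intro nn_integral_count_space_eq) (force intro: 0)+
  also have "\<dots> = (\<integral>\<^sup>+s. f s * indicator {0<..t} s \<partial>count_space ?S)"
    by (auto simp: nn_integral_count_space_indicator intro!: nn_integral_cong split: split_indicator)
  also have "\<dots> \<le> (\<integral>\<^sup>+s. a s * (\<integral>\<^sup>+s. a s \<partial>count_space ?S) + b s \<partial>count_space ?S)"
  proof (intro nn_integral_mono)
    fix s assume s: "s \<in> space (count_space ?S)"
    have "a s \<le> (\<integral>\<^sup>+s. a s \<partial>count_space ?S)"
      using s by (intro nn_integral_ge_point) auto
    moreover have "f s * indicator {0<..t} s \<le> a s * a s + b s"
      using le[of s] by (auto simp: a_def b_def split: split_indicator)
    ultimately show "f s * indicator {0<..t} s \<le> a s * (\<integral>\<^sup>+s. a s \<partial>count_space ?S) + b s"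
      by (elim order_trans) (intro add_right_mono mult_left_mono, simp_all)
  qed
  also have "\<dots> = (\<integral>\<^sup>+s. a s \<partial>count_space ?S) * (\<integral>\<^sup>+s. a s \<partial>count_space ?S) + (\<integral>\<^sup>+s. b s \<partial>count_space ?S)"
    by (simp add: nn_integral_add nn_integral_multc)
  finally show ?thesis unfolding A B .
qed

end

section \<open>The compensator of the jump measure at a fixed time\<close>

text \<open>
  In the application \<open>J\<close> is a predictable version of the set of times charged by \<open>\<nu>\<close>. Having mass
  exactly \<open>1\<close> at each time in \<open>J\<close>, the predictable random measure \<open>\<nu>\<close> exhibits sums over \<open>J\<close> of
  predictable processes as measurable functions of \<open>\<omega>\<close>.
\<close>

locale jump_decomposition = filtered_prob_space M F T
  for M :: "'a measure" and F T +
  fixes X Xi Xp :: "'a \<Rightarrow> real \<Rightarrow> real" and \<nu> \<nu>X :: "'a \<Rightarrow> (real \<times> real) measure" and J :: "('a \<times> real) set"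
  assumes comp: "compensator M F T (jump_measure T X) \<nu>X"
    and qlc: "quasi_left_continuous M F T Xi"
    and jump_Xp: "(\<lambda>(\<omega>, t). jump Xp \<omega> t) \<in> borel_measurable (predictable M F T)"
    and J: "J \<in> sets (predictable M F T)"
    and on_J: "AE \<omega> in M. \<forall>t\<in>{0..T}. (\<omega>, t) \<in> J \<longrightarrow> jump X \<omega> t = jump Xp \<omega> t"
    and off_J: "AE \<omega> in M. \<forall>t\<in>{0..T}. (\<omega>, t) \<notin> J \<longrightarrow> jump X \<omega> t = jump Xi \<omega> t"
    and \<nu>: "predictable_random_measure M F T \<nu>"
    and J_thin: "AE \<omega> in M. countable {t \<in> {0..T}. (\<omega>, t) \<in> J} \<and> (\<omega>, 0) \<notin> J \<and>
      (\<forall>t\<in>{0..T}. (\<omega>, t) \<in> J \<longrightarrow> emeasure (\<nu> \<omega>) ({t} \<times> UNIV) = 1)"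
begin

lemma \<nu>X: "predictable_random_measure M F T \<nu>X"
  using comp by (simp add: compensator_def)

lemma star_\<nu>X_integral:
  "predictable_integrand U \<Longrightarrow> (\<integral>\<^sup>+\<omega>. star U \<nu>X \<omega> T \<partial>M) = (\<integral>\<^sup>+\<omega>. star U (jump_measure T X) \<omega> T \<partial>M)"
  using comp unfolding compensator_def by blast

lemma star_jump_measure_eq_0:
  assumes W: "predictable_integrand W" and \<omega>: "\<omega> \<in> space M"
    and 0: "\<And>s. s \<in> {0<..T} \<Longrightarrow> jump X \<omega> s \<noteq> 0 \<Longrightarrow> W \<omega> s (jump X \<omega> s) = 0"
  shows "star W (jump_measure T X) \<omega> T = 0"
proof -
  have "star W (jump_measure T X) \<omega> T =
    (\<integral>\<^sup>+s. 0 \<partial>count_space {s \<in> {0<..T}. jump X \<omega> s \<noteq> 0})"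
    unfolding star_jump_measure[OF W \<omega> order_refl] by (intro nn_integral_cong) (auto simp: 0)
  then show ?thesis by simp
qed

text \<open>
  At an atom of \<open>U \<cdot> \<nu>\<^sup>X\<close> the process \<open>X\<^sup>i\<close> does not jump; off \<open>J\<close> then neither does \<open>X\<close>. So the
  predictable set of atoms off \<open>J\<close> is null for \<open>\<mu>\<^sup>X\<close>, hence for \<open>\<nu>\<^sup>X\<close>.
\<close>

lemma no_atoms_off_J:
  assumes U: "predictable_integrand U" and fin: "(\<integral>\<^sup>+\<omega>. star U (jump_measure T X) \<omega> T \<partial>M) < \<infinity>"
  shows "AE \<omega> in M. \<forall>t\<in>{0..T}. (\<omega>, t) \<notin> J \<longrightarrow> atom_integral U \<nu>X \<omega> t = 0"
proof -
  have finX: "(\<integral>\<^sup>+\<omega>. star U \<nu>X \<omega> T \<partial>M) < \<infinity>" using fin star_\<nu>X_integral[OF U] by simp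
  obtain p where p: "(\<lambda>(\<omega>, t). p \<omega> t) \<in> borel_measurable (predictable M F T)"
    and p_eq: "\<And>\<omega> t. \<omega> \<in> space M \<Longrightarrow> star U \<nu>X \<omega> T < \<infinity> \<Longrightarrow> t \<in> {0..T} \<Longrightarrow> p \<omega> t = atom_integral U \<nu>X \<omega> t"
    using atom_integral_predictable_version[OF \<nu>X U] by metis
  define W where "W \<omega> t e = U \<omega> t e * (if 0 < p \<omega> t then 1 else 0) * (1 - indicator J (\<omega>, t))" for \<omega> t e
  have W: "predictable_integrand W"
    using U predictable_process_integrand[OF p] predictable_set_integrand[OF J, where 'b = ennreal]
    unfolding W_def split_beta' by measurable
  have "AE \<omega> in M. star W (jump_measure T X) \<omega> T = 0"
    using quasi_left_continuous_no_jump_at_atoms[OF \<nu>X U finX qlc] off_J AE_star_finite[OF \<nu>X U finX] AE_space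
  proof eventually_elim
    fix \<omega> assume 1: "\<forall>t\<in>{0..T}. 0 < atom_integral U \<nu>X \<omega> t \<longrightarrow> jump Xi \<omega> t = 0"
      and 2: "\<forall>t\<in>{0..T}. (\<omega>, t) \<notin> J \<longrightarrow> jump X \<omega> t = jump Xi \<omega> t"
      and 3: "star U \<nu>X \<omega> T < \<infinity>" and \<omega>: "\<omega> \<in> space M"
    show "star W (jump_measure T X) \<omega> T = 0"
      by (rule star_jump_measure_eq_0[OF W \<omega>])
        (use 1 2 p_eq[OF \<omega> 3] in \<open>auto simp: W_def split: split_indicator\<close>)
  qed
  from compensator_null_atoms[OF comp W this] AE_star_finite[OF \<nu>X U finX] AE_space
  show ?thesis
  proof eventually_elim
    fix \<omega> assume 1: "\<forall>t\<in>{0..T}. atom_integral W \<nu>X \<omega> t = 0"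
      and fin: "star U \<nu>X \<omega> T < \<infinity>" and \<omega>: "\<omega> \<in> space M"
    show "\<forall>t\<in>{0..T}. (\<omega>, t) \<notin> J \<longrightarrow> atom_integral U \<nu>X \<omega> t = 0"
    proof (intro ballI impI, rule ccontr)
      fix t assume t: "t \<in> {0..T}" "(\<omega>, t) \<notin> J" and ne: "atom_integral U \<nu>X \<omega> t \<noteq> 0"
      then have "0 < p \<omega> t" using p_eq[OF \<omega> fin t(1)] by (simp add: zero_less_iff_neq_zero)
      then have "atom_integral U \<nu>X \<omega> t = atom_integral W \<nu>X \<omega> t"
        using t by (intro atom_integral_cong) (auto simp: W_def)
      then show False using 1 t ne by auto
    qed
  qed
qed

text \<open>
  The set of \<open>(t, e)\<close> with \<open>t \<in> J\<close> and \<open>e \<noteq> \<Delta>X\<^sup>p\<^sub>t\<close> is predictable and null for \<open>\<mu>\<^sup>X\<close>.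
\<close>

lemma atoms_on_J_carried_by_jump_Xp:
  assumes U: "predictable_integrand U"
  shows "AE \<omega> in M. \<forall>t\<in>{0..T}. (\<omega>, t) \<in> J \<longrightarrow>
    atom_integral (\<lambda>\<omega> t e. U \<omega> t e * (if e = jump Xp \<omega> t then 0 else 1)) \<nu>X \<omega> t = 0"
proof -
  define W where "W \<omega> t e = U \<omega> t e * (if e = jump Xp \<omega> t then 0 else 1) * indicator J (\<omega>, t)" for \<omega> t e
  have W: "predictable_integrand W"
    using U predictable_process_integrand[OF jump_Xp] predictable_set_integrand[OF J, where 'b = ennreal]
    unfolding W_def split_beta' by measurable
  have "AE \<omega> in M. star W (jump_measure T X) \<omega> T = 0"
    using on_J AE_space
  proof eventually_elim
    fix \<omega> assume 1: "\<forall>t\<in>{0..T}. (\<omega>, t) \<in> J \<longrightarrow> jump X \<omega> t = jump Xp \<omega> t" and \<omega>: "\<omega> \<in> space M"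
    show "star W (jump_measure T X) \<omega> T = 0"
      by (rule star_jump_measure_eq_0[OF W \<omega>]) (use 1 in \<open>auto simp: W_def split: split_indicator\<close>)
  qed
  from compensator_null_atoms[OF comp W this]
  show ?thesis
  proof eventually_elim
    fix \<omega> assume 1: "\<forall>t\<in>{0..T}. atom_integral W \<nu>X \<omega> t = 0"
    show "\<forall>t\<in>{0..T}. (\<omega>, t) \<in> J \<longrightarrow>
      atom_integral (\<lambda>\<omega> t e. U \<omega> t e * (if e = jump Xp \<omega> t then 0 else 1)) \<nu>X \<omega> t = 0"
    proof (intro ballI impI)
      fix t assume t: "t \<in> {0..T}" "(\<omega>, t) \<in> J"
      have "atom_integral (\<lambda>\<omega> t e. U \<omega> t e * (if e = jump Xp \<omega> t then 0 else 1)) \<nu>X \<omega> t =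
        atom_integral W \<nu>X \<omega> t"
        using t by (intro atom_integral_cong) (auto simp: W_def)
      then show "atom_integral (\<lambda>\<omega> t e. U \<omega> t e * (if e = jump Xp \<omega> t then 0 else 1)) \<nu>X \<omega> t = 0"
        using 1 t by auto
    qed
  qed
qed

text \<open>
  Put \<open>c\<^sub>t = U (t, \<Delta>X\<^sup>p\<^sub>t)\<close> and let \<open>m\<^sub>t \<le> 1\<close> be the mass of \<open>\<nu>\<^sup>X\<close> at \<open>(t, \<Delta>X\<^sup>p\<^sub>t)\<close>. Integrating \<open>U\<close> over the
  graph of \<open>\<Delta>X\<^sup>p\<close> above \<open>J\<close> gives \<open>\<Sum> c\<^sub>t m\<^sub>t\<close> for \<open>\<nu>\<^sup>X\<close> and \<open>\<Sum> c\<^sub>t\<close> for \<open>\<mu>\<^sup>X\<close>, with the same finite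
  expectation. The first sum being at most the second, the two agree almost surely, and then term by
  term.
\<close>

lemma atoms_on_J_have_full_mass:
  assumes U: "predictable_integrand U" and fin: "(\<integral>\<^sup>+\<omega>. star U (jump_measure T X) \<omega> T \<partial>M) < \<infinity>"
    and U0: "AE \<omega> in M. \<forall>t\<in>{0..T}. U \<omega> t 0 = 0"
  shows "AE \<omega> in M. \<forall>t\<in>{0..T}. (\<omega>, t) \<in> J \<longrightarrow> 0 < U \<omega> t (jump Xp \<omega> t) \<longrightarrow>
    emeasure (\<nu>X \<omega>) {(t, jump Xp \<omega> t)} = 1"
proof -
  define W where "W \<omega> t e = U \<omega> t e * (if e = jump Xp \<omega> t then 1 else 0) * indicator J (\<omega>, t)" for \<omega> t e
  define c where "c \<omega> t = U \<omega> t (jump Xp \<omega> t) * indicator J (\<omega>, t)" for \<omega> t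
  \<comment> \<open>The process \<open>c\<close> as an integrand: its integral with respect to \<open>\<nu>\<close> is the sum of \<open>c\<close> over \<open>J\<close>.\<close>
  define c' where "c' \<omega> t e = c \<omega> t" for \<omega> t and e :: real
  define m where "m \<omega> t = emeasure (\<nu>X \<omega>) {(t, jump Xp \<omega> t)}" for \<omega> t
  define J' where "J' \<omega> = {t \<in> {0..T}. (\<omega>, t) \<in> J}" for \<omega>
  have W: "predictable_integrand W"
    using U predictable_process_integrand[OF jump_Xp] predictable_set_integrand[OF J, where 'b = ennreal]
    unfolding W_def split_beta' by measurable
  have c': "predictable_integrand c'"
  proof -
    have "(\<lambda>x. (fst x, jump Xp (fst (fst x)) (snd (fst x)))) \<in>
      measurable (predictable_tilde M F T) (predictable_tilde M F T)"
      using predictable_process_integrand[OF jump_Xp] by (intro measurable_Pair) simp_all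
    from measurable_compose[OF this U]
    have "(\<lambda>x. U (fst (fst x)) (snd (fst x)) (jump Xp (fst (fst x)) (snd (fst x)))) \<in> borel_measurable (predictable_tilde M F T)"
      by (simp add: split_beta')
    then show ?thesis
      using predictable_set_integrand[OF J, where 'b = ennreal]
      unfolding c'_def c_def split_beta' by (rule borel_measurable_times_ennreal)
  qed
  let ?sums = "\<lambda>\<omega>. star W \<nu>X \<omega> T = (\<integral>\<^sup>+t. c \<omega> t * m \<omega> t \<partial>count_space (J' \<omega>)) \<and>
      star c' \<nu> \<omega> T = (\<integral>\<^sup>+t. c \<omega> t \<partial>count_space (J' \<omega>)) \<and>
      star W (jump_measure T X) \<omega> T = (\<integral>\<^sup>+t. c \<omega> t \<partial>count_space (J' \<omega>))"
  have pathwise: "AE \<omega> in M. ?sums \<omega>"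
    using J_thin on_J U0 AE_space
  proof eventually_elim
    fix \<omega> assume thin: "countable {t \<in> {0..T}. (\<omega>, t) \<in> J} \<and> (\<omega>, 0) \<notin> J \<and>
        (\<forall>t\<in>{0..T}. (\<omega>, t) \<in> J \<longrightarrow> emeasure (\<nu> \<omega>) ({t} \<times> UNIV) = 1)"
      and on: "\<forall>t\<in>{0..T}. (\<omega>, t) \<in> J \<longrightarrow> jump X \<omega> t = jump Xp \<omega> t"
      and U0: "\<forall>t\<in>{0..T}. U \<omega> t 0 = 0" and \<omega>: "\<omega> \<in> space M"
    have J'_pos: "t \<in> J' \<omega> \<Longrightarrow> 0 < t" and J'_le: "t \<in> J' \<omega> \<Longrightarrow> t \<le> T" for t
      using thin by (auto simp: J'_def less_le)
    have sX: "sets (\<nu>X \<omega>) = sets borel" and s: "sets (\<nu> \<omega>) = sets borel"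
      using predictable_random_measure_sets[OF \<nu>X \<omega>] predictable_random_measure_sets[OF \<nu> \<omega>] by auto
    have J': "countable (J' \<omega>)" "J' \<omega> \<subseteq> {0..T}" using thin by (auto simp: J'_def)
    have star_J': "star H \<rho> \<omega> T = (\<integral>\<^sup>+s. atom_integral H \<rho> \<omega> s \<partial>count_space (J' \<omega>))"
      if H: "predictable_integrand H" and 0: "\<And>t e. t \<in> {0..T} - J' \<omega> \<Longrightarrow> H \<omega> t e = 0"
        and \<rho>: "sets (\<rho> \<omega>) = sets borel" for H \<rho>
    proof -
      have "star H \<rho> \<omega> T = (\<integral>\<^sup>+(s, e). H \<omega> s e * indicator (J' \<omega>) s \<partial>\<rho> \<omega>)"
        unfolding star_def using 0 J'_pos J'_le
        by (intro nn_integral_cong) (auto split: split_indicator)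
      then show ?thesis using integral_over_countable_times[of H \<omega> \<rho>, OF H \<omega> \<rho> J'] by simp
    qed
    have "star W \<nu>X \<omega> T = (\<integral>\<^sup>+s. atom_integral W \<nu>X \<omega> s \<partial>count_space (J' \<omega>))"
      by (rule star_J'[OF W]) (auto simp: W_def J'_def sX)
    also have "\<dots> = (\<integral>\<^sup>+t. c \<omega> t * m \<omega> t \<partial>count_space (J' \<omega>))"
    proof (intro nn_integral_cong)
      fix t :: real
      have "atom_integral W \<nu>X \<omega> t = (\<integral>\<^sup>+x. c \<omega> t * indicator {(t, jump Xp \<omega> t)} x \<partial>\<nu>X \<omega>)"
        unfolding atom_integral_def by (intro nn_integral_cong) (auto simp: W_def c_def indicator_eq_0_iff split: split_indicator if_splits)
      also have "\<dots> = c \<omega> t * m \<omega> t"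
        unfolding m_def by (rule nn_integral_cmult_indicator) (simp add: sX)
      finally show "atom_integral W \<nu>X \<omega> t = c \<omega> t * m \<omega> t" .
    qed
    finally have 1: "star W \<nu>X \<omega> T = (\<integral>\<^sup>+t. c \<omega> t * m \<omega> t \<partial>count_space (J' \<omega>))" .
    have "star c' \<nu> \<omega> T = (\<integral>\<^sup>+s. atom_integral c' \<nu> \<omega> s \<partial>count_space (J' \<omega>))"
      by (rule star_J'[OF c']) (auto simp: c'_def c_def J'_def s)
    also have "\<dots> = (\<integral>\<^sup>+t. c \<omega> t \<partial>count_space (J' \<omega>))"
    proof (intro nn_integral_cong)
      fix t assume t: "t \<in> space (count_space (J' \<omega>))"
      have "atom_integral c' \<nu> \<omega> t = (\<integral>\<^sup>+x. c \<omega> t * indicator ({t} \<times> UNIV) x \<partial>\<nu> \<omega>)"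
        unfolding atom_integral_def by (intro nn_integral_cong) (auto simp: c'_def indicator_eq_0_iff split: split_indicator)
      also have "\<dots> = c \<omega> t * emeasure (\<nu> \<omega>) ({t} \<times> UNIV)"
        by (rule nn_integral_cmult_indicator) (simp add: s strip_borel)
      also have "\<dots> = c \<omega> t" using thin t by (auto simp: J'_def)
      finally show "atom_integral c' \<nu> \<omega> t = c \<omega> t" .
    qed
    finally have 2: "star c' \<nu> \<omega> T = (\<integral>\<^sup>+t. c \<omega> t \<partial>count_space (J' \<omega>))" .
    let ?S = "{s \<in> {0<..T}. jump X \<omega> s \<noteq> 0}"
    have "star W (jump_measure T X) \<omega> T = (\<integral>\<^sup>+s. c \<omega> s \<partial>count_space ?S)"
      unfolding star_jump_measure[OF W \<omega> order_refl]
      using on by (intro nn_integral_cong) (auto simp: W_def c_def split: split_indicator)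
    also have "\<dots> = (\<integral>\<^sup>+s. c \<omega> s \<partial>count_space (J' \<omega>))"
    proof (rule nn_integral_count_space_eq)
      fix s assume "s \<in> ?S - J' \<omega>"
      then show "c \<omega> s = 0" by (auto simp: c_def J'_def)
    next
      fix s assume "s \<in> J' \<omega> - ?S"
      then have "jump X \<omega> s = 0" "s \<in> {0..T}" "(\<omega>, s) \<in> J" using J'_pos by (auto simp: J'_def)
      then show "c \<omega> s = 0" using on U0 by (auto simp: c_def)
    qed
    finally have 3: "star W (jump_measure T X) \<omega> T = (\<integral>\<^sup>+t. c \<omega> t \<partial>count_space (J' \<omega>))" .
    show "?sums \<omega>"
      using 1 2 3 by simp
  qed
  have m_le: "m \<omega> t \<le> 1" if \<omega>: "\<omega> \<in> space M" and t: "t \<in> {0..T}" for \<omega> t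
  proof -
    have "m \<omega> t \<le> emeasure (\<nu>X \<omega>) ({t} \<times> UNIV)"
      unfolding m_def using predictable_random_measure_sets[OF \<nu>X \<omega>]
      by (intro emeasure_mono) (auto simp: strip_borel)
    also have "\<dots> \<le> 1" using comp \<omega> t unfolding compensator_def by blast
    finally show ?thesis .
  qed
  have intW: "(\<integral>\<^sup>+\<omega>. star W \<nu>X \<omega> T \<partial>M) = (\<integral>\<^sup>+\<omega>. star W (jump_measure T X) \<omega> T \<partial>M)"
    by (rule star_\<nu>X_integral[OF W])
  also have "\<dots> = (\<integral>\<^sup>+\<omega>. star c' \<nu> \<omega> T \<partial>M)"
  proof (rule nn_integral_cong_AE)
    show "AE \<omega> in M. star W (jump_measure T X) \<omega> T = star c' \<nu> \<omega> T"
      using pathwise by eventually_elim simp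
  qed
  finally have int_eq: "(\<integral>\<^sup>+\<omega>. star W \<nu>X \<omega> T \<partial>M) = (\<integral>\<^sup>+\<omega>. star c' \<nu> \<omega> T \<partial>M)" .
  have "(\<integral>\<^sup>+\<omega>. star W (jump_measure T X) \<omega> T \<partial>M) \<le> (\<integral>\<^sup>+\<omega>. star U (jump_measure T X) \<omega> T \<partial>M)"
    by (intro nn_integral_mono star_le_star) (auto simp: W_def split: split_indicator)
  then have int_fin: "(\<integral>\<^sup>+\<omega>. star W \<nu>X \<omega> T \<partial>M) < \<infinity>" using fin unfolding intW by (rule le_less_trans)
  have "AE \<omega> in M. star W \<nu>X \<omega> T \<le> star c' \<nu> \<omega> T"
    using pathwise AE_space
  proof eventually_elim
    fix \<omega> assume eq: "?sums \<omega>" and \<omega>: "\<omega> \<in> space M"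
    have "c \<omega> t * m \<omega> t \<le> c \<omega> t" if "t \<in> J' \<omega>" for t
      using mult_left_mono[OF m_le[OF \<omega>, of t], of "c \<omega> t"] that by (auto simp: J'_def)
    then show "star W \<nu>X \<omega> T \<le> star c' \<nu> \<omega> T"
      using eq by (auto intro!: nn_integral_mono)
  qed
  then have "AE \<omega> in M. star W \<nu>X \<omega> T = star c' \<nu> \<omega> T"
    using int_eq int_fin star_borel_measurable_T[OF \<nu>X W] star_borel_measurable_T[OF \<nu> c']
    by (intro nn_integral_eq_imp_AE_eq) auto
  then show ?thesis
    using pathwise AE_star_finite[OF \<nu>X W int_fin] AE_space
  proof eventually_elim
    fix \<omega> assume eq: "?sums \<omega>" and \<omega>: "\<omega> \<in> space M"
      and same: "star W \<nu>X \<omega> T = star c' \<nu> \<omega> T" and fin: "star W \<nu>X \<omega> T < \<infinity>"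
    have le: "c \<omega> t * m \<omega> t \<le> c \<omega> t" if "t \<in> J' \<omega>" for t
      using mult_left_mono[OF m_le[OF \<omega>, of t], of "c \<omega> t"] that by (auto simp: J'_def)
    have "AE t in count_space (J' \<omega>). c \<omega> t * m \<omega> t = c \<omega> t"
      using eq same fin le by (intro nn_integral_eq_imp_AE_eq) (auto simp: AE_count_space)
    moreover have "AE t in count_space (J' \<omega>). c \<omega> t \<noteq> \<infinity>"
      using eq same fin by (intro nn_integral_PInf_AE) auto
    ultimately have c: "c \<omega> t * m \<omega> t = c \<omega> t" "c \<omega> t \<noteq> \<top>" if "t \<in> J' \<omega>" for t
      using that by (auto simp: AE_count_space)
    show "\<forall>t\<in>{0..T}. (\<omega>, t) \<in> J \<longrightarrow> 0 < U \<omega> t (jump Xp \<omega> t) \<longrightarrow>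
      emeasure (\<nu>X \<omega>) {(t, jump Xp \<omega> t)} = 1"
    proof (intro ballI impI)
      fix t assume t: "t \<in> {0..T}" "(\<omega>, t) \<in> J" and pos: "0 < U \<omega> t (jump Xp \<omega> t)"
      then have "0 < c \<omega> t" by (simp add: c_def)
      moreover have "c \<omega> t * m \<omega> t = c \<omega> t * 1" "c \<omega> t \<noteq> \<top>"
        using c[of t] t by (auto simp: J'_def)
      ultimately have "m \<omega> t = 1"
        by (metis ennreal_mult_cancel_left infinity_ennreal_def less_irrefl)
      then show "emeasure (\<nu>X \<omega>) {(t, jump Xp \<omega> t)} = 1" by (simp add: m_def)
    qed
  qed
qed

text \<open>
  The weights \<open>U i\<close> detect every point at which \<open>\<phi>\<close> does not vanish, so statements on the atoms of
  \<open>U i \<cdot> \<nu>\<^sup>X\<close> for all \<open>i\<close> determine the integral of \<open>\<phi>\<close> over a single time. Off \<open>J\<close> this integral is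
  \<open>0\<close>; on \<open>J\<close> it is \<open>\<phi> (t, \<Delta>X\<^sup>p\<^sub>t)\<close>, which cancels the contribution of \<open>\<mu>\<^sup>X\<close>.
\<close>

lemma tilde_jump_measure:
  fixes \<phi> :: "'a \<Rightarrow> real \<Rightarrow> real \<Rightarrow> real" and U :: "'i::countable \<Rightarrow> 'a \<Rightarrow> real \<Rightarrow> real \<Rightarrow> ennreal"
  assumes \<phi>: "predictable_integrand \<phi>" and \<phi>0: "AE \<omega> in M. \<forall>t\<in>{0..T}. \<phi> \<omega> t 0 = 0"
    and U: "\<And>i. predictable_integrand (U i)"
    and U_fin: "\<And>i. (\<integral>\<^sup>+\<omega>. star (U i) (jump_measure T X) \<omega> T \<partial>M) < \<infinity>"
    and U0: "\<And>i. AE \<omega> in M. \<forall>t\<in>{0..T}. U i \<omega> t 0 = 0"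
    and U_ex: "AE \<omega> in M. \<forall>t\<in>{0..T}. \<forall>e. \<phi> \<omega> t e \<noteq> 0 \<longrightarrow> (\<exists>i. U i \<omega> t e \<noteq> 0)"
  shows "AE \<omega> in M. \<forall>t\<in>{0..T}. tilde (jump_measure T X) \<nu>X \<phi> \<omega> t =
    ereal (if (\<omega>, t) \<in> J then 0 else \<phi> \<omega> t (jump X \<omega> t))"
proof -
  have off: "AE \<omega> in M. \<forall>i. \<forall>t\<in>{0..T}. (\<omega>, t) \<notin> J \<longrightarrow> atom_integral (U i) \<nu>X \<omega> t = 0"
    using no_atoms_off_J[OF U U_fin] by (subst AE_all_countable) blast
  have on1: "AE \<omega> in M. \<forall>i. \<forall>t\<in>{0..T}. (\<omega>, t) \<in> J \<longrightarrow>
      atom_integral (\<lambda>\<omega> t e. U i \<omega> t e * (if e = jump Xp \<omega> t then 0 else 1)) \<nu>X \<omega> t = 0"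
    using atoms_on_J_carried_by_jump_Xp[OF U] by (subst AE_all_countable) blast
  have on2: "AE \<omega> in M. \<forall>i. \<forall>t\<in>{0..T}. (\<omega>, t) \<in> J \<longrightarrow> 0 < U i \<omega> t (jump Xp \<omega> t) \<longrightarrow>
      emeasure (\<nu>X \<omega>) {(t, jump Xp \<omega> t)} = 1"
    using atoms_on_J_have_full_mass[OF U U_fin U0] by (subst AE_all_countable) blast
  have Uoff: "predictable_integrand (\<lambda>\<omega> t e. U i \<omega> t e * (if e = jump Xp \<omega> t then 0 else 1))" for i
    using U[of i] predictable_process_integrand[OF jump_Xp] unfolding split_beta' by measurable

  show ?thesis
    using off on1 on2 U_ex \<phi>0 on_J AE_space
  proof eventually_elim
    fix \<omega> assume off: "\<forall>i. \<forall>t\<in>{0..T}. (\<omega>, t) \<notin> J \<longrightarrow> atom_integral (U i) \<nu>X \<omega> t = 0"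
      and on1: "\<forall>i. \<forall>t\<in>{0..T}. (\<omega>, t) \<in> J \<longrightarrow>
        atom_integral (\<lambda>\<omega> t e. U i \<omega> t e * (if e = jump Xp \<omega> t then 0 else 1)) \<nu>X \<omega> t = 0"
      and on2: "\<forall>i. \<forall>t\<in>{0..T}. (\<omega>, t) \<in> J \<longrightarrow> 0 < U i \<omega> t (jump Xp \<omega> t) \<longrightarrow>
        emeasure (\<nu>X \<omega>) {(t, jump Xp \<omega> t)} = 1"
      and U_ex: "\<forall>t\<in>{0..T}. \<forall>e. \<phi> \<omega> t e \<noteq> 0 \<longrightarrow> (\<exists>i. U i \<omega> t e \<noteq> 0)"
      and \<phi>0: "\<forall>t\<in>{0..T}. \<phi> \<omega> t 0 = 0"
      and on_J: "\<forall>t\<in>{0..T}. (\<omega>, t) \<in> J \<longrightarrow> jump X \<omega> t = jump Xp \<omega> t" and \<omega>: "\<omega> \<in> space M"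
    note sX = predictable_random_measure_sets[OF \<nu>X \<omega>]
    show "\<forall>t\<in>{0..T}. tilde (jump_measure T X) \<nu>X \<phi> \<omega> t = ereal (if (\<omega>, t) \<in> J then 0 else \<phi> \<omega> t (jump X \<omega> t))"
    proof
      fix t assume t: "t \<in> {0..T}"
      have int_\<mu>X: "(LINT (s, e):{t} \<times> UNIV|jump_measure T X \<omega>. \<phi> \<omega> s e) = \<phi> \<omega> t (jump X \<omega> t)"
        using integral_on_strip_jump_measure[OF \<phi> \<omega> t, of X] \<phi>0 t by auto
      show "tilde (jump_measure T X) \<nu>X \<phi> \<omega> t = ereal (if (\<omega>, t) \<in> J then 0 else \<phi> \<omega> t (jump X \<omega> t))"
      proof (cases "(\<omega>, t) \<in> J")
        case False
        have "AE x in \<nu>X \<omega>. fst x = t \<longrightarrow> U i \<omega> t (snd x) = 0" for i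
          using off False t atom_integral_eq_0_iff_AE[OF U[of i] \<omega> t, of \<nu>X, OF sX] by blast
        then have "AE x in \<nu>X \<omega>. \<forall>i. fst x = t \<longrightarrow> U i \<omega> t (snd x) = 0"
          by (subst AE_all_countable) blast
        then have "AE x in \<nu>X \<omega>. indicat_real ({t} \<times> UNIV) x *\<^sub>R (case x of (s, e) \<Rightarrow> \<phi> \<omega> s e) =
          indicat_real {} x *\<^sub>R 0"
        proof eventually_elim
          fix x assume x: "\<forall>i. fst x = t \<longrightarrow> U i \<omega> t (snd x) = 0"
          have "\<phi> \<omega> t (snd x) = 0" if "fst x = t" using x that U_ex t by metis
          then show "indicat_real ({t} \<times> UNIV) x *\<^sub>R (case x of (s, e) \<Rightarrow> \<phi> \<omega> s e) = indicat_real {} x *\<^sub>R 0"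
            by (cases x) (auto split: split_indicator)
        qed
        note const = integral_on_strip_const[OF \<phi> \<omega> t sX _ _ this]
        show ?thesis
          using const False int_\<mu>X by (simp add: tilde_def hat_def)
      next
        case True
        let ?y = "jump Xp \<omega> t"
        have "AE x in \<nu>X \<omega>. fst x = t \<longrightarrow> U i \<omega> t (snd x) * (if snd x = ?y then 0 else 1) = 0" for i
          using on1 True t atom_integral_eq_0_iff_AE[OF Uoff[of i] \<omega> t, of \<nu>X, OF sX] by blast
        then have "AE x in \<nu>X \<omega>. \<forall>i. fst x = t \<longrightarrow> U i \<omega> t (snd x) * (if snd x = ?y then 0 else 1) = 0"
          by (subst AE_all_countable) blast
        then have AE: "AE x in \<nu>X \<omega>. indicat_real ({t} \<times> UNIV) x *\<^sub>R (case x of (s, e) \<Rightarrow> \<phi> \<omega> s e) =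
          indicat_real {(t, ?y)} x *\<^sub>R \<phi> \<omega> t ?y"
        proof eventually_elim
          fix x assume x: "\<forall>i. fst x = t \<longrightarrow> U i \<omega> t (snd x) * (if snd x = ?y then 0 else 1) = 0"
          have "\<phi> \<omega> t (snd x) = 0" if "fst x = t" "snd x \<noteq> ?y"
          proof -
            have "U i \<omega> t (snd x) = 0" for i using spec[OF x, of i] that by simp
            then show ?thesis using U_ex t by metis
          qed
          then show "indicat_real ({t} \<times> UNIV) x *\<^sub>R (case x of (s, e) \<Rightarrow> \<phi> \<omega> s e) =
            indicat_real {(t, ?y)} x *\<^sub>R \<phi> \<omega> t ?y"
            by (cases x) (auto split: split_indicator)
        qed
        have "emeasure (\<nu>X \<omega>) {(t, ?y)} \<le> emeasure (\<nu>X \<omega>) ({t} \<times> UNIV)"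
          by (intro emeasure_mono) (auto simp: sX strip_borel)
        also have "\<dots> \<le> 1" using comp \<omega> t unfolding compensator_def by blast
        also have "\<dots> < \<infinity>" by simp
        finally have fin: "emeasure (\<nu>X \<omega>) {(t, ?y)} < \<infinity>" .
        note const = integral_on_strip_const[OF \<phi> \<omega> t sX _ fin AE]
        have "\<phi> \<omega> t ?y * measure (\<nu>X \<omega>) {(t, ?y)} = \<phi> \<omega> t ?y"
        proof (cases "\<phi> \<omega> t ?y = 0")
          case False
          then obtain i where "0 < U i \<omega> t ?y" using U_ex t by (metis zero_less_iff_neq_zero)
          then have "emeasure (\<nu>X \<omega>) {(t, ?y)} = 1" using on2 t True by blast
          then show ?thesis by (simp add: measure_def)
        qed simp
        moreover have "jump X \<omega> t = ?y" using on_J t True by blast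
        ultimately show ?thesis
          using const True int_\<mu>X by (simp add: tilde_def hat_def)
      qed
    qed
  qed
qed

end

section \<open>Change of variables in the stochastic integral\<close>

text \<open>
  The characterizing property of the stochastic integral mentions the integrand only through its
  jump process up to indistinguishability, so indistinguishable jump processes lead to the same
  choice.
\<close>

lemma stochastic_integral_cong:
  assumes "indistinguishable M T (tilde \<mu> \<nu> W) (tilde \<mu>' \<nu>' W')"
  shows "stochastic_integral M F T \<mu> \<nu> W = stochastic_integral M F T \<mu>' \<nu>' W'"
proof -
  have "indistinguishable M T Y (tilde \<mu> \<nu> W) \<longleftrightarrow> indistinguishable M T Y (tilde \<mu>' \<nu>' W')" for Y
  proof
    assume "indistinguishable M T Y (tilde \<mu> \<nu> W)"
    with assms show "indistinguishable M T Y (tilde \<mu>' \<nu>' W')"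
      unfolding indistinguishable_def by eventually_elim auto
  next
    assume "indistinguishable M T Y (tilde \<mu>' \<nu>' W')"
    with assms show "indistinguishable M T Y (tilde \<mu> \<nu> W)"
      unfolding indistinguishable_def by eventually_elim auto
  qed
  then show ?thesis unfolding stochastic_integral_def by simp
qed

theorem proposition3p7:
  fixes M :: "'a measure" and F :: "real \<Rightarrow> 'a measure" and T :: real
    and \<mu> \<nu> \<nu>X :: "'a \<Rightarrow> (real \<times> real) measure"
    and X Xi Xp :: "'a \<Rightarrow> real \<Rightarrow> real"
    and \<gamma> \<phi> :: "'a \<Rightarrow> real \<Rightarrow> real \<Rightarrow> real"
    and A :: "(('a \<times> real) \<times> real) set"
  assumes "filtered_prob_space M F T"
    and "integer_valued_random_measure M F T \<mu>"
    and "compensator M F T \<mu> \<nu>"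
    and "equal_ev M T (J_set M T \<nu>) (K_set M T \<nu>)"
    and "cadlag M T X" and "adapted F T X"
    and "indistinguishable M T X (\<lambda>\<omega> t. Xi \<omega> t + Xp \<omega> t)"
    and "cadlag M T Xi" and "adapted F T Xi" and "quasi_left_continuous M F T Xi"
    and "subset_ev M T {(\<omega>, t). jump Xi \<omega> t \<noteq> 0} (D_set M T \<mu>)"
    and "(\<lambda>((\<omega>, t), e). \<gamma> \<omega> t e) \<in> borel_measurable
           (restrict_space (predictable_tilde M F T) ((space M \<times> {0<..T}) \<times> UNIV))"
    and "AE ((\<omega>, t), e) in doleans_measure M T \<mu>. jump Xi \<omega> t * indicator {0<..T} t = \<gamma> \<omega> t e"
    and "cadlag M T Xp" and "(\<lambda>(\<omega>, t). Xp \<omega> t) \<in> borel_measurable (predictable M F T)"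
    and "subset_ev M T {(\<omega>, t). jump Xp \<omega> t \<noteq> 0} (J_set M T \<nu>)"
    and "compensator M F T (jump_measure T X) \<nu>X"
    and "(\<lambda>((\<omega>, t), e). \<phi> \<omega> t e) \<in> borel_measurable (predictable_tilde M F T)"
    and "\<forall>\<omega>\<in>space M. \<forall>t\<in>{0..T}. \<forall>e. 0 \<le> \<phi> \<omega> t e"
    and "indistinguishable M T (\<lambda>\<omega> s. \<phi> \<omega> s 0) (\<lambda>\<omega> s. 0)"
    and "A \<in> sets (predictable_tilde M F T)"
    and "A_plus_loc M F T
           (star (\<lambda>\<omega> s e. ennreal (\<bar>\<phi> \<omega> s e\<bar> * indicator A ((\<omega>, s), e))) (jump_measure T X))"
    and "A_plus_loc M F T
           (star (\<lambda>\<omega> s e. ennreal (\<bar>\<phi> \<omega> s e\<bar>\<^sup>2 * indicator (- A) ((\<omega>, s), e))) (jump_measure T X))"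
  shows "\<phi> \<in> G_loc M F T 1 (jump_measure T X) \<nu>X \<and>
    (\<lambda>\<omega> s e. if 0 < s then \<phi> \<omega> s (\<gamma> \<omega> s e) else 0) \<in> G_loc M F T 1 \<mu> \<nu> \<and>
    indistinguishable M T
      (stochastic_integral M F T (jump_measure T X) \<nu>X \<phi>)
      (stochastic_integral M F T \<mu> \<nu> (\<lambda>\<omega> s e. if 0 < s then \<phi> \<omega> s (\<gamma> \<omega> s e) else 0))"
proof -
  interpret filtered_prob_space M F T by fact
  note \<mu> = assms(2) and comp\<mu> = assms(3) and qlc = assms(10) and \<phi> = assms(18) and compX = assms(17)
  have \<phi>_nonneg: "0 \<le> \<phi> \<omega> t e" if "\<omega> \<in> space M" "t \<in> {0..T}" for \<omega> t e
    using assms(19) that by blast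
  have \<phi>0: "AE \<omega> in M. \<forall>t\<in>{0..T}. \<phi> \<omega> t 0 = 0" using assms(20) by (simp add: indistinguishable_def)
  have \<nu>: "predictable_random_measure M F T \<nu>" and \<nu>X: "predictable_random_measure M F T \<nu>X"
    using comp\<mu> compX by (simp_all add: compensator_def)
  have opt: "optional_random_measure M F T \<mu>" and rm: "random_measure M T \<mu>"
    using \<mu> unfolding integer_valued_random_measure_def optional_random_measure_def by blast+
  have s\<mu>: "sets (\<mu> \<omega>) = sets borel" and s\<nu>: "sets (\<nu> \<omega>) = sets borel" and s\<nu>X: "sets (\<nu>X \<omega>) = sets borel"
    if "\<omega> \<in> space M" for \<omega>
    using optional_random_measure_sets[OF opt that] predictable_random_measure_sets[OF \<nu> that]
      predictable_random_measure_sets[OF \<nu>X that] by auto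
  obtain V where V: "predictable_integrand V" and V_pos: "\<And>\<omega> t e. \<omega> \<in> space M \<Longrightarrow> t \<in> {0..T} \<Longrightarrow> (0::ennreal) < V \<omega> t e"
    and V_fin: "(\<integral>\<^sup>+\<omega>. star V \<mu> \<omega> T \<partial>M) < \<infinity>"
    using \<mu> unfolding integer_valued_random_measure_def by blast
  have V\<nu>_fin: "(\<integral>\<^sup>+\<omega>. star V \<nu> \<omega> T \<partial>M) < \<infinity>"
    using V_fin comp\<mu> V unfolding compensator_def by metis
  have T: "T \<in> {0..T}" using T_pos by auto
  have V\<mu>: "AE \<omega> in M. star V \<mu> \<omega> T < \<infinity>"
    using nn_integral_PInf_AE[OF measurable_F_imp_M[OF T optional_star_adapted[OF opt V T]]] V_fin
    by (auto simp: less_top)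
  obtain p where p: "(\<lambda>(\<omega>, t). p \<omega> t) \<in> borel_measurable (predictable M F T)"
    and p_eq: "\<And>\<omega> t. \<omega> \<in> space M \<Longrightarrow> star V \<nu> \<omega> T < \<infinity> \<Longrightarrow> t \<in> {0..T} \<Longrightarrow> p \<omega> t = atom_integral V \<nu> \<omega> t"
    using atom_integral_predictable_version[OF \<nu> V] by metis
  \<comment> \<open>The set of times charged by \<open>\<nu>\<close>, in a version that is a predictable set.\<close>
  define J where "J = {x \<in> space (predictable M F T). 0 < (case x of (\<omega>, t) \<Rightarrow> p \<omega> t)}"
  have J: "J \<in> sets (predictable M F T)"
    unfolding J_def by (intro borel_measurable_less p borel_measurable_const)
  let ?charged = "\<lambda>\<omega>. \<forall>t\<in>{0..T}. ((\<omega>, t) \<in> J \<longleftrightarrow> 0 < atom_integral V \<nu> \<omega> t) \<and>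
      ((\<omega>, t) \<in> J \<longleftrightarrow> 0 < emeasure (\<nu> \<omega>) ({t} \<times> UNIV))"
  have J_atom: "AE \<omega> in M. ?charged \<omega>"
    using AE_star_finite[OF \<nu> V V\<nu>_fin] AE_space
  proof eventually_elim
    fix \<omega> assume fin: "star V \<nu> \<omega> T < \<infinity>" and \<omega>: "\<omega> \<in> space M"
    show "?charged \<omega>"
    proof
      fix t assume t: "t \<in> {0..T}"
      have "(\<omega>, t) \<in> J \<longleftrightarrow> 0 < atom_integral V \<nu> \<omega> t"
        using p_eq[OF \<omega> fin t] \<omega> t by (simp add: J_def)
      moreover have "0 < atom_integral V \<nu> \<omega> t \<longleftrightarrow> 0 < emeasure (\<nu> \<omega>) ({t} \<times> UNIV)"
        by (rule atom_integral_pos_iff[OF V \<omega> t, of \<nu>, OF s\<nu>[OF \<omega>] V_pos[OF \<omega> t]])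
      ultimately show "((\<omega>, t) \<in> J \<longleftrightarrow> 0 < atom_integral V \<nu> \<omega> t) \<and>
        ((\<omega>, t) \<in> J \<longleftrightarrow> 0 < emeasure (\<nu> \<omega>) ({t} \<times> UNIV))" by simp
    qed
  qed
  let ?split = "\<lambda>\<omega>. \<forall>t\<in>{0..T}. ((\<omega>, t) \<in> J \<longrightarrow> jump Xi \<omega> t = 0 \<and> jump X \<omega> t = jump Xp \<omega> t) \<and>
      ((\<omega>, t) \<notin> J \<longrightarrow> jump X \<omega> t = jump Xi \<omega> t)"
  have jumps: "AE \<omega> in M. ?split \<omega>"
    using J_atom quasi_left_continuous_no_jump_at_atoms[OF \<nu> V V\<nu>_fin qlc] assms(7)[unfolded indistinguishable_def]
      assms(16)[unfolded subset_ev_def] AE_space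
  proof eventually_elim
    fix \<omega> assume 1: "?charged \<omega>"
      and 2: "\<forall>t\<in>{0..T}. 0 < atom_integral V \<nu> \<omega> t \<longrightarrow> jump Xi \<omega> t = 0"
      and 3: "\<forall>t\<in>{0..T}. X \<omega> t = Xi \<omega> t + Xp \<omega> t"
      and 4: "\<forall>t\<in>{0..T}. (\<omega>, t) \<in> {(\<omega>, t). jump Xp \<omega> t \<noteq> 0} \<longrightarrow> (\<omega>, t) \<in> J_set M T \<nu>"
      and \<omega>: "\<omega> \<in> space M"
    have add: "jump X \<omega> t = jump Xi \<omega> t + jump Xp \<omega> t" if "t \<in> {0..T}" for t
      using jump_add[OF assms(8,14) \<omega>, of X t] 3 that by auto
    show "?split \<omega>"
      using 1 2 4 add by (auto simp: J_set_def)
  qed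
  interpret jump_decomposition M F T X Xi Xp \<nu> \<nu>X J
  proof
    show "AE \<omega> in M. \<forall>t\<in>{0..T}. (\<omega>, t) \<in> J \<longrightarrow> jump X \<omega> t = jump Xp \<omega> t"
      using jumps by eventually_elim blast
    show "AE \<omega> in M. \<forall>t\<in>{0..T}. (\<omega>, t) \<notin> J \<longrightarrow> jump X \<omega> t = jump Xi \<omega> t"
      using jumps by eventually_elim blast
    show "AE \<omega> in M. countable {t \<in> {0..T}. (\<omega>, t) \<in> J} \<and> (\<omega>, 0) \<notin> J \<and>
      (\<forall>t\<in>{0..T}. (\<omega>, t) \<in> J \<longrightarrow> emeasure (\<nu> \<omega>) ({t} \<times> UNIV) = 1)"
      using J_atom AE_star_finite[OF \<nu> V V\<nu>_fin] assms(4)[unfolded equal_ev_def] AE_space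
    proof eventually_elim
      fix \<omega> assume 1: "?charged \<omega>"
        and fin: "star V \<nu> \<omega> T < \<infinity>"
        and JK: "\<forall>t\<in>{0..T}. ((\<omega>, t) \<in> J_set M T \<nu>) = ((\<omega>, t) \<in> K_set M T \<nu>)" and \<omega>: "\<omega> \<in> space M"
      have rm\<nu>: "random_measure M T \<nu>" using \<nu> by (simp add: predictable_random_measure_def)
      have "(\<omega>, 0) \<notin> J"
        using 1 atom_integral_eq_0_outside[OF rm\<nu> \<omega>, of 0 V] T_pos by auto
      moreover have "{t \<in> {0..T}. (\<omega>, t) \<in> J} \<subseteq> {t \<in> {0<..T}. 0 < atom_integral V \<nu> \<omega> t}"
        using 1 \<open>(\<omega>, 0) \<notin> J\<close> by (auto simp: less_le)
      then have "countable {t \<in> {0..T}. (\<omega>, t) \<in> J}"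
        by (rule countable_subset[OF _ countable_atoms[OF V \<omega> s\<nu>[OF \<omega>] fin]])
      moreover have "emeasure (\<nu> \<omega>) ({t} \<times> UNIV) = 1" if "t \<in> {0..T}" "(\<omega>, t) \<in> J" for t
        using that JK 1 \<omega> by (auto simp: J_set_def K_set_def)
      ultimately show "countable {t \<in> {0..T}. (\<omega>, t) \<in> J} \<and> (\<omega>, 0) \<notin> J \<and>
        (\<forall>t\<in>{0..T}. (\<omega>, t) \<in> J \<longrightarrow> emeasure (\<nu> \<omega>) ({t} \<times> UNIV) = 1)" by blast
    qed
  qed (use J compX qlc \<nu> predictable_jump[OF assms(14,15)] in auto)

  define W where "W \<omega> s e = (if 0 < s then \<phi> \<omega> s (\<gamma> \<omega> s e) else 0)" for \<omega> s e
  let ?\<Omega> = "(space M \<times> {0<..T}) \<times> (UNIV :: real set)"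
  let ?P = "predictable_tilde M F T"
  have \<Omega>: "?\<Omega> \<inter> space ?P \<in> sets ?P"
  proof -
    have "space M \<times> {0<..T} \<in> sets (predictable M F T)"
      using predictable_rectI[of 0 T "space M"] sets.top[of "F 0"] T_pos by (simp add: space_F)
    then have "?\<Omega> \<in> sets ?P" by (intro pair_measureI) auto
    then show ?thesis by simp
  qed
  have W: "predictable_integrand W"
  proof -
    have "(\<lambda>x. (fst x, \<gamma> (fst (fst x)) (snd (fst x)) (snd x))) \<in> measurable (restrict_space ?P ?\<Omega>) ?P"
      using assms(12) by (intro measurable_Pair measurable_restrict_space1[OF measurable_fst]) (simp_all add: split_beta')
    from measurable_compose[OF this \<phi>]
    have "(\<lambda>x. \<phi> (fst (fst x)) (snd (fst x)) (\<gamma> (fst (fst x)) (snd (fst x)) (snd x)))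
        \<in> borel_measurable (restrict_space ?P ?\<Omega>)" by (simp add: split_beta')
    then have "(\<lambda>x. indicator ?\<Omega> x *\<^sub>R \<phi> (fst (fst x)) (snd (fst x)) (\<gamma> (fst (fst x)) (snd (fst x)) (snd x)))
        \<in> borel_measurable ?P"
      by (subst (asm) borel_measurable_restrict_space_iff[OF \<Omega>])
    then show ?thesis
      by (rule measurable_cong[THEN iffD1, rotated])
        (auto simp: W_def space_pair_measure split: split_indicator if_splits)
  qed
  \<comment> \<open>Since \<open>\<gamma> = \<Delta>X\<^sup>i = 0\<close> almost everywhere over \<open>J\<close> with respect to \<open>\<mu>\<close>, the integral of \<open>W0\<close> vanishes
     for \<open>\<mu>\<close>, hence for \<open>\<nu>\<close>: so \<open>\<gamma> = 0\<close> also \<open>\<nu>\<close>-almost everywhere over \<open>J\<close>.\<close>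
  define W0 where "W0 \<omega> s e = V \<omega> s e * indicator J (\<omega>, s) * (if 0 < s \<and> \<gamma> \<omega> s e \<noteq> 0 then 1 else 0)" for \<omega> s e
  have W0: "predictable_integrand W0"
  proof -
    have "(\<lambda>x. if \<gamma> (fst (fst x)) (snd (fst x)) (snd x) \<noteq> 0 then 1 else 0 :: ennreal)
        \<in> borel_measurable (restrict_space ?P ?\<Omega>)"
      using assms(12) unfolding split_beta' by measurable
    then have 1: "(\<lambda>x. (if \<gamma> (fst (fst x)) (snd (fst x)) (snd x) \<noteq> 0 then 1 else 0 :: ennreal) * indicator ?\<Omega> x)
        \<in> borel_measurable ?P"
      by (subst (asm) borel_measurable_restrict_space_iff_ennreal[OF \<Omega>])
    have "(\<lambda>x. V (fst (fst x)) (snd (fst x)) (snd x) * indicator J (fst (fst x), snd (fst x)) *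
        ((if \<gamma> (fst (fst x)) (snd (fst x)) (snd x) \<noteq> 0 then 1 else 0 :: ennreal) * indicator ?\<Omega> x))
        \<in> borel_measurable ?P"
      using V predictable_set_integrand[OF J, where 'b = ennreal] 1
      unfolding split_beta' by (intro borel_measurable_times_ennreal[OF borel_measurable_times_ennreal 1])
    then show ?thesis
      by (rule measurable_cong[THEN iffD1, rotated])
        (auto simp: W0_def space_pair_measure split: split_indicator if_splits)
  qed
  define j where "j \<omega> t = (if (\<omega>, t) \<in> J then 0 else \<phi> \<omega> t (jump X \<omega> t))" for \<omega> t
  note carried = random_measure_AE_in[OF rm]
  have \<gamma>_AE: "AE \<omega> in M. AE x in \<mu> \<omega>. jump Xi \<omega> (fst x) = \<gamma> \<omega> (fst x) (snd x)"
    using AE_doleans_measure[OF \<mu> assms(13)] AE_space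
  proof eventually_elim
    fix \<omega> assume "AE x in \<mu> \<omega>. (case ((\<omega>, fst x), snd x) of (x, e) \<Rightarrow>
      (case x of (\<omega>, t) \<Rightarrow> \<lambda>e. jump Xi \<omega> t * indicator {0<..T} t = \<gamma> \<omega> t e) e)" and "\<omega> \<in> space M"
    from this(1) carried[OF this(2)] show "AE x in \<mu> \<omega>. jump Xi \<omega> (fst x) = \<gamma> \<omega> (fst x) (snd x)"
      by eventually_elim auto
  qed
  have W0_null: "AE \<omega> in M. \<forall>t\<in>{0..T}. atom_integral W0 \<nu> \<omega> t = 0"
  proof (rule compensator_null_atoms[OF comp\<mu> W0])
    show "AE \<omega> in M. star W0 \<mu> \<omega> T = 0"
      using \<gamma>_AE jumps AE_space
    proof eventually_elim
      fix \<omega> assume 1: "AE x in \<mu> \<omega>. jump Xi \<omega> (fst x) = \<gamma> \<omega> (fst x) (snd x)"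
        and 2: "?split \<omega>" and \<omega>: "\<omega> \<in> space M"
      have "AE x in \<mu> \<omega>. (case x of (s, e) \<Rightarrow> W0 \<omega> s e * indicator {0<..T} s) = 0"
        using 1
      proof eventually_elim
        fix x assume x: "jump Xi \<omega> (fst x) = \<gamma> \<omega> (fst x) (snd x)"
        obtain s e where xe: "x = (s, e)" by force
        have "jump Xi \<omega> s = 0" if "s \<in> {0<..T}" "(\<omega>, s) \<in> J" using 2 that by auto
        then show "(case x of (s, e) \<Rightarrow> W0 \<omega> s e * indicator {0<..T} s) = 0"
          using x by (auto simp: xe W0_def split: split_indicator)
      qed
      then show "star W0 \<mu> \<omega> T = 0" unfolding star_def by (simp cong: nn_integral_cong_AE)
    qed
  qed

  let ?HA = "\<lambda>\<omega> s e. ennreal (\<bar>\<phi> \<omega> s e\<bar> * indicator A ((\<omega>, s), e))"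
  let ?HB = "\<lambda>\<omega> s e. ennreal (\<bar>\<phi> \<omega> s e\<bar>\<^sup>2 * indicator (- A) ((\<omega>, s), e))"
  have indA: "(\<lambda>x. indicat_real A ((fst (fst x), snd (fst x)), snd x)) \<in> borel_measurable ?P"
    using borel_measurable_indicator[OF assms(21)] by simp
  have HA: "predictable_integrand ?HA"
    using \<phi> indA unfolding split_beta' by measurable
  have HB: "predictable_integrand ?HB"
    using \<phi> indA unfolding split_beta' indicator_compl by measurable
  obtain S where S: "localizing M F T S" "\<And>n. A_plus M F T (stopped (S n) (star ?HA (jump_measure T X)))"
    using assms(22) unfolding A_plus_loc_def by blast
  obtain S' where S': "localizing M F T S'" "\<And>n. A_plus M F T (stopped (S' n) (star ?HB (jump_measure T X)))"
    using assms(23) unfolding A_plus_loc_def by blast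
  \<comment> \<open>The integrands of the two hypotheses, cut at their localizing times, are integrable weights. The
     first kind sees \<open>\<phi>\<close> on \<open>A\<close>, the second kind outside \<open>A\<close>.\<close>
  define U where "U i \<omega> s e = (case i of (True, n) \<Rightarrow> ?HA \<omega> s e * indicator {s. ennreal s \<le> S n \<omega>} s
    | (False, n) \<Rightarrow> ?HB \<omega> s e * indicator {s. ennreal s \<le> S' n \<omega>} s)" for i :: "bool \<times> nat" and \<omega> s e
  have UA: "U (True, n) = (\<lambda>\<omega> s e. ?HA \<omega> s e * indicator {s. ennreal s \<le> S n \<omega>} s)"
    and UB: "U (False, n) = (\<lambda>\<omega> s e. ?HB \<omega> s e * indicator {s. ennreal s \<le> S' n \<omega>} s)" for n
    by (auto simp: U_def fun_eq_iff)
  have U_props: "predictable_integrand (U i) \<and> (\<integral>\<^sup>+\<omega>. star (U i) (jump_measure T X) \<omega> T \<partial>M) < \<infinity>" for i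
  proof (cases i)
    case (Pair b n)
    show ?thesis
    proof (cases b)
      case True
      have "is_stopping_time F T (S n)" using S(1) by (simp add: localizing_def)
      then have "predictable_integrand (U (True, n))" unfolding UA by (rule stopped_integrand[OF HA])
      moreover have "(\<integral>\<^sup>+\<omega>. star (U (True, n)) (jump_measure T X) \<omega> T \<partial>M) =
        (\<integral>\<^sup>+\<omega>. stopped (S n) (star ?HA (jump_measure T X)) \<omega> T \<partial>M)"
        unfolding UA using T_pos by (intro nn_integral_cong star_stopped[symmetric]) simp
      ultimately show ?thesis using S(2)[of n] Pair True by (simp add: A_plus_def)
    next
      case False
      have "is_stopping_time F T (S' n)" using S'(1) by (simp add: localizing_def)
      then have "predictable_integrand (U (False, n))" unfolding UB by (rule stopped_integrand[OF HB])
      moreover have "(\<integral>\<^sup>+\<omega>. star (U (False, n)) (jump_measure T X) \<omega> T \<partial>M) =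
        (\<integral>\<^sup>+\<omega>. stopped (S' n) (star ?HB (jump_measure T X)) \<omega> T \<partial>M)"
        unfolding UB using T_pos by (intro nn_integral_cong star_stopped[symmetric]) simp
      ultimately show ?thesis using S'(2)[of n] Pair False by (simp add: A_plus_def)
    qed
  qed
  have U: "predictable_integrand (U i)" and U_fin: "(\<integral>\<^sup>+\<omega>. star (U i) (jump_measure T X) \<omega> T \<partial>M) < \<infinity>" for i
    using U_props[of i] by auto
  have U_ex: "AE \<omega> in M. \<forall>t\<in>{0..T}. \<forall>e. \<phi> \<omega> t e \<noteq> 0 \<longrightarrow> (\<exists>i. U i \<omega> t e \<noteq> 0)"
  proof -
    have "AE \<omega> in M. (SUP n. S n \<omega>) = \<infinity>" "AE \<omega> in M. (SUP n. S' n \<omega>) = \<infinity>"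
      using S(1) S'(1) by (auto simp: localizing_def)
    then show ?thesis
    proof eventually_elim
      fix \<omega> assume 1: "(SUP n. S n \<omega>) = \<infinity>" and 2: "(SUP n. S' n \<omega>) = \<infinity>"
      show "\<forall>t\<in>{0..T}. \<forall>e. \<phi> \<omega> t e \<noteq> 0 \<longrightarrow> (\<exists>i. U i \<omega> t e \<noteq> 0)"
      proof (intro ballI allI impI)
        fix t e assume t: "t \<in> {0..T}" and ne: "\<phi> \<omega> t e \<noteq> 0"
        obtain n where n: "ennreal t < S n \<omega>"
          using 1 by (metis SUP_eq_top_iff ennreal_less_top infinity_ennreal_def UNIV_I)
        obtain m where m: "ennreal t < S' m \<omega>"
          using 2 by (metis SUP_eq_top_iff ennreal_less_top infinity_ennreal_def UNIV_I)
        show "\<exists>i. U i \<omega> t e \<noteq> 0"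
        proof (cases "((\<omega>, t), e) \<in> A")
          case True
          then have "U (True, n) \<omega> t e \<noteq> 0" using n ne by (simp add: UA less_imp_le)
          then show ?thesis by blast
        next
          case False
          then have "U (False, m) \<omega> t e \<noteq> 0" using m ne by (simp add: UB less_imp_le)
          then show ?thesis by blast
        qed
      qed
    qed
  qed
  have U0: "AE \<omega> in M. \<forall>t\<in>{0..T}. U i \<omega> t 0 = 0" for i
    using \<phi>0 by eventually_elim (auto simp: U_def split: prod.split bool.split)
  have tilde_X: "AE \<omega> in M. \<forall>t\<in>{0..T}. tilde (jump_measure T X) \<nu>X \<phi> \<omega> t = ereal (j \<omega> t)"
    unfolding j_def by (rule tilde_jump_measure[OF \<phi> \<phi>0 U U_fin U0 U_ex])

  \<comment> \<open>The integral of \<open>G = W\<^sup>2\<close> with respect to \<open>\<mu>\<close> is the sum of the squares of the \<open>j\<^sub>s\<close>.\<close>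
  define G where "G \<omega> s e = ennreal (W \<omega> s e) * ennreal (W \<omega> s e)" for \<omega> s e
  have G: "predictable_integrand G"
    using W unfolding G_def split_beta' by measurable
  have tilde_\<mu>: "AE \<omega> in M. \<forall>t\<in>{0..T}. tilde \<mu> \<nu> W \<omega> t = ereal (j \<omega> t) \<and>
      atom_integral G \<mu> \<omega> t = (ennreal \<bar>j \<omega> t\<bar>)\<^sup>2"
    using W0_null \<gamma>_AE J_atom \<phi>0 jumps assms(11)[unfolded subset_ev_def] AE_space
  proof eventually_elim
    fix \<omega> assume W0_null: "\<forall>t\<in>{0..T}. atom_integral W0 \<nu> \<omega> t = 0"
      and \<gamma>: "AE x in \<mu> \<omega>. jump Xi \<omega> (fst x) = \<gamma> \<omega> (fst x) (snd x)"
      and J_atom: "?charged \<omega>"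
      and \<phi>0: "\<forall>t\<in>{0..T}. \<phi> \<omega> t 0 = 0"
      and jumps: "?split \<omega>"
      and D: "\<forall>t\<in>{0..T}. (\<omega>, t) \<in> {(\<omega>, t). jump Xi \<omega> t \<noteq> 0} \<longrightarrow> (\<omega>, t) \<in> D_set M T \<mu>"
      and \<omega>: "\<omega> \<in> space M"
    show "\<forall>t\<in>{0..T}. tilde \<mu> \<nu> W \<omega> t = ereal (j \<omega> t) \<and> atom_integral G \<mu> \<omega> t = (ennreal \<bar>j \<omega> t\<bar>)\<^sup>2"
    proof
      fix t assume t: "t \<in> {0..T}"
      let ?B = "{t} \<times> (UNIV :: real set)"
      let ?y = "jump Xi \<omega> t"
      have W_const: "AE x in \<mu> \<omega>. fst x = t \<longrightarrow> W \<omega> t (snd x) = \<phi> \<omega> t ?y"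
        using \<gamma> carried[OF \<omega>] by eventually_elim (auto simp: W_def)
      have le1: "emeasure (\<mu> \<omega>) ?B \<le> 1"
        using \<mu> \<omega> t unfolding integer_valued_random_measure_def by blast
      \<comment> \<open>A jump of \<open>X\<^sup>i\<close> occurs only at a time charged by \<open>\<mu>\<close>, and the mass there is a positive integer
         which is at most \<open>1\<close>.\<close>
      have mass: "emeasure (\<mu> \<omega>) ?B = 1" if "\<phi> \<omega> t ?y \<noteq> 0"
      proof -
        have "?y \<noteq> 0" using that \<phi>0 t by auto
        then have pos: "0 < emeasure (\<mu> \<omega>) ?B" using D t by (auto simp: D_set_def)
        have "?B \<in> sets borel" by (rule strip_borel) simp
        then have "emeasure (\<mu> \<omega>) ?B \<in> range ennreal_of_enat"
          using \<mu> \<omega> unfolding integer_valued_random_measure_def by blast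
        then obtain k where k: "emeasure (\<mu> \<omega>) ?B = ennreal_of_enat k" by blast
        then have "k \<le> 1" using le1 ennreal_of_enat_le_iff[of k 1] by simp
        moreover have "k \<noteq> 0" using pos k by auto
        ultimately have "k = 1" by (cases k) (auto simp: one_enat_def zero_enat_def)
        then show ?thesis using k by simp
      qed
      have "AE x in \<mu> \<omega>. indicat_real ?B x *\<^sub>R (case x of (s, e) \<Rightarrow> W \<omega> s e) = indicat_real ?B x *\<^sub>R \<phi> \<omega> t ?y"
        using W_const by eventually_elim (auto split: split_indicator)
      note const\<mu> = integral_on_strip_const(2)[OF W \<omega> t s\<mu>[OF \<omega>] strip_borel _ this]
      have int\<mu>: "(LINT (s, e):?B|\<mu> \<omega>. W \<omega> s e) = \<phi> \<omega> t ?y"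
      proof -
        have "emeasure (\<mu> \<omega>) ?B < \<infinity>" by (rule le_less_trans[OF le1]) simp
        then have "(LINT (s, e):?B|\<mu> \<omega>. W \<omega> s e) = \<phi> \<omega> t ?y * measure (\<mu> \<omega>) ?B"
          using const\<mu> by simp
        then show ?thesis using mass by (cases "\<phi> \<omega> t ?y = 0") (auto simp: measure_def)
      qed
      have "AE x in \<nu> \<omega>. fst x = t \<longrightarrow> W \<omega> t (snd x) = 0"
      proof (cases "(\<omega>, t) \<in> J")
        case True
        have "AE x in \<nu> \<omega>. fst x = t \<longrightarrow> W0 \<omega> t (snd x) = 0"
          using W0_null t atom_integral_eq_0_iff_AE[OF W0 \<omega> t, of \<nu>, OF s\<nu>[OF \<omega>]] by blast
        then show ?thesis
        proof eventually_elim
          fix x assume x: "fst x = t \<longrightarrow> W0 \<omega> t (snd x) = 0"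
          have "V \<omega> t (snd x) \<noteq> 0" using V_pos[OF \<omega> t, of "snd x"] by auto
          then show "fst x = t \<longrightarrow> W \<omega> t (snd x) = 0"
            using x True \<phi>0 t by (auto simp: W0_def W_def split: if_splits)
        qed
      next
        case False
        then have "\<not> 0 < emeasure (\<nu> \<omega>) ?B" using J_atom t by blast
        then have "emeasure (\<nu> \<omega>) ?B = 0" by (simp add: zero_less_iff_neq_zero)
        then have "AE x in \<nu> \<omega>. fst x \<noteq> t" using strip_null_iff_AE[OF s\<nu>[OF \<omega>]] by blast
        then show ?thesis by eventually_elim simp
      qed
      then have "AE x in \<nu> \<omega>. indicat_real ?B x *\<^sub>R (case x of (s, e) \<Rightarrow> W \<omega> s e) = indicat_real {} x *\<^sub>R 0"
        by eventually_elim (auto split: split_indicator)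
      note const\<nu> = integral_on_strip_const[OF W \<omega> t s\<nu>[OF \<omega>] _ _ this]
      have j_eq: "j \<omega> t = \<phi> \<omega> t ?y"
        using jumps t \<phi>0 by (auto simp: j_def)
      have 1: "tilde \<mu> \<nu> W \<omega> t = ereal (j \<omega> t)"
        using const\<nu> int\<mu> j_eq by (simp add: tilde_def hat_def)
      define c where "c = ennreal (\<phi> \<omega> t ?y) * ennreal (\<phi> \<omega> t ?y)"
      have "atom_integral G \<mu> \<omega> t = (\<integral>\<^sup>+x. c * indicator ?B x \<partial>\<mu> \<omega>)"
        unfolding atom_integral_def
      proof (rule nn_integral_cong_AE)
        show "AE x in \<mu> \<omega>. (case x of (s, e) \<Rightarrow> G \<omega> s e * indicator {t} s) = c * indicator ?B x"
          using W_const by eventually_elim (auto simp: G_def c_def indicator_eq_0_iff split: split_indicator)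
      qed
      also have "\<dots> = c * emeasure (\<mu> \<omega>) ?B"
        by (rule nn_integral_cmult_indicator) (simp add: s\<mu>[OF \<omega>] strip_borel)
      also have "\<dots> = (ennreal \<bar>j \<omega> t\<bar>)\<^sup>2"
      proof (cases "\<phi> \<omega> t ?y = 0")
        case True
        then show ?thesis by (simp add: c_def j_eq)
      next
        case False
        then show ?thesis
          using mass[OF False] \<phi>_nonneg[OF \<omega> t] by (simp add: c_def j_eq power2_eq_square)
      qed
      finally show "tilde \<mu> \<nu> W \<omega> t = ereal (j \<omega> t) \<and> atom_integral G \<mu> \<omega> t = (ennreal \<bar>j \<omega> t\<bar>)\<^sup>2"
        using 1 by simp
    qed
  qed

  \<comment> \<open>Membership depends only on the jump process, so one argument serves both integrands.\<close>
  have G_locI: "W' \<in> G_loc M F T 1 \<mu>' \<nu>'"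
    if W': "predictable_integrand W'"
      and tilde: "AE \<omega> in M. \<forall>t\<in>{0..T}. tilde \<mu>' \<nu>' W' \<omega> t = ereal (j \<omega> t)" for W' \<mu>' \<nu>'
  proof -
    let ?Q = "\<lambda>\<omega> t. \<integral>\<^sup>+s. (e2ennreal \<bar>tilde \<mu>' \<nu>' W' \<omega> s\<bar>)\<^sup>2 \<partial>count_space {0..t}"
    have Q_eq: "AE \<omega> in M. \<forall>t\<in>{0..T}. ?Q \<omega> t = (\<integral>\<^sup>+s. (ennreal \<bar>j \<omega> s\<bar>)\<^sup>2 \<partial>count_space {0..t})"
      using tilde by eventually_elim (auto intro!: nn_integral_cong)
    have "A_plus_loc M F T (\<lambda>\<omega> t. powr_ennreal (?Q \<omega> t) (1 / 2))"
    proof (rule A_plus_loc_sqrt_star[OF opt G _ S S'])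
      show "AE \<omega> in M. \<forall>t\<in>{0..T}. powr_ennreal (?Q \<omega> t) (1 / 2) = powr_ennreal (star G \<mu> \<omega> t) (1 / 2)"
        using Q_eq tilde_\<mu> V\<mu> AE_space
      proof eventually_elim
        fix \<omega> assume Q: "\<forall>t\<in>{0..T}. ?Q \<omega> t = (\<integral>\<^sup>+s. (ennreal \<bar>j \<omega> s\<bar>)\<^sup>2 \<partial>count_space {0..t})"
          and atom: "\<forall>t\<in>{0..T}. tilde \<mu> \<nu> W \<omega> t = ereal (j \<omega> t) \<and> atom_integral G \<mu> \<omega> t = (ennreal \<bar>j \<omega> t\<bar>)\<^sup>2"
          and V\<mu>: "star V \<mu> \<omega> T < \<infinity>" and \<omega>: "\<omega> \<in> space M"
        show "\<forall>t\<in>{0..T}. powr_ennreal (?Q \<omega> t) (1 / 2) = powr_ennreal (star G \<mu> \<omega> t) (1 / 2)"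
        proof
          fix t assume t: "t \<in> {0..T}"
          have "star G \<mu> \<omega> t = (\<integral>\<^sup>+s. atom_integral G \<mu> \<omega> s \<partial>count_space {0..t})"
            by (rule star_eq_sum_over_atoms[OF \<mu> V V_pos[OF \<omega>] \<omega> V\<mu> G t])
          also have "\<dots> = (\<integral>\<^sup>+s. (ennreal \<bar>j \<omega> s\<bar>)\<^sup>2 \<partial>count_space {0..t})"
            using atom t by (intro nn_integral_cong) auto
          finally show "powr_ennreal (?Q \<omega> t) (1 / 2) = powr_ennreal (star G \<mu> \<omega> t) (1 / 2)"
            using Q t by simp
        qed
      qed
      show "AE \<omega> in M. \<forall>t\<in>{0..T}. powr_ennreal (?Q \<omega> t) (1 / 2)
          \<le> star ?HA (jump_measure T X) \<omega> t + 1 + star ?HB (jump_measure T X) \<omega> t"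
        using Q_eq \<phi>0 AE_space
      proof eventually_elim
        fix \<omega> assume Q: "\<forall>t\<in>{0..T}. ?Q \<omega> t = (\<integral>\<^sup>+s. (ennreal \<bar>j \<omega> s\<bar>)\<^sup>2 \<partial>count_space {0..t})"
          and \<phi>0: "\<forall>t\<in>{0..T}. \<phi> \<omega> t 0 = 0" and \<omega>: "\<omega> \<in> space M"
        show "\<forall>t\<in>{0..T}. powr_ennreal (?Q \<omega> t) (1 / 2)
          \<le> star ?HA (jump_measure T X) \<omega> t + 1 + star ?HB (jump_measure T X) \<omega> t"
        proof
          fix t assume t: "t \<in> {0..T}"
          have "?Q \<omega> t \<le> star ?HA (jump_measure T X) \<omega> t * star ?HA (jump_measure T X) \<omega> t
            + star ?HB (jump_measure T X) \<omega> t"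
            unfolding Q[rule_format, OF t]
          proof (rule sum_of_squared_jumps_le[OF HA HB \<omega> t])
            fix s assume "s \<in> {0..t}" "s = 0 \<or> jump X \<omega> s = 0"
            then show "(ennreal \<bar>j \<omega> s\<bar>)\<^sup>2 = 0" using \<phi>0 t by (auto simp: j_def jump_def)
          next
            fix s assume s: "s \<in> {0<..t}"
            let ?x = "jump X \<omega> s"
            have "(ennreal \<bar>j \<omega> s\<bar>)\<^sup>2 \<le> (ennreal \<bar>\<phi> \<omega> s ?x\<bar>)\<^sup>2" by (simp add: j_def)
            also have "\<dots> \<le> ?HA \<omega> s ?x * ?HA \<omega> s ?x + ?HB \<omega> s ?x"
              by (cases "((\<omega>, s), ?x) \<in> A") (simp_all add: power2_eq_square flip: ennreal_mult)
            finally show "(ennreal \<bar>j \<omega> s\<bar>)\<^sup>2 \<le> ?HA \<omega> s ?x * ?HA \<omega> s ?x + ?HB \<omega> s ?x" .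
          qed
          then show "powr_ennreal (?Q \<omega> t) (1 / 2)
            \<le> star ?HA (jump_measure T X) \<omega> t + 1 + star ?HB (jump_measure T X) \<omega> t"
            by (rule powr_ennreal_half_le)
        qed
      qed
    qed (auto intro: star_mono)
    then show ?thesis using W' by (simp add: G_loc_def)
  qed
  have tilde_W: "AE \<omega> in M. \<forall>t\<in>{0..T}. tilde \<mu> \<nu> W \<omega> t = ereal (j \<omega> t)"
    using tilde_\<mu> by eventually_elim blast
  have "indistinguishable M T (tilde (jump_measure T X) \<nu>X \<phi>) (tilde \<mu> \<nu> W)"
    unfolding indistinguishable_def using tilde_X tilde_W by eventually_elim simp
  then have "stochastic_integral M F T (jump_measure T X) \<nu>X \<phi> = stochastic_integral M F T \<mu> \<nu> W"
    by (rule stochastic_integral_cong)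
  moreover have "W = (\<lambda>\<omega> s e. if 0 < s then \<phi> \<omega> s (\<gamma> \<omega> s e) else 0)"
    by (simp add: W_def fun_eq_iff)
  ultimately show ?thesis
    using G_locI[OF \<phi> tilde_X] G_locI[OF W tilde_W] by (simp add: indistinguishable_def)
qed

end
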